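(* Let $G$ be a connected chordal graph. Then $G$ is a path graph if and only if, for every clique separator $Q$ of $G$, $\Gamma_Q$ has no full antipodal triple and $G$ is weak $Q$-colorable.
   Context: All graphs are finite, simple and undirected. A graph $G$ is a path graph if there are a tree $T$, a collection $\mathcal P$ of paths of $T$ and a bijection $\phi:V(G)\to\mathcal P$ such that $u,v\in V(G)$ are adjacent if and only if the vertex sets of $\phi(u)$ and $\phi(v)$ intersect. Chordal: no induced cycle of length at least four. For $n\in\mathbb N$, $[n]=\{1,\dots,n\}$. The word "clique" means an inclusion-wise maximal set of pairwise adjacent vertices. A clique separator of a connected graph $G$ is a clique $Q$ of $G$ such that $G-Q$ has at least two connected components. Let $V_1,\dots,V_s$ be the vertex sets of the components of $G-Q$, $\gamma_i=G[V_i\cup Q]$ and $\Gamma_Q=\{\gamma_1,\dots,\gamma_s\}$. A relevant clique of $\gamma\in\Gamma_Q$ is a clique $K$ of $\gamma$ with $K\cap Q\neq\emptyset$ and $K\neq Q$. For $v\in Q$, $\gamma$ is a neighboring subgraph of $v$ if $v$ belongs to some relevant clique of $\gamma$. A subset $W\subseteq\Gamma_Q$ is a neighboring set (pair, triple, ...) if there is $v\in Q$ such that every element of $W$ is a neighboring subgraph of $v$. Relations on $\Gamma_Q$. Attachedness: $\gamma\bowtie\gamma'$ iff there are relevant cliques $K$ of $\gamma$ and $K'$ of $\gamma'$ with $K\cap K'\cap Q\neq\emptyset$. Dominance: $\gamma\leq\gamma$ always; for $\gamma\ne\gamma'$, $\gamma\leq\gamma'$ iff $\gamma\bowtie\gamma'$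 and for each relevant clique $K'$ of $\gamma'$ either $K\cap Q\subseteq K'\cap Q$ for every relevant clique $K$ of $\gamma$, or $K\cap K'\cap Q=\emptyset$ for every relevant clique $K$ of $\gamma$. Antipodality: $\gamma\leftrightarrow\gamma'$ iff $\gamma\bowtie\gamma'$, $\gamma\not\leq\gamma'$ and $\gamma'\not\leq\gamma$. A full antipodal triple is a neighboring triple whose three elements are pairwise antipodal. Dominance is a preorder; let $\gamma\sim\gamma'$ iff $\gamma\leq\gamma'$ and $\gamma'\leq\gamma$. Equivalent elements have the same relations to all other elements and are neighboring subgraphs of the same vertices. By convention $\Gamma_Q$ is identified with $\Gamma_Q/\!\sim$ (relations being those of representatives), so that $(\Gamma_Q,\leq)$ is a partial order. Let $\mathrm{Upper}_Q$ be the set of $\leq$-maximal elements of $\Gamma_Q$, with a fixed (arbitrary) ordering $(u_1,\dots,u_\ell)$. For $i\in[\ell]$ let $D_i=\{\gamma\in\Gamma_Q: \gamma\leq u_i,\ \gamma\not\leq u_j\ \forall j\in[\ell]\setminus\{i\}\}$; for $i<j$ in $[\ell]$ let $D_{i,j}=\{\gamma\in\Gamma_Q:\gamma\leq u_i,\ \gamma\leq u_j,\ \gamma\not\leq u_k\ \forall k\in[\ell]\setminus\{i,j\}\}$. Let $\mathcal D=\{D_i: i\in[\ell]\}\cup\{D_{i,j}: i<j\}$. Let $\mathrm{Cross}_Q=\{\gamma\in\Gamma_Q:\ \gamma\in D\text{ for some }D\in\mathcal D\text{ and }\gamma\leftrightarrow\gamma'\text{ for some }\gamma'\notin D\}$.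 A map $f:\mathrm{Upper}_Q\cup\mathrm{Cross}_Q\to[\ell]$ is a partial $Q$-coloring if: (i) $f(u_i)=i$ for all $i\in[\ell]$; (ii) for all $i\in[\ell]$ and $\gamma\in D_i$, if there is $\gamma'\notin D_i$ with $\gamma\leftrightarrow\gamma'$, then $f(\gamma)=i$; (iii) for all $i<j$ in $[\ell]$, $\gamma\in D_{i,j}$ and every $\gamma'\notin D_{i,j}$ with $\gamma\leftrightarrow\gamma'$: $f(\gamma)=i$ if $\gamma'\in D_j$, and $f(\gamma)=j$ if $\gamma'\in D_i$. $G$ is weak $Q$-colorable if there is $f:\Gamma_Q\to[\ell+1]$ whose restriction to $\mathrm{Upper}_Q\cup\mathrm{Cross}_Q$ is a partial $Q$-coloring and such that: (iv) $f(D_i)\subseteq\{i,\ell+1\}$ for all $i\in[\ell]$; (v) $f(D_{i,j})\subseteq\{i,j\}$ for all $i<j$ in $[\ell]$; (vi) for all $D\in\mathcal D$, if $\gamma,\gamma'\in D$ and $\gamma\leftrightarrow\gamma'$ then $f(\gamma)\neq f(\gamma')$. *)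

theory Defs
  imports "Graph_Theory.Digraph_Component" "Graph_Theory.Vertex_Walk"
begin

text \<open>
  A finite simple undirected graph is a \<open>graph\<close> in the sense of \<^theory>\<open>Graph_Theory.Digraph\<close>:
  a finite symmetric digraph without loops and parallel arcs.  The library predicates
  \<open>forest\<close> and \<open>tree\<close> are not usable for such graphs, because there the closed walk \<open>a, b, a\<close>
  along an edge and back counts as a cycle.
\<close>

definition graph_cycle :: "('a,'b) pre_digraph \<Rightarrow> 'a list \<Rightarrow> bool" where
  "graph_cycle G xs \<longleftrightarrow> 3 \<le> length xs \<and> vpath xs G \<and> last xs \<rightarrow>\<^bsub>G\<^esub> hd xs"

definition graph_tree :: "('a,'b) pre_digraph \<Rightarrow> bool" where
  "graph_tree T \<longleftrightarrow> graph T \<and> Digraph_Component.connected T \<and> (\<nexists>xs. graph_cycle T xs)"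

definition induced_cycle :: "('a,'b) pre_digraph \<Rightarrow> 'a list \<Rightarrow> bool" where
  "induced_cycle G xs \<longleftrightarrow> graph_cycle G xs \<and>
     (\<forall>i < length xs. \<forall>j < length xs. xs ! i \<rightarrow>\<^bsub>G\<^esub> xs ! j \<longrightarrow>
        j = Suc i mod length xs \<or> i = Suc j mod length xs)"

definition chordal :: "('a,'b) pre_digraph \<Rightarrow> bool" where
  "chordal G \<longleftrightarrow> (\<nexists>xs. induced_cycle G xs \<and> 4 \<le> length xs)"

text \<open>
  Paths of \<open>T\<close> are subgraphs of \<open>T\<close>, so a path and its reversal are the same path.
  A single vertex is a path.
\<close>

definition path_of :: "('a,'b) pre_digraph \<Rightarrow> ('a,'b) pre_digraph \<Rightarrow> bool" where
  "path_of T P \<longleftrightarrow> subgraph P T \<and>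
     (\<exists>xs. vpath xs T \<and> verts P = set xs \<and>
           arcs_ends P = set (vwalk_arcs xs) \<union> (set (vwalk_arcs xs))\<inverse>)"

text \<open>Since trees are finite, it is no restriction to take their vertices in \<^typ>\<open>nat\<close>.\<close>

definition path_graph :: "('a,'b) pre_digraph \<Rightarrow> bool" where
  "path_graph G \<longleftrightarrow>
     (\<exists>(T :: (nat, nat \<times> nat) pre_digraph) \<P> \<phi>.
        graph_tree T \<and> (\<forall>P\<in>\<P>. path_of T P) \<and> bij_betw \<phi> (verts G) \<P> \<and>
        (\<forall>u\<in>verts G. \<forall>v\<in>verts G. u \<noteq> v \<longrightarrow>
           (u \<rightarrow>\<^bsub>G\<^esub> v \<longleftrightarrow> verts (\<phi> u) \<inter> verts (\<phi> v) \<noteq> {})))"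

definition pairwise_adjacent :: "('a,'b) pre_digraph \<Rightarrow> 'a set \<Rightarrow> bool" where
  "pairwise_adjacent G K \<longleftrightarrow> K \<subseteq> verts G \<and> (\<forall>u\<in>K. \<forall>v\<in>K. u \<noteq> v \<longrightarrow> u \<rightarrow>\<^bsub>G\<^esub> v)"

definition clique :: "('a,'b) pre_digraph \<Rightarrow> 'a set \<Rightarrow> bool" where
  "clique G K \<longleftrightarrow> pairwise_adjacent G K \<and> (\<forall>K'. pairwise_adjacent G K' \<and> K \<subseteq> K' \<longrightarrow> K' = K)"

text \<open>For symmetric digraphs, strongly connected components are the connected components.\<close>

definition comps_minus :: "('a,'b) pre_digraph \<Rightarrow> 'a set \<Rightarrow> 'a set set" where
  "comps_minus G Q = pre_digraph.sccs_verts (G \<restriction> (verts G - Q))"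

definition clique_separator :: "('a,'b) pre_digraph \<Rightarrow> 'a set \<Rightarrow> bool" where
  "clique_separator G Q \<longleftrightarrow> clique G Q \<and> 2 \<le> card (comps_minus G Q)"

definition Gamma :: "('a,'b) pre_digraph \<Rightarrow> 'a set \<Rightarrow> ('a,'b) pre_digraph set" where
  "Gamma G Q = (\<lambda>C. G \<restriction> (C \<union> Q)) ` comps_minus G Q"

definition relevant_cliques :: "'a set \<Rightarrow> ('a,'b) pre_digraph \<Rightarrow> 'a set set" where
  "relevant_cliques Q \<gamma> = {K. clique \<gamma> K \<and> K \<inter> Q \<noteq> {} \<and> K \<noteq> Q}"

definition neighboring_subgraph :: "'a set \<Rightarrow> 'a \<Rightarrow> ('a,'b) pre_digraph \<Rightarrow> bool" where
  "neighboring_subgraph Q v \<gamma> \<longleftrightarrow> (\<exists>K\<in>relevant_cliques Q \<gamma>. v \<in> K)"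

definition neighboring_set ::
    "('a,'b) pre_digraph \<Rightarrow> 'a set \<Rightarrow> ('a,'b) pre_digraph set \<Rightarrow> bool" where
  "neighboring_set G Q W \<longleftrightarrow> W \<subseteq> Gamma G Q \<and> (\<exists>v\<in>Q. \<forall>\<gamma>\<in>W. neighboring_subgraph Q v \<gamma>)"

definition attached :: "'a set \<Rightarrow> ('a,'b) pre_digraph \<Rightarrow> ('a,'b) pre_digraph \<Rightarrow> bool" where
  "attached Q \<gamma> \<gamma>' \<longleftrightarrow>
     (\<exists>K\<in>relevant_cliques Q \<gamma>. \<exists>K'\<in>relevant_cliques Q \<gamma>'. K \<inter> K' \<inter> Q \<noteq> {})"

definition dominated :: "'a set \<Rightarrow> ('a,'b) pre_digraph \<Rightarrow> ('a,'b) pre_digraph \<Rightarrow> bool" where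
  "dominated Q \<gamma> \<gamma>' \<longleftrightarrow> \<gamma> = \<gamma>' \<or>
     (attached Q \<gamma> \<gamma>' \<and>
      (\<forall>K'\<in>relevant_cliques Q \<gamma>'.
         (\<forall>K\<in>relevant_cliques Q \<gamma>. K \<inter> Q \<subseteq> K' \<inter> Q) \<or>
         (\<forall>K\<in>relevant_cliques Q \<gamma>. K \<inter> K' \<inter> Q = {})))"

definition antipodal :: "'a set \<Rightarrow> ('a,'b) pre_digraph \<Rightarrow> ('a,'b) pre_digraph \<Rightarrow> bool" where
  "antipodal Q \<gamma> \<gamma>' \<longleftrightarrow> attached Q \<gamma> \<gamma>' \<and> \<not> dominated Q \<gamma> \<gamma>' \<and> \<not> dominated Q \<gamma>' \<gamma>"

definition full_antipodal_triple ::
    "('a,'b) pre_digraph \<Rightarrow> 'a set \<Rightarrow> ('a,'b) pre_digraph set \<Rightarrow> bool" where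
  "full_antipodal_triple G Q W \<longleftrightarrow> neighboring_set G Q W \<and> card W = 3 \<and>
     (\<forall>\<gamma>\<in>W. \<forall>\<gamma>'\<in>W. \<gamma> \<noteq> \<gamma>' \<longrightarrow> antipodal Q \<gamma> \<gamma>')"

definition dom_equiv ::
    "('a,'b) pre_digraph \<Rightarrow> 'a set \<Rightarrow> (('a,'b) pre_digraph \<times> ('a,'b) pre_digraph) set" where
  "dom_equiv G Q =
     {(\<gamma>, \<gamma>'). \<gamma> \<in> Gamma G Q \<and> \<gamma>' \<in> Gamma G Q \<and> dominated Q \<gamma> \<gamma>' \<and> dominated Q \<gamma>' \<gamma>}"

text \<open>
  From here on, elements of \<open>\<Gamma>\<^sub>Q\<close> are equivalence classes under mutual dominance.  Relations
  between classes are those of representatives; as mutually dominating subgraphs have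
  the same relations to all others, asking for some pair of representatives is the
  same as asking for all pairs.
\<close>

definition Gamma_classes ::
    "('a,'b) pre_digraph \<Rightarrow> 'a set \<Rightarrow> ('a,'b) pre_digraph set set" where
  "Gamma_classes G Q = Gamma G Q // dom_equiv G Q"

definition cl_dominated ::
    "'a set \<Rightarrow> ('a,'b) pre_digraph set \<Rightarrow> ('a,'b) pre_digraph set \<Rightarrow> bool" where
  "cl_dominated Q A B \<longleftrightarrow> (\<exists>\<gamma>\<in>A. \<exists>\<gamma>'\<in>B. dominated Q \<gamma> \<gamma>')"

definition cl_antipodal ::
    "'a set \<Rightarrow> ('a,'b) pre_digraph set \<Rightarrow> ('a,'b) pre_digraph set \<Rightarrow> bool" where
  "cl_antipodal Q A B \<longleftrightarrow> (\<exists>\<gamma>\<in>A. \<exists>\<gamma>'\<in>B. antipodal Q \<gamma> \<gamma>')"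

definition Upper :: "('a,'b) pre_digraph \<Rightarrow> 'a set \<Rightarrow> ('a,'b) pre_digraph set set" where
  "Upper G Q =
     {A \<in> Gamma_classes G Q. \<forall>B\<in>Gamma_classes G Q. cl_dominated Q A B \<longrightarrow> B = A}"

definition upper_ordering ::
    "('a,'b) pre_digraph \<Rightarrow> 'a set \<Rightarrow> (nat \<Rightarrow> ('a,'b) pre_digraph set) \<Rightarrow> bool" where
  "upper_ordering G Q u \<longleftrightarrow> bij_betw u {1..card (Upper G Q)} (Upper G Q)"

definition D_single :: "('a,'b) pre_digraph \<Rightarrow> 'a set \<Rightarrow> (nat \<Rightarrow> ('a,'b) pre_digraph set)
    \<Rightarrow> nat \<Rightarrow> ('a,'b) pre_digraph set set" where
  "D_single G Q u i =
     {A \<in> Gamma_classes G Q. cl_dominated Q A (u i) \<and>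
        (\<forall>k\<in>{1..card (Upper G Q)} - {i}. \<not> cl_dominated Q A (u k))}"

definition D_pair :: "('a,'b) pre_digraph \<Rightarrow> 'a set \<Rightarrow> (nat \<Rightarrow> ('a,'b) pre_digraph set)
    \<Rightarrow> nat \<Rightarrow> nat \<Rightarrow> ('a,'b) pre_digraph set set" where
  "D_pair G Q u i j =
     {A \<in> Gamma_classes G Q. cl_dominated Q A (u i) \<and> cl_dominated Q A (u j) \<and>
        (\<forall>k\<in>{1..card (Upper G Q)} - {i, j}. \<not> cl_dominated Q A (u k))}"

definition D_family :: "('a,'b) pre_digraph \<Rightarrow> 'a set \<Rightarrow> (nat \<Rightarrow> ('a,'b) pre_digraph set)
    \<Rightarrow> ('a,'b) pre_digraph set set set" where
  "D_family G Q u =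
     {D_single G Q u i | i. i \<in> {1..card (Upper G Q)}} \<union>
     {D_pair G Q u i j | i j. i \<in> {1..card (Upper G Q)} \<and> j \<in> {1..card (Upper G Q)} \<and> i < j}"

definition Cross :: "('a,'b) pre_digraph \<Rightarrow> 'a set \<Rightarrow> (nat \<Rightarrow> ('a,'b) pre_digraph set)
    \<Rightarrow> ('a,'b) pre_digraph set set" where
  "Cross G Q u =
     {A \<in> Gamma_classes G Q. \<exists>D\<in>D_family G Q u. A \<in> D \<and>
        (\<exists>B\<in>Gamma_classes G Q - D. cl_antipodal Q A B)}"

text \<open>Only the values of \<open>f\<close> on \<open>Upper G Q \<union> Cross G Q u\<close> matter here.\<close>

definition partial_coloring :: "('a,'b) pre_digraph \<Rightarrow> 'a set
    \<Rightarrow> (nat \<Rightarrow> ('a,'b) pre_digraph set) \<Rightarrow> (('a,'b) pre_digraph set \<Rightarrow> nat) \<Rightarrow> bool" where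
  "partial_coloring G Q u f \<longleftrightarrow>
     (let l = card (Upper G Q) in
      f ` (Upper G Q \<union> Cross G Q u) \<subseteq> {1..l} \<and>
      (\<forall>i\<in>{1..l}. f (u i) = i) \<and>
      (\<forall>i\<in>{1..l}. \<forall>A\<in>D_single G Q u i.
         (\<exists>B\<in>Gamma_classes G Q - D_single G Q u i. cl_antipodal Q A B) \<longrightarrow> f A = i) \<and>
      (\<forall>i\<in>{1..l}. \<forall>j\<in>{1..l}. i < j \<longrightarrow>
         (\<forall>A\<in>D_pair G Q u i j. \<forall>B\<in>Gamma_classes G Q - D_pair G Q u i j.
            cl_antipodal Q A B \<longrightarrow>
              (B \<in> D_single G Q u j \<longrightarrow> f A = i) \<and> (B \<in> D_single G Q u i \<longrightarrow> f A = j))))"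

definition weak_colorable :: "('a,'b) pre_digraph \<Rightarrow> 'a set
    \<Rightarrow> (nat \<Rightarrow> ('a,'b) pre_digraph set) \<Rightarrow> bool" where
  "weak_colorable G Q u \<longleftrightarrow>
     (let l = card (Upper G Q) in
      \<exists>f. f ` Gamma_classes G Q \<subseteq> {1..l + 1} \<and>
        partial_coloring G Q u f \<and>
        (\<forall>i\<in>{1..l}. f ` D_single G Q u i \<subseteq> {i, l + 1}) \<and>
        (\<forall>i\<in>{1..l}. \<forall>j\<in>{1..l}. i < j \<longrightarrow> f ` D_pair G Q u i j \<subseteq> {i, j}) \<and>
        (\<forall>D\<in>D_family G Q u. \<forall>A\<in>D. \<forall>B\<in>D. cl_antipodal Q A B \<longrightarrow> f A \<noteq> f B))"

end

theory Submission
  imports Defs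
begin

text \<open>
  Both conditions together are equivalent to a coloring of \<open>\<Gamma>\<^sub>Q\<close> as in the theorem of Monma and
  Wei: antipodal elements get different colors, and the neighboring subgraphs of each \<open>v\<close> in \<open>Q\<close>
  use at most two colors.  A weak coloring already has this property, because without full
  antipodal triples at most two maximal elements are neighboring subgraphs of the same \<open>v\<close>;
  conversely, one compares the color of an element with those of the maximal elements above it.

  In a path graph, the paths of the vertices of \<open>Q\<close> share a node \<open>q\<close> of the tree, and every
  element of \<open>\<Gamma>\<^sub>Q\<close> lives in one branch at \<open>q\<close>; these branches are the colors.

  Conversely, a clique tree in which every vertex occupies a path is built by induction, as the
  colorings are inherited by the elements of \<open>\<Gamma>\<^sub>Q\<close>.  The trees of the elements of one color
  are hung below each other, dominated elements last, so that every vertex of \<open>Q\<close> occupies a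
  chain starting at \<open>Q\<close>; gluing the colors at \<open>Q\<close> joins at most two chains per vertex.
  A chordal graph without clique separators has at most two maximal cliques.
\<close>

section \<open>Weak colorings and colorings in the sense of Monma and Wei\<close>

text \<open>Dominance of one element over another sees the lower one only through its foot, the set
  of vertices of \<open>Q\<close> with a neighbor in the component: every maximal clique on the
  upper side must contain this foot or miss it. This is what makes hanging possible. If a foot has
  this property for all cliques already placed, its vertices occupy the same nodes there, their
  chains from \<open>Q\<close> end at one node, and the new tree goes below that node without
  branching any chain. A single element contributes only one chain per vertex of \<open>Q\<close>,
  because its component is connected and so \<open>Q\<close> has just one child in its tree.

  Gluing needs trees rooted at the separator, while the separator found in the induction may differ
  from the prescribed root; hence clique trees are built for every root and can be rerooted.

  In a weak coloring, the extra color \<open>l + 1\<close> is the second color next to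
  \<open>i\<close> at a vertex with only one maximal element \<open>u i\<close>.\<close>

lemma attached_iff:
  "attached Q \<gamma> \<gamma>' \<longleftrightarrow>
     (\<exists>v\<in>Q. neighboring_subgraph Q v \<gamma> \<and> neighboring_subgraph Q v \<gamma>')"
  by (auto simp: attached_def neighboring_subgraph_def)

lemma dominated_refl [simp]: "dominated Q \<gamma> \<gamma>"
  by (simp add: dominated_def)

text \<open>Attachedness yields one clique \<open>K'\<close> for which the disjointness alternative
  fails; this \<open>K'\<close> alone contains the traces on \<open>Q\<close> of all relevant
  cliques of \<gamma>.\<close>

lemma dominated_neighboring:
  assumes "dominated Q \<gamma> \<gamma>'" "v \<in> Q" "neighboring_subgraph Q v \<gamma>"
  shows "neighboring_subgraph Q v \<gamma>'"
proof (cases "\<gamma> = \<gamma>'")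
  case False
  then obtain K0 K' where K: "K0 \<in> relevant_cliques Q \<gamma>" "K' \<in> relevant_cliques Q \<gamma>'"
    "K0 \<inter> K' \<inter> Q \<noteq> {}"
    using assms(1) unfolding dominated_def attached_def by auto
  have "(\<forall>K\<in>relevant_cliques Q \<gamma>. K \<inter> Q \<subseteq> K' \<inter> Q) \<or>
      (\<forall>K\<in>relevant_cliques Q \<gamma>. K \<inter> K' \<inter> Q = {})"
    using assms(1) False K(2) unfolding dominated_def by simp
  then have "\<forall>K\<in>relevant_cliques Q \<gamma>. K \<inter> Q \<subseteq> K' \<inter> Q" using K by meson
  with K(2) show ?thesis using assms(2,3) by (auto simp: neighboring_subgraph_def)
qed (use assms in simp)

text \<open>A single clique \<open>K'\<close> of the middle element contains all traces of the lower
  one, so whichever alternative holds between \<open>K'\<close> and \<open>K''\<close> is inherited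
  by them.\<close>

lemma dominated_trans:
  assumes "dominated Q \<gamma> \<gamma>'" "dominated Q \<gamma>' \<gamma>''"
  shows "dominated Q \<gamma> \<gamma>''"
proof (cases "\<gamma> = \<gamma>' \<or> \<gamma>' = \<gamma>''")
  case True
  then show ?thesis using assms by auto
next
  case False
  then have att: "attached Q \<gamma> \<gamma>'" using assms by (simp add: dominated_def)
  then obtain K0 K' where K0: "K0 \<in> relevant_cliques Q \<gamma>"
    and K': "K' \<in> relevant_cliques Q \<gamma>'" and ne: "K0 \<inter> K' \<inter> Q \<noteq> {}"
    by (auto simp: attached_def)
  have sub: "K \<inter> Q \<subseteq> K' \<inter> Q" if "K \<in> relevant_cliques Q \<gamma>" for K
    using assms(1) False K0 K' ne that unfolding dominated_def by blast
  have att2: "attached Q \<gamma> \<gamma>''"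
    using att dominated_neighboring[OF assms(2)] by (auto simp: attached_iff)
  have "(\<forall>K\<in>relevant_cliques Q \<gamma>. K \<inter> Q \<subseteq> K'' \<inter> Q) \<or>
        (\<forall>K\<in>relevant_cliques Q \<gamma>. K \<inter> K'' \<inter> Q = {})"
    if "K'' \<in> relevant_cliques Q \<gamma>''" for K''
    using assms(2) False that sub K' unfolding dominated_def by blast
  with att2 show ?thesis by (simp add: dominated_def)
qed

text \<open>The colorings of Monma and Wei.\<close>

definition strong_coloring ::
    "('a,'b) pre_digraph \<Rightarrow> 'a set \<Rightarrow> (('a,'b) pre_digraph \<Rightarrow> nat) \<Rightarrow> bool" where
  "strong_coloring G Q g \<longleftrightarrow>
     (\<forall>\<gamma>\<in>Gamma G Q. \<forall>\<gamma>'\<in>Gamma G Q. antipodal Q \<gamma> \<gamma>' \<longrightarrow> g \<gamma> \<noteq> g \<gamma>') \<and>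
     (\<forall>v\<in>Q. \<forall>\<gamma>\<in>Gamma G Q. \<forall>\<gamma>'\<in>Gamma G Q. \<forall>\<gamma>''\<in>Gamma G Q.
        neighboring_subgraph Q v \<gamma> \<and> neighboring_subgraph Q v \<gamma>' \<and>
        neighboring_subgraph Q v \<gamma>'' \<longrightarrow> g \<gamma> = g \<gamma>' \<or> g \<gamma> = g \<gamma>'' \<or> g \<gamma>' = g \<gamma>'')"

definition strong_colorable :: "('a,'b) pre_digraph \<Rightarrow> 'a set \<Rightarrow> bool" where
  "strong_colorable G Q \<longleftrightarrow> (\<exists>g. strong_coloring G Q g)"

lemma strong_coloring_antipodal:
  "strong_coloring G Q g \<Longrightarrow> \<gamma> \<in> Gamma G Q \<Longrightarrow> \<gamma>' \<in> Gamma G Q \<Longrightarrow> antipodal Q \<gamma> \<gamma>' \<Longrightarrow> g \<gamma> \<noteq> g \<gamma>'"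
  by (simp add: strong_coloring_def)

lemma strong_coloring_two:
  assumes "strong_coloring G Q g" "v \<in> Q" "\<gamma> \<in> Gamma G Q" "\<gamma>' \<in> Gamma G Q" "\<gamma>'' \<in> Gamma G Q"
    "neighboring_subgraph Q v \<gamma>" "neighboring_subgraph Q v \<gamma>'" "neighboring_subgraph Q v \<gamma>''"
  shows "g \<gamma> = g \<gamma>' \<or> g \<gamma> = g \<gamma>'' \<or> g \<gamma>' = g \<gamma>''"
  using assms unfolding strong_coloring_def by blast

section \<open>The partial order of dominance classes and its maximal elements\<close>

locale ordered_upper =
  fixes G :: "('a,'b) pre_digraph" and Q :: "'a set" and u :: "nat \<Rightarrow> ('a,'b) pre_digraph set"
  assumes finite_Gamma: "finite (Gamma G Q)"
    and ordering: "upper_ordering G Q u"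
begin

abbreviation "X \<equiv> Gamma_classes G Q"
abbreviation "single \<equiv> D_single G Q u"
abbreviation "pair \<equiv> D_pair G Q u"
abbreviation "l \<equiv> card (Upper G Q)"
abbreviation "below \<equiv> cl_dominated Q"
abbreviation "anti \<equiv> cl_antipodal Q"

definition I :: "nat set" where "I = {1..l}"

text \<open>\<open>v \<in> Q\<close> is built in because dominance only controls the traces of
  cliques on \<open>Q\<close>.\<close>

definition nb :: "'a \<Rightarrow> ('a,'b) pre_digraph set \<Rightarrow> bool" where
  "nb v A \<longleftrightarrow> v \<in> Q \<and> (\<exists>\<gamma>\<in>A. neighboring_subgraph Q v \<gamma>)"

lemma equiv_dom_equiv: "equiv (Gamma G Q) (dom_equiv G Q)"
proof (rule equivI)
  show "dom_equiv G Q \<subseteq> Gamma G Q \<times> Gamma G Q"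
    by (auto simp: dom_equiv_def)
  show "refl_on (Gamma G Q) (dom_equiv G Q)"
    by (auto simp: refl_on_def dom_equiv_def)
  show "sym (dom_equiv G Q)" by (auto simp: sym_def dom_equiv_def)
  show "trans (dom_equiv G Q)"
    by (auto simp: trans_def dom_equiv_def intro: dominated_trans)
qed

lemma classes_D:
  assumes "A \<in> X"
  shows "A \<noteq> {}" "A \<subseteq> Gamma G Q" "\<gamma> \<in> A \<Longrightarrow> \<gamma>' \<in> A \<Longrightarrow> dominated Q \<gamma> \<gamma>'"
proof -
  show "A \<noteq> {}" "A \<subseteq> Gamma G Q"
    using assms in_quotient_imp_non_empty[OF equiv_dom_equiv]
      in_quotient_imp_subset[OF equiv_dom_equiv] by (auto simp: Gamma_classes_def)
  assume "\<gamma> \<in> A" "\<gamma>' \<in> A"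
  then have "(\<gamma>, \<gamma>') \<in> dom_equiv G Q"
    using assms quotient_eq_iff[OF equiv_dom_equiv] by (auto simp: Gamma_classes_def)
  then show "dominated Q \<gamma> \<gamma>'" by (simp add: dom_equiv_def)
qed

lemma class_exists:
  assumes "\<gamma> \<in> Gamma G Q"
  obtains A where "A \<in> X" "\<gamma> \<in> A"
  using assms equiv_class_self[OF equiv_dom_equiv assms] quotientI[OF assms, of "dom_equiv G Q"]
  by (auto simp: Gamma_classes_def)

lemma dom_rep:
  assumes "A \<in> X" "B \<in> X" "a \<in> A" "b \<in> B"
  shows "below A B \<longleftrightarrow> dominated Q a b"
  using assms classes_D(3)[OF assms(1)] classes_D(3)[OF assms(2)]
  by (meson cl_dominated_def dominated_trans)

lemma nb_rep:
  assumes "A \<in> X" "a \<in> A"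
  shows "nb v A \<longleftrightarrow> v \<in> Q \<and> neighboring_subgraph Q v a"
proof -
  have "neighboring_subgraph Q v a" if "v \<in> Q" "b \<in> A" "neighboring_subgraph Q v b" for b
    using dominated_neighboring[OF classes_D(3)[OF assms(1) that(2) assms(2)] that(1,3)] .
  then show ?thesis using assms(2) by (auto simp: nb_def)
qed

text \<open>Antipodality is a combination of common vertices and comparability, which are already
  known not to depend on the representatives.\<close>

lemma anti_rep:
  assumes "A \<in> X" "B \<in> X" "a \<in> A" "b \<in> B"
  shows "anti A B \<longleftrightarrow> antipodal Q a b"
proof -
  have "antipodal Q c d \<longleftrightarrow> (\<exists>v. nb v A \<and> nb v B) \<and> \<not> below A B \<and> \<not> below B A"
    if "c \<in> A" "d \<in> B" for c d
    using nb_rep[OF assms(1) that(1)] nb_rep[OF assms(2) that(2)]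
      dom_rep[OF assms(1,2) that] dom_rep[OF assms(2,1) that(2,1)]
    by (auto simp: antipodal_def attached_iff)
  then show ?thesis using assms by (auto simp: cl_antipodal_def)
qed

lemma dom_refl: "A \<in> X \<Longrightarrow> below A A"
  using classes_D(1) dom_rep by fastforce

lemma dom_trans:
  assumes "A \<in> X" "B \<in> X" "C \<in> X" "below A B" "below B C"
  shows "below A C"
proof -
  obtain a b c where abc: "a \<in> A" "b \<in> B" "c \<in> C"
    using classes_D(1)[OF assms(1)] classes_D(1)[OF assms(2)] classes_D(1)[OF assms(3)] by auto
  show ?thesis
    using assms(4,5) dominated_trans[of Q a b c]
    unfolding dom_rep[OF assms(1,2) abc(1,2)] dom_rep[OF assms(2,3) abc(2,3)]
      dom_rep[OF assms(1,3) abc(1,3)] by simp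
qed

lemma dom_antisym:
  assumes "A \<in> X" "B \<in> X" "below A B" "below B A"
  shows "A = B"
proof -
  obtain a b where ab: "a \<in> A" "b \<in> B" using assms classes_D(1) by blast
  then have "(a, b) \<in> dom_equiv G Q"
    using assms dom_rep classes_D(2) by (fastforce simp: dom_equiv_def)
  then show ?thesis
    using assms(1,2) ab quotient_eq_iff[OF equiv_dom_equiv] by (auto simp: Gamma_classes_def)
qed

lemma nb_mono:
  assumes "A \<in> X" "B \<in> X" "below A B" "nb v A"
  shows "nb v B"
proof -
  obtain a b where ab: "a \<in> A" "b \<in> B"
    using classes_D(1)[OF assms(1)] classes_D(1)[OF assms(2)] by auto
  show ?thesis
    using assms(3,4) dominated_neighboring[of Q a b v]
    unfolding dom_rep[OF assms(1,2) ab] nb_rep[OF assms(1) ab(1)] nb_rep[OF assms(2) ab(2)]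
    by simp
qed

lemma anti_iff:
  assumes "A \<in> X" "B \<in> X"
  shows "anti A B \<longleftrightarrow> (\<exists>v. nb v A \<and> nb v B) \<and> \<not> below A B \<and> \<not> below B A"
proof -
  obtain a b where ab: "a \<in> A" "b \<in> B" using assms classes_D(1) by blast
  show ?thesis
    using anti_rep[OF assms ab] nb_rep[OF assms(1) ab(1)] nb_rep[OF assms(2) ab(2)]
      dom_rep[OF assms ab] dom_rep[OF assms(2,1) ab(2,1)]
    by (auto simp: antipodal_def attached_iff)
qed

lemma anti_sym: "A \<in> X \<Longrightarrow> B \<in> X \<Longrightarrow> anti A B \<Longrightarrow> anti B A"
  using anti_iff by blast

lemma finite_X: "finite X"
  unfolding Gamma_classes_def
  by (rule finite_quotient[OF finite_Gamma]) (auto simp: dom_equiv_def)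

lemma u_Upper: "i \<in> I \<Longrightarrow> u i \<in> Upper G Q"
  using ordering unfolding upper_ordering_def I_def bij_betw_def by blast

lemma u_X: "i \<in> I \<Longrightarrow> u i \<in> X"
  using u_Upper by (auto simp: Upper_def)

lemma Upper_u: "A \<in> Upper G Q \<Longrightarrow> \<exists>i\<in>I. A = u i"
  using ordering unfolding upper_ordering_def I_def bij_betw_def by blast

lemma u_inj: "i \<in> I \<Longrightarrow> j \<in> I \<Longrightarrow> u i = u j \<Longrightarrow> i = j"
  using ordering unfolding upper_ordering_def I_def bij_betw_def inj_on_def by blast

lemma u_max: "i \<in> I \<Longrightarrow> B \<in> X \<Longrightarrow> below (u i) B \<Longrightarrow> B = u i"
  using u_Upper by (auto simp: Upper_def)

lemma dom_u_exists:
  assumes "A \<in> X"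
  shows "\<exists>i\<in>I. below A (u i)"
proof -
  \<comment> \<open>The order is reversed, so that the minimal element found is a maximal one above
    \<open>A\<close>.\<close>
  let ?R = "\<lambda>B C. below C B \<and> C \<noteq> B"
  let ?S = "{B \<in> X. below A B}"
  have "\<exists>m\<in>?S. \<forall>x\<in>?S. x \<noteq> m \<longrightarrow> \<not> ?R x m"
  proof (rule Finite_Set.bex_min_element)
    show "finite ?S" using finite_X by simp
    show "asymp_on ?S ?R" using dom_antisym by (auto simp: asymp_on_def)
    show "transp_on ?S ?R"
      by (rule transp_onI) (use dom_antisym dom_trans in blast)
    show "?S \<noteq> {}" using assms dom_refl by blast
  qed
  then obtain M where M: "M \<in> X" "below A M" "\<And>B. B \<in> X \<Longrightarrow> below A B \<Longrightarrow> below M B \<Longrightarrow> B = M"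
    by blast
  have "B = M" if "B \<in> X" "below M B" for B
    using M(3)[OF that(1) dom_trans[OF assms M(1) that(1) M(2) that(2)] that(2)] .
  then have "M \<in> Upper G Q"
    using M(1) by (simp add: Upper_def)
  then show ?thesis using Upper_u M by blast
qed

lemma uppers_anti:
  assumes "i \<in> I" "j \<in> I" "i \<noteq> j" "nb v (u i)" "nb v (u j)"
  shows "anti (u i) (u j)"
  using assms anti_iff u_X u_max u_inj by metis

text \<open>Distinct maximal elements at one vertex are antipodal, so three of them would be a full
  antipodal triple. Only here does the absence of such triples enter.\<close>

lemma two_uppers:
  assumes nt: "\<nexists>W. full_antipodal_triple G Q W"
    and ijk: "i \<in> I" "j \<in> I" "k \<in> I" "i \<noteq> j"
    and nb: "nb v (u i)" "nb v (u j)" "nb v (u k)"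
  shows "k = i \<or> k = j"
proof (rule ccontr)
  assume "\<not> (k = i \<or> k = j)"
  then have ne: "k \<noteq> i" "k \<noteq> j" by auto
  obtain a b c where abc: "a \<in> u i" "b \<in> u j" "c \<in> u k"
    using classes_D(1)[OF u_X[OF ijk(1)]] classes_D(1)[OF u_X[OF ijk(2)]]
      classes_D(1)[OF u_X[OF ijk(3)]] by auto
  have anti: "antipodal Q x y"
    if "x \<in> u i'" "y \<in> u j'" "i' \<noteq> j'" "i' \<in> {i,j,k}" "j' \<in> {i,j,k}" for x y i' j'
    using uppers_anti[of i' j' v] anti_rep[of "u i'" "u j'" x y] that ijk nb u_X by auto
  have ab: "antipodal Q a b" "antipodal Q b a" "antipodal Q a c" "antipodal Q c a"
     "antipodal Q b c" "antipodal Q c b"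
    using anti abc ne ijk(4) by blast+
  then have "a \<noteq> b" "a \<noteq> c" "b \<noteq> c" by (auto simp: antipodal_def)
  moreover have "a \<in> Gamma G Q" "b \<in> Gamma G Q" "c \<in> Gamma G Q"
    using abc ijk u_X classes_D(2) by blast+
  moreover have "v \<in> Q" "neighboring_subgraph Q v a" "neighboring_subgraph Q v b"
      "neighboring_subgraph Q v c"
    using abc nb nb_rep u_X ijk by blast+
  ultimately have "full_antipodal_triple G Q {a,b,c}"
    using ab by (auto simp: full_antipodal_triple_def neighboring_set_def)
  then show False using nt by blast
qed

lemma D_single_iff:
  "A \<in> single i \<longleftrightarrow>
     A \<in> X \<and> below A (u i) \<and> (\<forall>k\<in>I. k \<noteq> i \<longrightarrow> \<not> below A (u k))"
  unfolding D_single_def I_def by blast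

lemma D_pair_iff:
  "A \<in> pair i j \<longleftrightarrow>
     A \<in> X \<and> below A (u i) \<and> below A (u j) \<and> (\<forall>k\<in>I. k \<noteq> i \<and> k \<noteq> j \<longrightarrow> \<not> below A (u k))"
  unfolding D_pair_def I_def by blast

text \<open>Every maximal element above \<open>A\<close> is again a neighboring subgraph of
  \<open>v\<close>, and \<open>v\<close> admits at most two of them.\<close>

lemma D_cases:
  assumes nt: "\<nexists>W. full_antipodal_triple G Q W" and A: "A \<in> X" "nb v A"
  obtains i where "i \<in> I" "A \<in> single i"
  | i j where "i \<in> I" "j \<in> I" "i < j" "A \<in> pair i j"
proof -
  obtain i where i: "i \<in> I" "below A (u i)" using dom_u_exists A by blast
  have nbu: "nb v (u k)" if "k \<in> I" "below A (u k)" for k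
    using nb_mono A u_X that by blast
  show thesis
  proof (cases "\<exists>j\<in>I. j \<noteq> i \<and> below A (u j)")
    case False
    then show ?thesis using that(1)[of i] i A by (auto simp: D_single_iff)
  next
    case True
    then obtain j where j: "j \<in> I" "j \<noteq> i" "below A (u j)" by blast
    have "k = i \<or> k = j" if "k \<in> I" "below A (u k)" for k
      using two_uppers[OF nt i(1) j(1) that(1) j(2)[symmetric]] nbu i j that by blast
    then show ?thesis
      using that(2)[of i j] that(2)[of j i] i j A by (cases "i < j") (auto simp: D_pair_iff)
  qed
qed

text \<open>If \<open>u j\<close> were below \<open>A\<close>, it would be below the different
  maximal element \<open>u i\<close>. Thus sharing a vertex with another maximal element already
  triggers condition (ii).\<close>

lemma single_anti_upper:
  assumes "i \<in> I" "A \<in> single i" "j \<in> I" "j \<noteq> i" "nb v A" "nb v (u j)"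
  shows "anti A (u j)" "u j \<in> X - single i"
proof -
  have A: "\<not> below A (u j)" "A \<in> X" "below A (u i)" using assms by (auto simp: D_single_iff)
  have "\<not> below (u j) A"
    using assms(1,3,4) A u_max[OF assms(3) u_X[OF assms(1)]] u_inj
      dom_trans[OF u_X[OF assms(3)] A(2) u_X[OF assms(1)]] by metis
  then show "anti A (u j)" using anti_iff[OF A(2) u_X[OF assms(3)]] A assms(5,6) by blast
  show "u j \<in> X - single i"
    using assms u_X u_inj dom_refl by (auto simp: D_single_iff)
qed

text \<open>The weak coloring itself works, read on the classes. At a vertex with two neighboring
  maximal elements only their indices occur, since the other maximal element excludes color
  \<open>l + 1\<close>; with a single one, \<open>u i\<close>, only \<open>i\<close> and
  \<open>l + 1\<close> occur.\<close>

lemma strong_if_weak: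
  assumes nt: "\<nexists>W. full_antipodal_triple G Q W" and weak: "weak_colorable G Q u"
  shows "strong_colorable G Q"
proof -
  obtain f where part: "partial_coloring G Q u f"
    and f: "\<forall>i\<in>I. f ` single i \<subseteq> {i, l + 1}"
      "\<forall>i\<in>I. \<forall>j\<in>I. i < j \<longrightarrow> f ` pair i j \<subseteq> {i, j}"
      "\<forall>D\<in>D_family G Q u. \<forall>A\<in>D. \<forall>B\<in>D. anti A B \<longrightarrow> f A \<noteq> f B"
    using weak unfolding weak_colorable_def Let_def I_def by auto
  have f2: "f A = i"
    if "i \<in> I" "A \<in> single i" "B \<in> X - single i" "anti A B" for i A B
    using part that unfolding partial_coloring_def Let_def I_def by blast
  have "\<forall>i\<in>I. \<forall>j\<in>I. i < j \<longrightarrow> (\<forall>A\<in>pair i j. \<forall>B\<in>X - pair i j.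
      anti A B \<longrightarrow> (B \<in> single j \<longrightarrow> f A = i) \<and> (B \<in> single i \<longrightarrow> f A = j))"
    using part unfolding partial_coloring_def Let_def I_def[symmetric] by (elim conjE)
  note f3 = this[rule_format]
  have f4: "f A = i \<or> f A = l + 1" if "i \<in> I" "A \<in> single i" for i A
    using f(1) that by auto
  have f5: "f A = i \<or> f A = j" if "i \<in> I" "j \<in> I" "i < j" "A \<in> pair i j" for i j A
    using f(2) that by blast
  note f6 = f(3)[rule_format]
  have single_fam: "single i \<in> D_family G Q u" if "i \<in> I" for i
    using that unfolding D_family_def I_def by blast
  have pair_fam: "pair i j \<in> D_family G Q u"
    if "i \<in> I" "j \<in> I" "i < j" for i j
    using that unfolding D_family_def I_def by blast
  have nbu: "nb v (u k)" if "k \<in> I" "below A (u k)" "A \<in> X" "nb v A" for k v A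
    using nb_mono u_X that by blast
  \<comment> \<open>A common vertex forces \<open>i\<close> to be \<open>j\<close> or
    \<open>k\<close>; then (ii) fixes \<open>f A = i\<close>, while (iii) gives \<open>B\<close> the
    other index of its pair.\<close>
  have mixed: "f A \<noteq> f B"
    if A: "i \<in> I" "A \<in> single i"
      and B: "j \<in> I" "k \<in> I" "j < k" "B \<in> pair j k"
      and ab: "anti A B" for A B i j k
  proof -
    have AX: "A \<in> X" "below A (u i)" and BX: "B \<in> X" "below B (u j)" "below B (u k)"
      using A B by (auto simp: D_single_iff D_pair_iff)
    obtain v where v: "nb v A" "nb v B" using ab anti_iff AX BX by blast
    have jk: "i = j \<or> i = k"
      using two_uppers[OF nt B(1,2) A(1)] B(3) nbu AX BX A B v by blast
    have "B \<notin> single i" "A \<notin> pair j k"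
      using A B by (auto simp: D_single_iff D_pair_iff)
    then have "f A = i" "f B = (if i = j then k else j)"
      using f2[OF A _ ab] f3[OF B _ anti_sym[OF _ _ ab]] AX BX A(2) jk B(3) by auto
    then show ?thesis using jk B(3) by auto
  qed
  have diff: "f A \<noteq> f B" if AB: "A \<in> X" "B \<in> X" "anti A B" for A B
  proof -
    obtain v where v: "nb v A" "nb v B" using AB anti_iff by blast
    show ?thesis
    proof (cases rule: D_cases[OF nt AB(1) v(1)])
      case A: (1 i)
      show ?thesis
      proof (cases rule: D_cases[OF nt AB(2) v(2)])
        case B: (1 j)
        show ?thesis
        proof (cases "i = j")
          case True
          then show ?thesis using f6[OF single_fam] A B AB by blast
        next
          case False
          then have "B \<notin> single i" "A \<notin> single j"
            using A B by (auto simp: D_single_iff)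
          then have "f A = i" "f B = j"
            using f2 A B AB anti_sym by blast+
          then show ?thesis using False by simp
        qed
      next
        case B: (2 j k)
        then show ?thesis using mixed A AB by blast
      qed
    next
      case A: (2 i j)
      show ?thesis
      proof (cases rule: D_cases[OF nt AB(2) v(2)])
        case B: (1 k)
        then show ?thesis using mixed A AB anti_sym by metis
      next
        case B: (2 i' j')
        \<comment> \<open>Two pairs of maximal elements meeting at \<open>v\<close> are the same
          pair, so condition (vi) applies.\<close>
        have "below A (u i)" "below A (u j)" "below B (u i')" "below B (u j')"
          using A B by (auto simp: D_pair_iff)
        then have "i' = i \<or> i' = j" "j' = i \<or> j' = j"
          using two_uppers[OF nt A(1,2) B(1)] two_uppers[OF nt A(1,2) B(2)]
            A B AB v nbu by blast+
        then have "i' = i" "j' = j" using A B by auto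
        then show ?thesis using f6[OF pair_fam] A B AB by blast
      qed
    qed
  qed
  have one: "f A = i \<or> f A = l + 1"
    if "A \<in> X" "nb v A" "i \<in> I" "\<And>k. k \<in> I \<Longrightarrow> nb v (u k) \<Longrightarrow> k = i" for A v i
  proof -
    have "\<exists>j\<in>I. below A (u j)" using dom_u_exists that(1) by blast
    then obtain j where "j \<in> I" "below A (u j)" by auto
    moreover have "k = i" if "k \<in> I" "below A (u k)" for k
      using nbu[OF that \<open>A \<in> X\<close> \<open>nb v A\<close>] \<open>\<And>k. k \<in> I \<Longrightarrow> nb v (u k) \<Longrightarrow> k = i\<close> that(1) by blast
    ultimately have "A \<in> single i"
      using that(1) unfolding D_single_iff by blast
    then show ?thesis using f4 that by blast
  qed
  have two: "f A = i \<or> f A = j"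
    if A: "A \<in> X" "nb v A" and ij: "i \<in> I" "j \<in> I" "i \<noteq> j" "nb v (u i)" "nb v (u j)"
    for A v i j
  proof (cases rule: D_cases[OF nt A])
    case (1 k)
    then have k: "k = i \<or> k = j"
      using two_uppers[OF nt ij(1,2) 1(1) ij(3)] ij nbu A by (auto simp: D_single_iff)
    \<comment> \<open>\<open>u m\<close> is the other of the two maximal elements; \<open>A\<close>
      is antipodal to it, which rules out color \<open>l + 1\<close>.\<close>
    define m where "m = (if k = i then j else i)"
    have "m \<in> I" "m \<noteq> k" "nb v (u m)" using ij k by (auto simp: m_def)
    then have "f A = k"
      using f2 1 single_anti_upper[of k A m v] A by blast
    then show ?thesis using k by simp
  next
    case (2 i' j')
    then have "i' = i \<or> i' = j" "j' = i \<or> j' = j"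
      using two_uppers[OF nt ij(1,2) 2(1) ij(3)] two_uppers[OF nt ij(1,2) 2(2) ij(3)] ij nbu A
      by (auto simp: D_pair_iff)
    then show ?thesis using f5 2 by blast
  qed
  have atmost2: "\<exists>p q. \<forall>A\<in>X. nb v A \<longrightarrow> f A = p \<or> f A = q" for v
  proof (cases "\<exists>i\<in>I. \<exists>j\<in>I. i \<noteq> j \<and> nb v (u i) \<and> nb v (u j)")
    case True
    then show ?thesis using two by metis
  next
    case False
    show ?thesis
    proof (cases "\<exists>A\<in>X. nb v A")
      case True
      then obtain i where "i \<in> I" "nb v (u i)" using dom_u_exists nbu by blast
      then show ?thesis using one[of _ v i] False by blast
    qed auto
  qed
  define cls where "cls \<gamma> = (SOME A. A \<in> X \<and> \<gamma> \<in> A)" for \<gamma>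
  have cls: "cls \<gamma> \<in> X" "\<gamma> \<in> cls \<gamma>" if "\<gamma> \<in> Gamma G Q" for \<gamma>
    using class_exists[OF that] someI[of "\<lambda>A. A \<in> X \<and> \<gamma> \<in> A"] unfolding cls_def by metis+
  have "strong_coloring G Q (\<lambda>\<gamma>. f (cls \<gamma>))"
    unfolding strong_coloring_def
  proof (intro conjI ballI impI)
    fix \<gamma> \<gamma>' assume "\<gamma> \<in> Gamma G Q" "\<gamma>' \<in> Gamma G Q" "antipodal Q \<gamma> \<gamma>'"
    then show "f (cls \<gamma>) \<noteq> f (cls \<gamma>')"
      using diff cls anti_rep by metis
  next
    fix v \<gamma> \<gamma>' \<gamma>'' assume *: "v \<in> Q" "\<gamma> \<in> Gamma G Q" "\<gamma>' \<in> Gamma G Q" "\<gamma>'' \<in> Gamma G Q"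
      "neighboring_subgraph Q v \<gamma> \<and> neighboring_subgraph Q v \<gamma>' \<and> neighboring_subgraph Q v \<gamma>''"
    then have "nb v (cls \<gamma>)" "nb v (cls \<gamma>')" "nb v (cls \<gamma>'')"
      using cls nb_rep by metis+
    then show "f (cls \<gamma>) = f (cls \<gamma>') \<or> f (cls \<gamma>) = f (cls \<gamma>'') \<or> f (cls \<gamma>') = f (cls \<gamma>'')"
      using atmost2[of v] cls(1) * by metis
  qed
  then show ?thesis by (auto simp: strong_colorable_def)
qed

text \<open>Three pairwise antipodal elements need three colors, but their common vertex admits
  two.\<close>

lemma no_triple_if_strong:
  assumes "strong_colorable G Q"
  shows "\<nexists>W. full_antipodal_triple G Q W"
proof
  assume "\<exists>W. full_antipodal_triple G Q W"
  then obtain W where W: "full_antipodal_triple G Q W" by blast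
  obtain g where g: "strong_coloring G Q g" using assms by (auto simp: strong_colorable_def)
  note g1 = strong_coloring_antipodal[OF g] and g2 = strong_coloring_two[OF g]
  obtain a b c where "W = {a,b,c}" "a \<noteq> b" "a \<noteq> c" "b \<noteq> c"
    using W card_3_iff[of W] by (auto simp: full_antipodal_triple_def)
  then show False
    using W g1[of a b] g1[of a c] g1[of b c] g2[of _ a b c]
    by (auto simp: full_antipodal_triple_def neighboring_set_def)
qed

text \<open>Indices of maximal elements must replace the colors, since a strong coloring may repeat
  a color on maximal elements without a common vertex. Those with a common vertex are antipodal and
  hence distinguished.\<close>

lemma weak_if_strong:
  assumes strong: "strong_colorable G Q"
  shows "weak_colorable G Q u"
proof -
  obtain h where h: "strong_coloring G Q h" using strong by (auto simp: strong_colorable_def)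
  note h1 = strong_coloring_antipodal[OF h] and h2 = strong_coloring_two[OF h]
  note nt = no_triple_if_strong[OF strong]
  define rep where "rep A = (SOME \<gamma>. \<gamma> \<in> A)" for A :: "('a,'b) pre_digraph set"
  have rep: "rep A \<in> A" "rep A \<in> Gamma G Q" if "A \<in> X" for A
    using classes_D(1,2)[OF that] some_in_eq[of A] by (auto simp: rep_def)
  define g where "g A = h (rep A)" for A
  have g1: "g A \<noteq> g B" if "A \<in> X" "B \<in> X" "anti A B" for A B
    using h1 rep that anti_rep unfolding g_def by metis
  have g2: "g A = g B \<or> g A = g C \<or> g B = g C"
    if "A \<in> X" "B \<in> X" "C \<in> X" "nb v A" "nb v B" "nb v C" for A B C v
    using h2[of v "rep A" "rep B" "rep C"] rep that nb_rep unfolding g_def by metis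
  have nbu: "nb v (u k)" if "k \<in> I" "below A (u k)" "A \<in> X" "nb v A" for k v A
    using nb_mono u_X that by blast
  \<comment> \<open>Color \<open>l + 1\<close> takes the elements of a \<open>D_i\<close> whose
    color differs from that of \<open>u i\<close>, and everything in no set of the family, where any
    color is admissible.\<close>
  define f where "f A =
    (if \<exists>i\<in>I. A \<in> single i then
       let i = (THE i. i \<in> I \<and> A \<in> single i) in if g A = g (u i) then i else l + 1
     else if \<exists>i\<in>I. \<exists>j\<in>I. i < j \<and> A \<in> pair i j then
       let (i, j) = (THE (i, j). i \<in> I \<and> j \<in> I \<and> i < j \<and> A \<in> pair i j)
       in if g A = g (u i) then i else j
     else l + 1)" for A
  have f_single: "f A = (if g A = g (u i) then i else l + 1)"
    if "i \<in> I" "A \<in> single i" for A i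
  proof -
    have "(THE i. i \<in> I \<and> A \<in> single i) = i"
      using that by (intro the_equality) (auto simp: D_single_iff)
    then show ?thesis using that by (auto simp: f_def Let_def)
  qed
  have f_pair: "f A = (if g A = g (u i) then i else j)"
    if ij: "i \<in> I" "j \<in> I" "i < j" "A \<in> pair i j" for A i j
  proof -
    have "(THE (i, j). i \<in> I \<and> j \<in> I \<and> i < j \<and> A \<in> pair i j) = (i, j)"
    proof (rule the_equality)
      fix p assume p: "case p of (i, j) \<Rightarrow> i \<in> I \<and> j \<in> I \<and> i < j \<and> A \<in> pair i j"
      obtain i' j' where "p = (i', j')" by (cases p)
      moreover from this p ij have "i' = i \<or> i' = j" "j' = i \<or> j' = j" "i' < j'"
        by (auto simp: D_pair_iff)
      ultimately show "p = (i, j)" using ij(3) by auto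
    qed (use that in auto)
    moreover have "\<not> (\<exists>i\<in>I. A \<in> single i)"
      using ij by (auto simp: D_single_iff D_pair_iff)
    moreover have "\<exists>i\<in>I. \<exists>j\<in>I. i < j \<and> A \<in> pair i j" using that by blast
    ultimately show ?thesis by (auto simp: f_def)
  qed
  have u_single: "u i \<in> single i" if "i \<in> I" for i
    using that u_X dom_refl u_max u_inj by (fastforce simp: D_single_iff)
  have other_upper: "\<exists>k\<in>I. k \<noteq> i \<and> below B (u k)"
    if "i \<in> I" "B \<in> X - single i" for i B
    using that dom_u_exists[of B] by (auto simp: D_single_iff)
  have g_u: "g (u i) \<noteq> g (u j)"
    if "i \<in> I" "j \<in> I" "i \<noteq> j" "nb v (u i)" "nb v (u j)" for i j v
    using g1 uppers_anti that u_X by blast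
  \<comment> \<open>\<open>B\<close> lies below a maximal element \<open>u k\<close> with
    \<open>k \<noteq> i\<close>, and \<open>A\<close> is antipodal to \<open>u k\<close>. Of the
    three elements \<open>A\<close>, \<open>u i\<close>, \<open>u k\<close> at \<open>v\<close>, the
    last differs in color from the other two, which must therefore agree.\<close>
  have single_g: "g A = g (u i)"
    if iA: "i \<in> I" "A \<in> single i" and B: "B \<in> X - single i" "anti A B"
    for i A B
  proof -
    obtain k where k: "k \<in> I" "k \<noteq> i" "below B (u k)" using other_upper iA B by blast
    have A: "A \<in> X" "below A (u i)" using iA by (auto simp: D_single_iff)
    obtain v where v: "nb v A" "nb v B" using B A anti_iff by blast
    then have vu: "nb v (u i)" "nb v (u k)" using nbu k iA A B by blast+
    have "anti A (u k)" using single_anti_upper iA k v vu by blast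
    then show ?thesis
      using g2[of A "u i" "u k" v] g1[of A "u k"] g_u[OF iA(1) k(1) _ vu] k u_X iA A v vu by auto
  qed
  have pair_g: "g A = g (u i) \<or> g A = g (u j)" "g (u i) \<noteq> g (u j)"
    if "i \<in> I" "j \<in> I" "i < j" "A \<in> pair i j" "nb v A" for i j A v
  proof -
    have A: "A \<in> X" "below A (u i)" "below A (u j)" using that by (auto simp: D_pair_iff)
    then have vu: "nb v (u i)" "nb v (u j)" using nbu that by blast+
    show "g (u i) \<noteq> g (u j)" using g_u vu that by simp
    then show "g A = g (u i) \<or> g A = g (u j)"
      using g2[of A "u i" "u j" v] A that vu u_X by blast
  qed
  have cross_single: "f A = i"
    if "i \<in> I" "A \<in> single i" "B \<in> X - single i" "anti A B" for i A B
    using f_single single_g that by simp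
  \<comment> \<open>\<open>B\<close> is antipodal to \<open>u i\<close> and so has the color of
    \<open>u j\<close>, which is then denied to \<open>A\<close>.\<close>
  have pair_anti: "g A = g (u i)"
    if ij: "i \<in> I" "j \<in> I" "i \<noteq> j" and B: "B \<in> single j"
      and A: "A \<in> X" "below A (u i)" "g A = g (u i) \<or> g A = g (u j)" "anti A B" for i j A B
  proof -
    have BX: "B \<in> X" "below B (u j)" using B by (auto simp: D_single_iff)
    obtain v where v: "nb v A" "nb v B" using A BX anti_iff by blast
    then have vu: "nb v (u i)" using nbu ij A by blast
    have "g B = g (u j)"
      using single_g[OF ij(2) B, of "u i"] single_anti_upper[OF ij(2) B ij(1,3)] v vu by blast
    then show ?thesis using g1[of A B] A BX by auto
  qed
  have part: "partial_coloring G Q u f"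
    unfolding partial_coloring_def Let_def I_def[symmetric]
  proof (intro conjI ballI impI)
    show fu: "f (u i) = i" if "i \<in> I" for i
      using f_single[OF that u_single[OF that]] by simp
    show "f ` (Upper G Q \<union> Cross G Q u) \<subseteq> I"
    proof (intro image_subsetI, elim UnE)
      fix A assume "A \<in> Upper G Q"
      then show "f A \<in> I" using Upper_u fu by force
    next
      fix A assume "A \<in> Cross G Q u"
      then obtain D B where D: "D \<in> D_family G Q u" "A \<in> D" "B \<in> X - D" "anti A B"
        by (auto simp: Cross_def)
      then consider i where "i \<in> I" "D = single i"
        | i j where "i \<in> I" "j \<in> I" "i < j" "D = pair i j"
        unfolding D_family_def I_def by blast
      then show "f A \<in> I"
      proof cases
        case 1
        then show ?thesis using cross_single D by metis
      next
        case 2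
        then show ?thesis using f_pair[OF 2(1-3)] D by simp
      qed
    qed
    show "f A = i" if "i \<in> I" "A \<in> single i"
       "\<exists>B\<in>X - single i. anti A B" for i A
      using cross_single that by blast
    fix i j A B assume *: "i \<in> I" "j \<in> I" "i < j" "A \<in> pair i j"
      "B \<in> X - pair i j" "anti A B"
    have A: "A \<in> X" "below A (u i)" "below A (u j)" using * by (auto simp: D_pair_iff)
    obtain v where v: "nb v A" using * A anti_iff by blast
    note pg = pair_g[OF *(1-4) v]
    show "f A = i" if "B \<in> single j"
    proof -
      have "g A = g (u i)" using pair_anti[OF *(1,2) _ that] * A pg by blast
      then show ?thesis using f_pair[OF *(1-4)] by simp
    qed
    show "f A = j" if "B \<in> single i"
    proof -
      have "g A = g (u j)" using pair_anti[OF *(2,1) _ that] * A pg by blast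
      then show ?thesis using f_pair[OF *(1-4)] pg by simp
    qed
  qed
  have same: "f A \<noteq> f B" if D: "D \<in> D_family G Q u" "A \<in> D" "B \<in> D" "anti A B" for D A B
  proof -
    consider i where "i \<in> I" "D = single i"
      | i j where "i \<in> I" "j \<in> I" "i < j" "D = pair i j"
      using D(1) unfolding D_family_def I_def by blast
    then show ?thesis
    proof cases
      case 1
      have AB: "A \<in> X" "B \<in> X" "below A (u i)" using D 1 by (auto simp: D_single_iff)
      obtain v where v: "nb v A" "nb v B" using anti_iff AB D by blast
      \<comment> \<open>Only two colors occur among \<open>A\<close>, \<open>B\<close> and
        \<open>u i\<close>, and \<open>A\<close>, \<open>B\<close> differ: one of them gets
        \<open>i\<close>, the other \<open>l + 1\<close>.\<close>
      then have "g A = g (u i) \<or> g B = g (u i)"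
        using g2[of A B "u i" v] g1[OF AB(1,2) D(4)] AB nbu 1 u_X by auto
      then show ?thesis using f_single g1[OF AB(1,2) D(4)] D 1 by (auto simp: I_def)
    next
      case 2
      have AB: "A \<in> X" "B \<in> X" using D 2 by (auto simp: D_pair_iff)
      obtain v where v: "nb v A" "nb v B" using anti_iff AB D by blast
      then show ?thesis
        using pair_g[OF 2(1-3), of A v] pair_g[OF 2(1-3), of B v] g1[OF AB D(4)] f_pair[OF 2(1-3)]
          D 2 by auto
    qed
  qed
  have range: "f ` X \<subseteq> {1..l + 1}"
  proof (intro image_subsetI)
    fix A assume "A \<in> X"
    show "f A \<in> {1..l + 1}"
    proof (cases "\<exists>i\<in>I. A \<in> single i")
      case True
      then show ?thesis using f_single by (fastforce simp: I_def)
    next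
      case False
      then show ?thesis
      proof (cases "\<exists>i\<in>I. \<exists>j\<in>I. i < j \<and> A \<in> pair i j")
        case True
        then obtain i j where "i \<in> I" "j \<in> I" "i < j" "A \<in> pair i j" by blast
        then show ?thesis using f_pair[of i j A] by (auto simp: I_def)
      next
        case 2: False
        have "f A = l + 1"
          unfolding f_def by (simp only: False 2 if_False)
        then show ?thesis by simp
      qed
    qed
  qed
  have s4: "\<forall>i\<in>I. f ` single i \<subseteq> {i, l + 1}"
    using f_single by auto
  have s5: "\<forall>i\<in>I. \<forall>j\<in>I. i < j \<longrightarrow> f ` pair i j \<subseteq> {i, j}"
    using f_pair by auto
  show ?thesis
    unfolding weak_colorable_def Let_def I_def[symmetric]
    by (intro exI[of _ f] conjI range part s4 s5) (use same in blast)
qed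

end

section \<open>Rooted trees whose nodes are vertex sets\<close>

text \<open>The rank \<open>d\<close> forces iterated parents to end in the root; \<open>p\<close>
  is arbitrary outside \<open>M\<close>, in particular at \<open>q\<close>.\<close>

definition parent_tree :: "('n \<Rightarrow> 'n) \<Rightarrow> 'n \<Rightarrow> 'n set \<Rightarrow> bool" where
  "parent_tree p q M \<longleftrightarrow> q \<notin> M \<and> (\<exists>d::'n \<Rightarrow> nat. \<forall>x\<in>M. p x \<in> insert q M \<and> d (p x) < d x)"

text \<open>Inside a rooted tree this is a possibly empty downward path starting just below
  \<open>t\<close>: injectivity of \<open>p\<close> excludes branching.\<close>

definition parent_chain :: "('n \<Rightarrow> 'n) \<Rightarrow> 'n \<Rightarrow> 'n set \<Rightarrow> bool" where
  "parent_chain p t A \<longleftrightarrow> t \<notin> A \<and> inj_on p A \<and> p ` A \<subseteq> insert t A"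

text \<open>A path of the tree, split at its topmost node \<open>t\<close> into two descending arms.
  The root can only be \<open>t\<close>, since \<open>p\<close> has no meaning there.\<close>

definition two_chains :: "('n \<Rightarrow> 'n) \<Rightarrow> 'n \<Rightarrow> 'n set \<Rightarrow> bool" where
  "two_chains p q S \<longleftrightarrow> (\<exists>t A B. S = insert t (A \<union> B) \<and> A \<inter> B = {} \<and> q \<notin> A \<union> B \<and>
     parent_chain p t A \<and> parent_chain p t B)"

definition path_tree :: "'v set set \<Rightarrow> 'v set \<Rightarrow> ('v set \<Rightarrow> 'v set) \<Rightarrow> bool" where
  "path_tree M q p \<longleftrightarrow> finite M \<and> parent_tree p q M \<and>
     (\<forall>v\<in>\<Union>(insert q M). two_chains p q {K\<in>insert q M. v \<in> K})"

text \<open>Compared with \<open>path_tree\<close>, a vertex of \<open>q\<close> uses only one of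
  the two arms available at \<open>q\<close>, so that a second tree can be joined there.\<close>

definition one_sided :: "'v set set \<Rightarrow> 'v set \<Rightarrow> ('v set \<Rightarrow> 'v set) \<Rightarrow> bool" where
  "one_sided M q p \<longleftrightarrow> finite M \<and> parent_tree p q M \<and>
     (\<forall>v\<in>q. parent_chain p q {K\<in>M. v \<in> K}) \<and>
     (\<forall>v\<in>\<Union>M - q. two_chains p q {K\<in>M. v \<in> K})"

lemma parent_chain_cong:
  "(\<And>x. x \<in> A \<Longrightarrow> p x = p' x) \<Longrightarrow> parent_chain p t A \<longleftrightarrow> parent_chain p' t A"
  by (simp add: parent_chain_def inj_on_def image_def subset_iff cong: ball_cong)

lemma parent_chain_upd: "q \<notin> A \<Longrightarrow> parent_chain (p(q := r)) t A \<longleftrightarrow> parent_chain p t A"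
  by (rule parent_chain_cong) auto

lemma parent_chain_empty [simp]: "parent_chain p t {}"
  by (simp add: parent_chain_def)

text \<open>Only edges inside \<open>S\<close> matter, so the parent of the topmost node may change.
  This permits hanging a whole tree elsewhere.\<close>

lemma two_chains_cong:
  assumes "two_chains p q S" "\<And>x. x \<in> S \<Longrightarrow> p x \<in> S \<Longrightarrow> p' x = p x" "r \<notin> S \<or> r = q"
  shows "two_chains p' r S"
proof -
  obtain t A B where S: "S = insert t (A \<union> B)" "A \<inter> B = {}" "q \<notin> A \<union> B"
     "parent_chain p t A" "parent_chain p t B"
    using assms(1) by (auto simp: two_chains_def)
  have "p' x = p x" if "x \<in> A \<union> B" for x
    by (rule assms(2)) (use that S in \<open>auto simp: parent_chain_def\<close>)
  then have "parent_chain p' t A" "parent_chain p' t B"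
    using S parent_chain_cong[of A p' p t] parent_chain_cong[of B p' p t] by auto
  moreover have "r \<notin> A \<union> B" using assms(3) S by blast
  ultimately show ?thesis using S unfolding two_chains_def by blast
qed

section \<open>Reaching the root and changing it\<close>

lemma parent_tree_reach:
  assumes "parent_tree p q M" "x \<in> insert q M"
  shows "(x, q) \<in> {(y, p y) |y. y \<in> M}\<^sup>*"
proof -
  obtain d :: "'a \<Rightarrow> nat" where d: "\<And>x. x \<in> M \<Longrightarrow> p x \<in> insert q M \<and> d (p x) < d x"
    using assms(1) by (auto simp: parent_tree_def)
  show ?thesis
    using assms(2)
  proof (induction "d x" arbitrary: x rule: less_induct)
    case less
    show ?case
    proof (cases "x = q")
      case False
      then have "x \<in> M" using less.prems by simp
      then have "(p x, q) \<in> {(y, p y) |y. y \<in> M}\<^sup>*" using less.hyps d by blast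
      then show ?thesis using \<open>x \<in> M\<close> by (auto intro: converse_rtrancl_into_rtrancl)
    qed simp
  qed
qed

lemma parent_treeI_reach:
  assumes "q \<notin> M" "\<And>x. x \<in> M \<Longrightarrow> p x \<in> insert q M"
    and "\<And>x. x \<in> M \<Longrightarrow> (x, q) \<in> {(y, p y) |y. y \<in> M}\<^sup>*"
  shows "parent_tree p q M"
proof -
  let ?R = "{(y, p y) |y. y \<in> M}"
  define d where "d x = (LEAST n. (x, q) \<in> ?R ^^ n)" for x
  have "d (p x) < d x" if x: "x \<in> M" for x
  proof -
    obtain n where "(x, q) \<in> ?R ^^ n" using assms(3)[OF x] rtrancl_power by blast
    then have *: "(x, q) \<in> ?R ^^ d x" unfolding d_def by (rule LeastI)
    have "d x \<noteq> 0"
    proof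
      assume "d x = 0"
      then have "x = q" using * by simp
      then show False using x assms(1) by simp
    qed
    then obtain m where m: "d x = Suc m" using not0_implies_Suc by blast
    then obtain y where "(x, y) \<in> ?R" "(y, q) \<in> ?R ^^ m"
      using * relpow_Suc_D2[of x q m ?R] by auto
    then have "(p x, q) \<in> ?R ^^ m" by auto
    then have "d (p x) \<le> m" unfolding d_def by (rule Least_le)
    then show ?thesis using m by simp
  qed
  then show ?thesis using assms(1,2) by (auto simp: parent_tree_def)
qed

text \<open>Only the edge between \<open>q\<close> and \<open>r\<close> is reversed: a walk up to
  \<open>q\<close> either meets \<open>r\<close> on its way or continues from \<open>q\<close> by
  one step.\<close>

lemma parent_tree_reroot_child:
  assumes tree: "parent_tree p q M" and r: "r \<in> M" "p r = q"
  shows "parent_tree (p(q := r)) r (insert q M - {r})"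
proof (rule parent_treeI_reach)
  have q: "q \<notin> M" and pM: "\<And>x. x \<in> M \<Longrightarrow> p x \<in> insert q M"
    using tree by (auto simp: parent_tree_def)
  show "r \<notin> insert q M - {r}" by simp
  show "(p(q := r)) x \<in> insert r (insert q M - {r})" if "x \<in> insert q M - {r}" for x
    using that pM r by auto
  let ?R = "{(y, (p(q := r)) y) |y. y \<in> insert q M - {r}}"
  fix x assume "x \<in> insert q M - {r}"
  then have "(x, q) \<in> {(y, p y) |y. y \<in> M}\<^sup>*" using parent_tree_reach[OF tree] by simp
  then show "(x, r) \<in> ?R\<^sup>*"
  proof (induction rule: converse_rtrancl_induct)
    case base
    have "(q, r) \<in> ?R" using q r by auto
    then show ?case by blast
  next
    case (step y z)
    show ?case
    proof (cases "y = r")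
      case False
      then have "(y, z) \<in> ?R" using step q by auto
      then show ?thesis using step by (meson converse_rtrancl_into_rtrancl)
    qed simp
  qed
qed

text \<open>A path through both \<open>q\<close> and \<open>r\<close> has top \<open>q\<close>, and
  \<open>r\<close> begins one of its arms. After the reversal the top is \<open>r\<close>, that arm
  loses \<open>r\<close> and the other gains \<open>q\<close>. All other paths keep their
  arms.\<close>

lemma two_chains_reroot_child:
  assumes tc: "two_chains p q S" and r: "p r = q" "r \<noteq> q"
  shows "two_chains (p(q := r)) r S"
proof -
  obtain t A B where S: "S = insert t (A \<union> B)" "A \<inter> B = {}" "q \<notin> A \<union> B"
     "parent_chain p t A" "parent_chain p t B"
    using tc by (auto simp: two_chains_def)
  show ?thesis
  proof (cases "q \<in> S \<and> r \<in> S")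
    case True
    then have t: "t = q" using S by auto
    have swap: "two_chains (p(q := r)) r S"
      if "r \<in> A" "S = insert t (A \<union> B)" "A \<inter> B = {}" "q \<notin> A \<union> B"
        "parent_chain p t A" "parent_chain p t B" for A B
    proof -
      have inj: "inj_on p A" "inj_on p B" and sub: "p ` A \<subseteq> insert q A" "p ` B \<subseteq> insert q B"
        using that(5,6) t by (auto simp: parent_chain_def)
      have "p a \<in> A - {r} \<or> p a = r" if "a \<in> A - {r}" for a
        using that sub(1) inj_onD[OF inj(1), of a r] \<open>r \<in> A\<close> r(1) by auto
      then have "parent_chain p r (A - {r})"
        using inj(1) by (auto simp: parent_chain_def inj_on_diff)
      then have "parent_chain (p(q := r)) r (A - {r})"
        using that(4) by (simp add: parent_chain_upd)
      moreover have "r \<notin> insert q B" using that(1,3) r(2) by auto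
      then have "parent_chain (p(q := r)) r (insert q B)"
        using inj(2) sub(2) that(4) unfolding parent_chain_def by (auto simp: inj_on_def)
      moreover have "S = insert r ((A - {r}) \<union> insert q B)" "(A - {r}) \<inter> insert q B = {}"
          "r \<notin> (A - {r}) \<union> insert q B"
        using that t r by auto
      ultimately show ?thesis unfolding two_chains_def by blast
    qed
    have "r \<in> A \<or> r \<in> B" using True S t r by auto
    then show ?thesis using swap[of A B] swap[of B A] S by (auto simp: Un_commute Int_commute)
  next
    case False
    have "parent_chain (p(q := r)) t A" "parent_chain (p(q := r)) t B"
      using S(3-5) by (simp_all add: parent_chain_upd)
    moreover have "r \<notin> A \<union> B"
      using False S r by (auto simp: parent_chain_def)
    ultimately show ?thesis using S unfolding two_chains_def by blast
  qed
qed

lemma path_tree_reroot: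
  assumes tree: "path_tree M q p" and x: "x \<in> insert q M"
  shows "\<exists>p'. path_tree (insert q M - {x}) x p'"
proof -
  have q: "q \<notin> M" using tree by (auto simp: path_tree_def parent_tree_def)
  obtain d :: "'a set \<Rightarrow> nat" where d: "\<And>x. x \<in> M \<Longrightarrow> p x \<in> insert q M \<and> d (p x) < d x"
    using tree unfolding path_tree_def parent_tree_def by blast
  \<comment> \<open>The added invariant says that each original edge between \<open>z\<close> and
    \<open>p z\<close> survives in one of its directions. It gives \<open>p' x = y\<close> once the
    tree is rooted at the parent \<open>y\<close> of \<open>x\<close>, and then one reversal
    suffices.\<close>
  have "\<exists>p'. path_tree (insert q M - {x}) x p' \<and>
      (\<forall>z\<in>M. z \<noteq> x \<and> p' z = p z \<or> p z \<noteq> x \<and> p' (p z) = z)"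
    using x
  proof (induction "d x" arbitrary: x rule: less_induct)
    case less
    show ?case
    proof (cases "x = q")
      case True
      then show ?thesis using tree q by (intro exI[of _ p]) auto
    next
      case False
      then have x: "x \<in> M" using less.prems by simp
      define y where "y = p x"
      have y: "y \<in> insert q M" "d y < d x" using d x by (auto simp: y_def)
      then have yx: "y \<noteq> x" by auto
      obtain p' where p': "path_tree (insert q M - {y}) y p'"
        and inv: "\<And>z. z \<in> M \<Longrightarrow> z \<noteq> y \<and> p' z = p z \<or> p z \<noteq> y \<and> p' (p z) = z"
        using less.hyps[OF y(2,1)] by blast
      have p'x: "p' x = y" using inv[OF x] by (auto simp: y_def)
      have ins: "insert y (insert q M - {y}) = insert q M" "insert x (insert q M - {x}) = insert q M"
        using x y by auto
      have "path_tree (insert q M - {x}) x (p'(y := x))"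
        unfolding path_tree_def ins
      proof (intro conjI ballI)
        show "finite (insert q M - {x})" using tree by (simp add: path_tree_def)
        have "parent_tree p' y (insert q M - {y})" using p' by (simp add: path_tree_def)
        then show "parent_tree (p'(y := x)) x (insert q M - {x})"
          using parent_tree_reroot_child[of p' y "insert q M - {y}" x] x p'x yx ins by auto
        show "two_chains (p'(y := x)) x {K \<in> insert q M. v \<in> K}"
          if "v \<in> \<Union> (insert q M)" for v
        proof -
          have "two_chains p' y {K \<in> insert q M. v \<in> K}"
            using p' that unfolding path_tree_def ins by blast
          then show ?thesis by (rule two_chains_reroot_child[where q = y]) (use p'x yx in auto)
        qed
      qed
      moreover have "z \<noteq> x \<and> (p'(y := x)) z = p z \<or> p z \<noteq> x \<and> (p'(y := x)) (p z) = z"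
        if z: "z \<in> M" for z
      proof (cases "z = x")
        case True
        then show ?thesis using yx by (auto simp: y_def)
      next
        case zx: False
        show ?thesis
        proof (cases "z \<noteq> y \<and> p' z = p z")
          case False
          then have *: "p z \<noteq> y" "p' (p z) = z" using inv[OF z] by auto
          have "p z \<noteq> x"
          proof
            assume "p z = x"
            then have "z = y" using * p'x by simp
            then show False using d[OF z] y \<open>p z = x\<close> by simp
          qed
          then show ?thesis using * by simp
        qed (use zx in simp)
      qed
      ultimately show ?thesis by blast
    qed
  qed
  then show ?thesis by blast
qed

section \<open>Merging and joining trees with a common root\<close>

lemma one_sided_empty [simp]: "one_sided {} q p"
  by (simp add: one_sided_def parent_tree_def)

text \<open>By injectivity the \<open>card A\<close> nodes of the chain have only
  \<open>card A\<close> parents, so one of the \<open>card A + 1\<close> nodes of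
  \<open>insert q A\<close> has no child in the chain: its lower end.\<close>

lemma parent_chain_bottom:
  assumes "parent_chain p q A" "finite A"
  shows "\<exists>t\<in>insert q A. t \<notin> p ` A"
proof (rule ccontr)
  assume "\<not> ?thesis"
  then have "insert q A \<subseteq> p ` A" by blast
  then have "card (insert q A) \<le> card A"
    using assms card_image[of p A] card_mono[of "p ` A" "insert q A"]
    by (simp add: parent_chain_def)
  then show False using assms by (simp add: parent_chain_def)
qed

lemma inj_on_disjoint_Un:
  "inj_on f A \<Longrightarrow> inj_on f B \<Longrightarrow> f ` A \<inter> f ` B = {} \<Longrightarrow> inj_on f (A \<union> B)"
  by (auto simp: inj_on_Un)

text \<open>
  All vertices of \<open>q\<close> occurring in \<open>M2\<close> lie in the same nodes of \<open>M1\<close>, hence their chains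
  in \<open>M1\<close> end at the same node; the second tree is hung below that node.
\<close>

lemma one_sided_merge:
  assumes T1: "one_sided M1 q p1" and T2: "one_sided M2 q p2"
    and disj: "M1 \<inter> M2 = {}" and inter: "\<Union>M1 \<inter> \<Union>M2 \<subseteq> q"
    and child: "\<And>K K'. K \<in> M2 \<Longrightarrow> K' \<in> M2 \<Longrightarrow> p2 K = q \<Longrightarrow> p2 K' = q \<Longrightarrow> K = K'"
    and unif: "\<And>v w K. v \<in> q \<Longrightarrow> w \<in> q \<Longrightarrow> v \<in> \<Union>M2 \<Longrightarrow> w \<in> \<Union>M2 \<Longrightarrow> K \<in> M1 \<Longrightarrow> v \<in> K \<Longrightarrow> w \<in> K"
  shows "\<exists>p. one_sided (M1 \<union> M2) q p"
proof -
  have q: "q \<notin> M1" "q \<notin> M2" and fin: "finite M1" "finite M2"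
    using T1 T2 by (auto simp: one_sided_def parent_tree_def)
  obtain d1 :: "'a set \<Rightarrow> nat" where d1: "\<And>x. x \<in> M1 \<Longrightarrow> p1 x \<in> insert q M1 \<and> d1 (p1 x) < d1 x"
    using T1 by (auto simp: one_sided_def parent_tree_def)
  obtain d2 :: "'a set \<Rightarrow> nat" where d2: "\<And>x. x \<in> M2 \<Longrightarrow> p2 x \<in> insert q M2 \<and> d2 (p2 x) < d2 x"
    using T2 by (auto simp: one_sided_def parent_tree_def)
  \<comment> \<open>If no vertex of \<open>q\<close> occurs in \<open>M2\<close>, the condition is
    void and any node serves as \<open>t\<close>.\<close>
  have "\<exists>t\<in>insert q M1. \<forall>v\<in>q \<inter> \<Union>M2. t \<in> insert q {K\<in>M1. v \<in> K} \<and> t \<notin> p1 ` {K\<in>M1. v \<in> K}"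
  proof (cases "q \<inter> \<Union>M2 = {}")
    case False
    then obtain v where v: "v \<in> q" "v \<in> \<Union>M2" by blast
    have eq: "{K\<in>M1. w \<in> K} = {K\<in>M1. v \<in> K}" if "w \<in> q \<inter> \<Union>M2" for w
      using unif[of v w] unif[of w v] v that by blast
    have "parent_chain p1 q {K\<in>M1. v \<in> K}" using T1 v by (auto simp: one_sided_def)
    then obtain t where t: "t \<in> insert q {K\<in>M1. v \<in> K}" "t \<notin> p1 ` {K\<in>M1. v \<in> K}"
      using parent_chain_bottom[of p1 q "{K\<in>M1. v \<in> K}"] fin by auto
    show ?thesis
    proof (intro bexI[of _ t] ballI)
      fix w assume "w \<in> q \<inter> \<Union>M2"
      then show "t \<in> insert q {K\<in>M1. w \<in> K} \<and> t \<notin> p1 ` {K\<in>M1. w \<in> K}"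
        using t by (simp only: eq simp_thms)
    qed (use t in blast)
  qed auto
  then obtain t where t: "t \<in> insert q M1"
    and tv: "\<forall>v\<in>q \<inter> \<Union>M2. t \<in> insert q {K\<in>M1. v \<in> K} \<and> t \<notin> p1 ` {K\<in>M1. v \<in> K}"
    by (rule bexE)
  define p where "p K = (if K \<in> M1 then p1 K else if p2 K = q then t else p2 K)" for K
  have p_M1: "p K = p1 K" if "K \<in> M1" for K using that by (simp add: p_def)
  have p_M2: "p K = (if p2 K = q then t else p2 K)" if "K \<in> M2" for K
    using that disj by (auto simp: p_def)
  \<comment> \<open>A shift beyond all ranks in \<open>insert q M1\<close>, so that the nodes of
    \<open>M2\<close> rank above whatever \<open>t\<close> they are hung below.\<close>
  define D where "D = Suc (Max (d1 ` insert q M1))"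
  have D: "d1 K < D" if "K \<in> insert q M1" for K
    using that fin(1) Max_ge[of "d1 ` insert q M1" "d1 K"] unfolding D_def
    by (simp add: le_imp_less_Suc del: Max_insert image_insert)
  define d where "d K = (if K \<in> insert q M1 then d1 K else d2 K + D)" for K
  have "p K \<in> insert q (M1 \<union> M2) \<and> d (p K) < d K" if K: "K \<in> M1 \<union> M2" for K
  proof (cases "K \<in> M1")
    case True
    then show ?thesis using d1[OF True] p_M1[OF True] by (auto simp: d_def)
  next
    case False
    then have K2: "K \<in> M2" "K \<notin> insert q M1" using K q by auto
    show ?thesis
    proof (cases "p2 K = q")
      case True
      then show ?thesis using p_M2[OF K2(1)] K2 t D[OF t] by (auto simp: d_def)
    next
      case False
      then have "p2 K \<in> M2" "p2 K \<notin> insert q M1" using d2[OF K2(1)] disj by auto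
      then show ?thesis using p_M2[OF K2(1)] K2 False d2[OF K2(1)] by (auto simp: d_def)
    qed
  qed
  then have tree: "parent_tree p q (M1 \<union> M2)"
    using q unfolding parent_tree_def by blast
  have "parent_chain p q {K\<in>M1 \<union> M2. v \<in> K}" if v: "v \<in> q" for v
  proof -
    let ?A1 = "{K\<in>M1. v \<in> K}" and ?A2 = "{K\<in>M2. v \<in> K}"
    have split: "{K\<in>M1 \<union> M2. v \<in> K} = ?A1 \<union> ?A2" by auto
    have c1: "inj_on p1 ?A1" "p1 ` ?A1 \<subseteq> insert q ?A1"
      using T1 v by (auto simp: one_sided_def parent_chain_def)
    have c2: "inj_on p2 ?A2" "p2 ` ?A2 \<subseteq> insert q ?A2"
      using T2 v by (auto simp: one_sided_def parent_chain_def)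
    have 1: "inj_on p ?A1" "p ` ?A1 = p1 ` ?A1"
      using c1(1) p_M1 by (auto simp: inj_on_def image_def)
    show ?thesis
    proof (cases "v \<in> \<Union>M2")
      case False
      then have "?A2 = {}" by auto
      then have "{K\<in>M1 \<union> M2. v \<in> K} = ?A1" by (simp only: split Un_empty_right)
      moreover have "q \<notin> ?A1" using q by simp
      ultimately show ?thesis using 1 c1(2) by (simp only: parent_chain_def simp_thms)
    next
      case True
      note t' = bspec[OF tv IntI[OF v True]]
      have t2: "t \<notin> M2" using t q disj by auto
      have 2: "p K = t \<or> p K \<in> ?A2" if "K \<in> ?A2" for K
        using that c2(2) p_M2[of K] by auto
      \<comment> \<open>Injectivity at \<open>t\<close> comes from \<open>child\<close>: only one
        node of \<open>M2\<close> is hung there.\<close>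
      have "K = K'" if "K \<in> ?A2" "K' \<in> ?A2" "p K = p K'" for K K'
      proof (cases "p2 K = q \<or> p2 K' = q")
        case True
        then have "p2 K = q" "p2 K' = q"
          using that p_M2[of K] p_M2[of K'] t2 d2[of K] d2[of K'] by (auto split: if_splits)
        then show ?thesis using child that by blast
      next
        case False
        then show ?thesis using that p_M2[of K] p_M2[of K'] c2(1) by (auto simp: inj_on_def)
      qed
      then have inj2: "inj_on p ?A2" by (rule inj_onI)
      have "p ` ?A1 \<inter> p ` ?A2 = {}"
      proof (rule ccontr)
        assume "p ` ?A1 \<inter> p ` ?A2 \<noteq> {}"
        then obtain y where "y \<in> p1 ` ?A1" "y \<in> p ` ?A2" unfolding 1(2) by (meson disjoint_iff)
        then obtain K where y: "y \<in> p1 ` ?A1" "K \<in> ?A2" "y = p K" by (meson imageE)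
        have "y \<noteq> t" using y(1) t' by auto
        then have "y \<in> ?A2" using y(3) 2[OF y(2)] by simp
        moreover have "y \<in> insert q ?A1" using y(1) c1(2) by blast
        ultimately show False using q(2) disj by blast
      qed
      then have "inj_on p (?A1 \<union> ?A2)"
        using 1(1) inj2 by (intro inj_on_disjoint_Un)
      moreover have "p ` (?A1 \<union> ?A2) \<subseteq> insert q (?A1 \<union> ?A2)"
      proof -
        have "p ` ?A1 \<subseteq> insert q ?A1" using 1(2) c1(2) by simp
        moreover have "p ` ?A2 \<subseteq> insert t ?A2" using 2 by (intro image_subsetI) (simp only: insert_iff)
        ultimately show ?thesis using t' by (simp only: image_Un) blast
      qed
      moreover have "q \<notin> ?A1 \<union> ?A2" using q by simp
      ultimately show ?thesis by (simp only: split parent_chain_def simp_thms)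
    qed
  qed
  moreover have "two_chains p q {K\<in>M1 \<union> M2. v \<in> K}" if v: "v \<in> \<Union>(M1 \<union> M2) - q" for v
  proof (cases "v \<in> \<Union>M1")
    case True
    then have "v \<notin> \<Union>M2" using inter v by auto
    then have "{K\<in>M1 \<union> M2. v \<in> K} = {K\<in>M1. v \<in> K}" by auto
    moreover have "two_chains p1 q {K\<in>M1. v \<in> K}"
      using T1 v True unfolding one_sided_def by blast
    then have "two_chains p q {K\<in>M1. v \<in> K}"
      by (rule two_chains_cong) (use p_M1 in simp_all)
    ultimately show ?thesis by simp
  next
    case False
    then have "{K\<in>M1 \<union> M2. v \<in> K} = {K\<in>M2. v \<in> K}" by auto
    moreover have "two_chains p2 q {K\<in>M2. v \<in> K}"
      using T2 v False unfolding one_sided_def by blast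
    then have "two_chains p q {K\<in>M2. v \<in> K}"
      by (rule two_chains_cong) (use p_M2 q in auto)
    ultimately show ?thesis by simp
  qed
  ultimately have "one_sided (M1 \<union> M2) q p"
    using tree fin by (auto simp: one_sided_def)
  then show ?thesis by blast
qed

text \<open>A vertex of \<open>q\<close> occurs in at most two of the trees, and its chains there
  become the two arms of a path with top \<open>q\<close>.\<close>

lemma one_sided_join:
  fixes M :: "'i \<Rightarrow> 'v set set"
  assumes "finite I" and os: "\<And>i. i \<in> I \<Longrightarrow> one_sided (M i) q (p i)"
    and disj: "\<And>i j. i \<in> I \<Longrightarrow> j \<in> I \<Longrightarrow> i \<noteq> j \<Longrightarrow> M i \<inter> M j = {}"
    and inter: "\<And>i j. i \<in> I \<Longrightarrow> j \<in> I \<Longrightarrow> i \<noteq> j \<Longrightarrow> \<Union>(M i) \<inter> \<Union>(M j) \<subseteq> q"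
    and two: "\<And>v. v \<in> q \<Longrightarrow> \<exists>i j. \<forall>k\<in>I. v \<in> \<Union>(M k) \<longrightarrow> k = i \<or> k = j"
  shows "\<exists>p'. path_tree (\<Union>i\<in>I. M i) q p'"
proof -
  define ix where "ix K = (THE i. i \<in> I \<and> K \<in> M i)" for K
  have ix: "ix K = i" if "i \<in> I" "K \<in> M i" for i K
    unfolding ix_def using that disj by (intro the_equality) auto
  define p' where "p' K = p (ix K) K" for K
  have p': "p' K = p i K" if "i \<in> I" "K \<in> M i" for i K
    using ix[OF that] by (simp add: p'_def)
  have q: "q \<notin> M i" if "i \<in> I" for i
    using os[OF that] by (auto simp: one_sided_def parent_tree_def)
  have "\<exists>d::'v set \<Rightarrow> nat. \<forall>x\<in>M i. p i x \<in> insert q (M i) \<and> d (p i x) < d x" if "i \<in> I" for i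
    using os[OF that] by (auto simp: one_sided_def parent_tree_def)
  then obtain d :: "'i \<Rightarrow> 'v set \<Rightarrow> nat"
    where d: "\<And>i x. i \<in> I \<Longrightarrow> x \<in> M i \<Longrightarrow> p i x \<in> insert q (M i) \<and> d i (p i x) < d i x"
    by metis
  \<comment> \<open>The given ranks need not agree at \<open>q\<close>; the root gets 0 and all
    others are raised by one.\<close>
  define d' where "d' K = (if K = q then 0 else Suc (d (ix K) K))" for K
  have "parent_tree p' q (\<Union>i\<in>I. M i)"
    unfolding parent_tree_def
  proof (intro conjI exI[of _ d'] ballI)
    show "q \<notin> (\<Union>i\<in>I. M i)" using q by auto
    fix K assume "K \<in> (\<Union>i\<in>I. M i)"
    then obtain i where i: "i \<in> I" "K \<in> M i" by auto
    show "p' K \<in> insert q (\<Union>i\<in>I. M i)" using p'[OF i] d[OF i] i by auto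
    have "K \<noteq> q" using q i by auto
    show "d' (p' K) < d' K"
    proof (cases "p i K = q")
      case True
      then show ?thesis using p'[OF i] \<open>K \<noteq> q\<close> by (simp add: d'_def)
    next
      case False
      then have "p i K \<in> M i" using d[OF i] by auto
      then show ?thesis
        using p'[OF i] \<open>K \<noteq> q\<close> False ix[OF i] ix[OF i(1), of "p i K"] d[OF i]
        by (simp add: d'_def)
    qed
  qed
  moreover have "two_chains p' q {K\<in>insert q (\<Union>i\<in>I. M i). v \<in> K}"
    if v: "v \<in> \<Union>(insert q (\<Union>i\<in>I. M i))" for v
  proof (cases "v \<in> q")
    case True
    have chain: "parent_chain p' q {K\<in>M i. v \<in> K}" if "i \<in> I" for i
    proof -
      have "parent_chain (p i) q {K\<in>M i. v \<in> K}" using os[OF that] True by (auto simp: one_sided_def)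
      then show ?thesis using parent_chain_cong[of "{K\<in>M i. v \<in> K}" p' "p i" q] p' that by auto
    qed
    obtain i j where ij: "\<And>k. k \<in> I \<Longrightarrow> v \<in> \<Union>(M k) \<Longrightarrow> k = i \<or> k = j" using two[OF True] by blast
    define A where "A k = (if k \<in> I then {K\<in>M k. v \<in> K} else {})" for k
    have A: "parent_chain p' q (A k)" "q \<notin> A k" for k using chain q by (auto simp: A_def)
    have "{K\<in>insert q (\<Union>i\<in>I. M i). v \<in> K} = insert q (A i \<union> A j)"
    proof (intro equalityI subsetI)
      fix K assume "K \<in> {K\<in>insert q (\<Union>i\<in>I. M i). v \<in> K}"
      then consider "K = q" | k where "k \<in> I" "K \<in> M k" "v \<in> K" by blast
      then show "K \<in> insert q (A i \<union> A j)"
        by cases (use ij in \<open>auto simp: A_def\<close>)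
    qed (use True in \<open>auto simp: A_def split: if_splits\<close>)
    \<comment> \<open>If both indices name the same tree, the second arm must be empty, since arms
      are disjoint.\<close>
    moreover define B where "B = (if i = j then {} else A j)"
    moreover have "A i \<inter> B = {}" using disj by (auto simp: A_def B_def)
    moreover have "parent_chain p' q B" "q \<notin> A i \<union> B" using A by (auto simp: B_def)
    moreover have "A i \<union> A j = A i \<union> B" by (auto simp: B_def)
    ultimately show ?thesis
      unfolding two_chains_def using A(1)[of i] by metis
  next
    case False
    then obtain i where i: "i \<in> I" "v \<in> \<Union>(M i)" using v by auto
    have "v \<notin> \<Union>(M k)" if "k \<in> I" "k \<noteq> i" for k using inter[of i k] that i False by auto
    then have eq: "{K\<in>insert q (\<Union>i\<in>I. M i). v \<in> K} = {K\<in>M i. v \<in> K}"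
      using False i by auto
    have "two_chains (p i) q {K\<in>M i. v \<in> K}" using os[OF i(1)] i False by (auto simp: one_sided_def)
    then show ?thesis unfolding eq by (rule two_chains_cong) (use p' i in auto)
  qed
  moreover have "finite (\<Union>i\<in>I. M i)" using assms(1) os by (auto simp: one_sided_def)
  ultimately have "path_tree (\<Union>i\<in>I. M i) q p'" by (simp add: path_tree_def)
  then show ?thesis by blast
qed

section \<open>Gluing clique trees at a maximal clique\<close>

lemma at_most_two:
  assumes "\<And>a b c. P a \<Longrightarrow> P b \<Longrightarrow> P c \<Longrightarrow> a = b \<or> a = c \<or> b = c"
  shows "\<exists>i j. \<forall>k. P k \<longrightarrow> k = i \<or> k = j"
  using assms by metis

text \<open>Adjacency is fixed while vertex sets are arguments, because the induction passes to
  vertex subsets of one graph.\<close>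

locale ugraph =
  fixes adj :: "'a \<Rightarrow> 'a \<Rightarrow> bool"
  assumes adj_sym: "adj x y \<Longrightarrow> adj y x" and adj_irrefl: "\<not> adj x x"
begin

definition mclique :: "'a set \<Rightarrow> 'a set \<Rightarrow> bool" where
  "mclique V K \<longleftrightarrow> K \<subseteq> V \<and> (\<forall>x\<in>K. \<forall>y\<in>K. x \<noteq> y \<longrightarrow> adj x y) \<and> (\<forall>x\<in>V - K. \<exists>y\<in>K. \<not> adj x y)"

text \<open>Connectedness is phrased through closed subsets so that it can be applied directly: a
  property that holds somewhere in \<open>C\<close> and spreads along edges holds on all of
  \<open>C\<close>.\<close>

definition component :: "'a set \<Rightarrow> 'a set \<Rightarrow> 'a set \<Rightarrow> bool" where
  "component V Q C \<longleftrightarrow> C \<noteq> {} \<and> C \<subseteq> V - Q \<and> (\<forall>x\<in>C. \<forall>y\<in>V - Q. adj x y \<longrightarrow> y \<in> C) \<and>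
     (\<forall>W\<subseteq>C. W \<noteq> {} \<and> (\<forall>x\<in>W. \<forall>y\<in>C. adj x y \<longrightarrow> y \<in> W) \<longrightarrow> W = C)"

text \<open>For a component \<open>C\<close> these are the maximal cliques of
  \<open>C \<union> Q\<close> other than \<open>Q\<close>, hence what \<open>C\<close> contributes
  to a clique tree rooted at \<open>Q\<close>.\<close>

definition nodes :: "'a set \<Rightarrow> 'a set \<Rightarrow> 'a set set" where
  "nodes V C = {K. mclique V K \<and> K \<inter> C \<noteq> {}}"

text \<open>For a component, this is the union of the traces on \<open>Q\<close> of the relevant
  cliques, and the set of those \<open>v\<close> of which it gives a neighboring subgraph.\<close>

definition foot :: "'a set \<Rightarrow> 'a set \<Rightarrow> 'a set" where
  "foot Q C = {v\<in>Q. \<exists>c\<in>C. adj v c}"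

text \<open>Dominance between distinct components: a condition on all relevant cliques of
  \<open>C\<close> becomes one on the union of their traces. The cliques \<open>K\<close> that miss
  \<open>Q\<close> may be included, as they satisfy the second alternative.\<close>

definition subordinate :: "'a set \<Rightarrow> 'a set \<Rightarrow> 'a set \<Rightarrow> 'a set \<Rightarrow> bool" where
  "subordinate V Q C C' \<longleftrightarrow> foot Q C \<inter> foot Q C' \<noteq> {} \<and>
     (\<forall>K\<in>nodes V C'. foot Q C \<subseteq> K \<or> foot Q C \<inter> K = {})"

text \<open>The counterpart of \<open>strong_coloring\<close> for components, with antipodality
  turned into its contrapositive.\<close>

definition coloring :: "'a set \<Rightarrow> 'a set \<Rightarrow> ('a set \<Rightarrow> nat) \<Rightarrow> bool" where
  "coloring V Q g \<longleftrightarrow>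
     (\<forall>C C'. component V Q C \<and> component V Q C' \<and> C \<noteq> C' \<and> g C = g C' \<and>
        foot Q C \<inter> foot Q C' \<noteq> {} \<longrightarrow> subordinate V Q C C' \<or> subordinate V Q C' C) \<and>
     (\<forall>v C C' C''. component V Q C \<and> component V Q C' \<and> component V Q C'' \<and>
        v \<in> foot Q C \<and> v \<in> foot Q C' \<and> v \<in> foot Q C'' \<longrightarrow> g C = g C' \<or> g C = g C'' \<or> g C' = g C'')"

definition colorable :: "'a set \<Rightarrow> 'a set \<Rightarrow> bool" where
  "colorable V Q \<longleftrightarrow> (\<exists>g. coloring V Q g)"

lemma coloringI:
  assumes "\<And>C C'. component V Q C \<Longrightarrow> component V Q C' \<Longrightarrow> C \<noteq> C' \<Longrightarrow> g C = g C' \<Longrightarrow>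
      foot Q C \<inter> foot Q C' \<noteq> {} \<Longrightarrow> subordinate V Q C C' \<or> subordinate V Q C' C"
    and "\<And>v C C' C''. component V Q C \<Longrightarrow> component V Q C' \<Longrightarrow> component V Q C'' \<Longrightarrow>
      v \<in> foot Q C \<Longrightarrow> v \<in> foot Q C' \<Longrightarrow> v \<in> foot Q C'' \<Longrightarrow> g C = g C' \<or> g C = g C'' \<or> g C' = g C''"
  shows "coloring V Q g"
  unfolding coloring_def
  by (intro conjI allI impI; elim conjE) (rule assms; assumption)+

lemma coloring_comparable:
  assumes "coloring V Q g" "component V Q C" "component V Q C'" "C \<noteq> C'" "g C = g C'"
    "foot Q C \<inter> foot Q C' \<noteq> {}"
  shows "subordinate V Q C C' \<or> subordinate V Q C' C"
  using assms by (simp add: coloring_def)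

lemma coloring_two:
  assumes "coloring V Q g" "component V Q C" "component V Q C'" "component V Q C''"
    "v \<in> foot Q C" "v \<in> foot Q C'" "v \<in> foot Q C''"
  shows "g C = g C' \<or> g C = g C'' \<or> g C' = g C''"
  using assms unfolding coloring_def by blast

lemma mcliqueD:
  assumes "mclique V K"
  shows "K \<subseteq> V" "x \<in> K \<Longrightarrow> y \<in> K \<Longrightarrow> x \<noteq> y \<Longrightarrow> adj x y"
    and "x \<in> V \<Longrightarrow> x \<notin> K \<Longrightarrow> \<exists>y\<in>K. \<not> adj x y"
  using assms by (auto simp: mclique_def)

lemma mclique_extend:
  assumes fin: "finite V" and K: "K \<subseteq> V" "\<forall>x\<in>K. \<forall>y\<in>K. x \<noteq> y \<longrightarrow> adj x y"
  shows "\<exists>L. mclique V L \<and> K \<subseteq> L"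
proof -
  let ?F = "{L. K \<subseteq> L \<and> L \<subseteq> V \<and> (\<forall>x\<in>L. \<forall>y\<in>L. x \<noteq> y \<longrightarrow> adj x y)}"
  have "finite ?F" by (rule finite_subset[of _ "Pow V"]) (use fin in auto)
  moreover have "?F \<noteq> {}" using K by blast
  ultimately obtain L where L: "L \<in> ?F" "\<forall>M\<in>?F. L \<subseteq> M \<longrightarrow> L = M"
    by (meson finite_has_maximal)
  have "\<exists>y\<in>L. \<not> adj x y" if "x \<in> V - L" for x
  proof (rule ccontr)
    assume "\<not> ?thesis"
    then have "insert x L \<in> ?F" using L(1) that adj_sym by auto
    then have "L \<subseteq> insert x L \<longrightarrow> L = insert x L" by (rule bspec[OF L(2)])
    then show False using that by auto
  qed
  then show ?thesis using L(1) unfolding mclique_def by blast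
qed

lemma mclique_subset_eq: "mclique V K \<Longrightarrow> mclique V L \<Longrightarrow> K \<subseteq> L \<Longrightarrow> K = L"
  using mcliqueD[of V K] mcliqueD[of V L] by blast

lemma componentD:
  assumes "component V Q C"
  shows "C \<noteq> {}" "C \<subseteq> V" "C \<inter> Q = {}" "x \<in> C \<Longrightarrow> y \<in> V \<Longrightarrow> y \<notin> Q \<Longrightarrow> adj x y \<Longrightarrow> y \<in> C"
  using assms by (auto simp: component_def)

lemma component_connected:
  assumes "component V Q C" "W \<subseteq> C" "W \<noteq> {}" "\<And>x y. x \<in> W \<Longrightarrow> y \<in> C \<Longrightarrow> adj x y \<Longrightarrow> y \<in> W"
  shows "W = C"
proof -
  have "\<forall>W\<subseteq>C. W \<noteq> {} \<and> (\<forall>x\<in>W. \<forall>y\<in>C. adj x y \<longrightarrow> y \<in> W) \<longrightarrow> W = C"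
    using assms(1) unfolding component_def by (elim conjE)
  then show ?thesis using assms(2-4) by simp
qed

lemma componentI:
  assumes "C \<noteq> {}" "C \<subseteq> V - Q" "\<And>x y. x \<in> C \<Longrightarrow> y \<in> V - Q \<Longrightarrow> adj x y \<Longrightarrow> y \<in> C"
    and "\<And>W. W \<subseteq> C \<Longrightarrow> W \<noteq> {} \<Longrightarrow> \<forall>x\<in>W. \<forall>y\<in>C. adj x y \<longrightarrow> y \<in> W \<Longrightarrow> W = C"
  shows "component V Q C"
  unfolding component_def using assms by (intro conjI allI ballI impI; (elim conjE)?) simp_all

lemma component_exists:
  assumes "x \<in> V - Q"
  shows "\<exists>C. component V Q C \<and> x \<in> C"
proof -
  define R where "R = {(a, b). a \<in> V - Q \<and> b \<in> V - Q \<and> adj a b}"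
  define C where "C = {y. (x, y) \<in> R\<^sup>*}"
  have symR: "sym (R\<^sup>*)" by (rule sym_rtrancl) (auto simp: R_def sym_def adj_sym)
  have sub: "C \<subseteq> V - Q"
  proof
    fix y assume "y \<in> C"
    then have "(x, y) \<in> R\<^sup>*" by (simp add: C_def)
    then show "y \<in> V - Q" by (cases rule: rtranclE) (use assms in \<open>auto simp: R_def\<close>)
  qed
  have closed: "z \<in> C" if "y \<in> C" "z \<in> V - Q" "adj y z" for y z
  proof -
    have "(y, z) \<in> R" using that sub by (auto simp: R_def)
    then show ?thesis using that(1) unfolding C_def by (auto intro: rtrancl_into_rtrancl)
  qed
  have conn: "W = C" if W: "W \<subseteq> C" "W \<noteq> {}" "\<forall>y\<in>W. \<forall>z\<in>C. adj y z \<longrightarrow> z \<in> W" for W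
  proof -
    obtain w where w: "w \<in> W" using W by blast
    have "(w, x) \<in> R\<^sup>*" using w W(1) symR by (auto simp: C_def dest: symD)
    have "y \<in> W" if "y \<in> C" for y
    proof -
      have "(w, y) \<in> R\<^sup>*" using \<open>(w, x) \<in> R\<^sup>*\<close> that by (auto simp: C_def)
      then show ?thesis
      proof (induction rule: rtrancl_induct)
        case (step y z)
        then have "z \<in> C" using closed W(1) by (auto simp: R_def)
        then show ?case using step W(3) by (auto simp: R_def)
      qed (use w in simp)
    qed
    then show ?thesis using W(1) by blast
  qed
  have "x \<in> C" by (simp add: C_def)
  moreover have "component V Q C"
    by (rule componentI) (use \<open>x \<in> C\<close> sub closed conn in blast)+
  ultimately show ?thesis by blast
qed

lemma component_unique:
  assumes "component V Q C" "component V Q C'" "x \<in> C" "x \<in> C'"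
  shows "C = C'"
proof -
  have *: "D \<inter> D' = D" if D: "component V Q D" "component V Q D'" "x \<in> D" "x \<in> D'" for D D'
  proof (rule component_connected[OF D(1)])
    show "z \<in> D \<inter> D'" if "y \<in> D \<inter> D'" "z \<in> D" "adj y z" for y z
      using that componentD(4)[OF D(2), of y z] componentD(2,3)[OF D(1)] by blast
  qed (use D in auto)
  show ?thesis using *[OF assms] *[OF assms(2,1,4,3)] by blast
qed

lemma finite_components: "finite V \<Longrightarrow> finite {C. component V Q C}"
  by (rule finite_subset[of _ "Pow V"]) (auto simp: component_def)

lemma finite_mcliques: "finite V \<Longrightarrow> finite {K. mclique V K}"
  by (rule finite_subset[of _ "Pow V"]) (auto simp: mclique_def)

lemma nodes_subset:
  assumes "component V Q C" "K \<in> nodes V C"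
  shows "K \<subseteq> C \<union> Q"
proof
  fix x assume x: "x \<in> K"
  obtain c where c: "c \<in> K" "c \<in> C" and K: "mclique V K" using assms(2) by (auto simp: nodes_def)
  show "x \<in> C \<union> Q"
    using x c mcliqueD[OF K] componentD[OF assms(1)] by blast
qed

lemma nodes_disjoint:
  assumes "component V Q C" "component V Q C'" "C \<noteq> C'"
  shows "nodes V C \<inter> nodes V C' = {}" "\<Union>(nodes V C) \<inter> \<Union>(nodes V C') \<subseteq> Q"
proof -
  have disj: "C \<inter> C' = {}" using component_unique assms by blast
  show "\<Union>(nodes V C) \<inter> \<Union>(nodes V C') \<subseteq> Q"
    using nodes_subset[OF assms(1)] nodes_subset[OF assms(2)] disj by blast
  show "nodes V C \<inter> nodes V C' = {}"
  proof (rule ccontr)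
    assume "\<not> ?thesis"
    then obtain K where K: "K \<in> nodes V C" "K \<in> nodes V C'" by blast
    then obtain c where "c \<in> K" "c \<in> C'" by (auto simp: nodes_def)
    then show False using nodes_subset[OF assms(1) K(1)] disj componentD[OF assms(2)] by blast
  qed
qed

lemma mclique_cases:
  assumes "mclique V Q" "mclique V K" "K \<noteq> Q"
  shows "\<exists>C. component V Q C \<and> K \<in> nodes V C"
proof -
  obtain x where x: "x \<in> K" "x \<notin> Q" using assms mclique_subset_eq by blast
  then have "x \<in> V - Q" using mcliqueD[OF assms(2)] by blast
  then show ?thesis using component_exists x assms(2) unfolding nodes_def by blast
qed

lemma base_notin_nodes: "component V Q C \<Longrightarrow> Q \<notin> nodes V C"
  by (auto simp: nodes_def component_def)

text \<open>A clique not inside \<open>Q\<close> contains some \<open>c\<close> of \<open>C\<close>,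
  and all neighbors of \<open>c\<close> in \<open>V\<close> lie in \<open>C \<union> Q\<close>; so
  maximality in \<open>C \<union> Q\<close> and in \<open>V\<close> agree.\<close>

lemma mclique_component:
  assumes Q: "mclique V Q" and C: "component V Q C"
  shows "mclique (C \<union> Q) K \<longleftrightarrow> K = Q \<or> K \<in> nodes V C"
proof
  assume K: "mclique (C \<union> Q) K"
  show "K = Q \<or> K \<in> nodes V C"
  proof (cases "K \<subseteq> Q")
    case True
    have "Q \<subseteq> K"
    proof
      fix x assume x: "x \<in> Q"
      show "x \<in> K"
      proof (rule ccontr)
        assume "x \<notin> K"
        then obtain y where "y \<in> K" "\<not> adj x y" using mcliqueD(3)[OF K, of x] x by blast
        then show False using mcliqueD(2)[OF Q x, of y] True \<open>x \<notin> K\<close> by blast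
      qed
    qed
    then show ?thesis using True by blast
  next
    case False
    then obtain c where c: "c \<in> K" "c \<in> C" using mcliqueD(1)[OF K] by blast
    have "mclique V K"
      unfolding mclique_def
    proof (intro conjI ballI impI)
      show "K \<subseteq> V" using mcliqueD(1)[OF K] mcliqueD(1)[OF Q] componentD(2)[OF C] by blast
      show "adj x y" if "x \<in> K" "y \<in> K" "x \<noteq> y" for x y using mcliqueD(2)[OF K] that .
      fix x assume x: "x \<in> V - K"
      show "\<exists>y\<in>K. \<not> adj x y"
      proof (cases "x \<in> C \<union> Q")
        case True
        then show ?thesis using mcliqueD(3)[OF K] x by blast
      next
        case False
        then have "\<not> adj c x" using componentD(4)[OF C c(2)] x by blast
        then show ?thesis using c adj_sym by blast
      qed
    qed
    then show ?thesis using c by (auto simp: nodes_def)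
  qed
next
  have V: "C \<union> Q \<subseteq> V" using mcliqueD(1)[OF Q] componentD(2)[OF C] by blast
  assume "K = Q \<or> K \<in> nodes V C"
  then have "K \<subseteq> C \<union> Q" "mclique V K" using nodes_subset[OF C] Q by (auto simp: nodes_def)
  then show "mclique (C \<union> Q) K" using V unfolding mclique_def by blast
qed

lemma foot_iff:
  assumes "finite V" "Q \<subseteq> V" and C: "component V Q C"
  shows "v \<in> foot Q C \<longleftrightarrow> v \<in> Q \<and> v \<in> \<Union>(nodes V C)"
proof
  assume "v \<in> foot Q C"
  then obtain c where c: "v \<in> Q" "c \<in> C" "adj v c" by (auto simp: foot_def)
  have "{v, c} \<subseteq> V" using c assms(2) componentD(2)[OF C] by blast
  then obtain K where "mclique V K" "{v, c} \<subseteq> K"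
    using mclique_extend[OF assms(1), of "{v,c}"] c adj_sym by auto
  then show "v \<in> Q \<and> v \<in> \<Union>(nodes V C)" using c by (auto simp: nodes_def)
next
  assume v: "v \<in> Q \<and> v \<in> \<Union>(nodes V C)"
  then obtain K c where K: "mclique V K" "c \<in> K" "c \<in> C" "v \<in> K" by (auto simp: nodes_def)
  then have "v \<noteq> c" using v componentD(3)[OF C] by blast
  then show "v \<in> foot Q C" using K v mcliqueD(2)[OF K(1)] by (auto simp: foot_def)
qed

text \<open>
  The nodes of the subtree hanging from a child of \<open>Q\<close> are closed under sharing a vertex
  of the connected set \<open>C\<close>.
\<close>

lemma path_tree_component_child:
  assumes fin: "finite V" and C: "component V Q C" and T: "path_tree (nodes V C) Q p"
    and r: "r \<in> nodes V C" "p r = Q" and r': "r' \<in> nodes V C" "p r' = Q"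
  shows "r = r'"
proof -
  let ?N = "nodes V C"
  let ?E = "{(y, p y) |y. y \<in> ?N}"
  have QN: "Q \<notin> ?N" using base_notin_nodes[OF C] .
  obtain d :: "'a set \<Rightarrow> nat" where d: "\<And>x. x \<in> ?N \<Longrightarrow> p x \<in> insert Q ?N \<and> d (p x) < d x"
    using T unfolding path_tree_def parent_tree_def by blast
  \<comment> \<open>The subtree below \<open>r\<close>. An edge avoiding \<open>Q\<close> has both
    ends in it or both outside.\<close>
  define X where "X = {K\<in>?N. (K, r) \<in> ?E\<^sup>*}"
  have rX: "r \<in> X" using r by (simp add: X_def)
  have X: "K \<in> X \<longleftrightarrow> p K \<in> X" if "K \<in> ?N" "p K \<noteq> Q" for K
  proof
    assume "K \<in> X"
    then have "(K, r) \<in> ?E\<^sup>*" by (simp add: X_def)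
    then have "(p K, r) \<in> ?E\<^sup>*"
      by (cases rule: converse_rtranclE) (use that r in auto)
    then show "p K \<in> X" using d that by (auto simp: X_def)
  next
    assume "p K \<in> X"
    then show "K \<in> X" using that by (auto simp: X_def intro: converse_rtrancl_into_rtrancl)
  qed
  \<comment> \<open>As \<open>c\<close> is not in \<open>Q\<close>, its nodes form a path avoiding
    \<open>Q\<close>, and they lie in the subtree all together or not at all.\<close>
  have sub: "K' \<in> X" if c: "c \<in> C" and K: "K \<in> X" "c \<in> K" "K' \<in> ?N" "c \<in> K'" for c K K'
  proof -
    have cQ: "c \<notin> Q" using c componentD(3)[OF C] by blast
    have "c \<in> \<Union>(insert Q ?N)" using K by (auto simp: X_def)
    then have "two_chains p Q {K\<in>insert Q ?N. c \<in> K}" using T unfolding path_tree_def by blast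
    moreover have "{K\<in>insert Q ?N. c \<in> K} = {K\<in>?N. c \<in> K}" using cQ by auto
    ultimately obtain t A B where S: "{K\<in>?N. c \<in> K} = insert t (A \<union> B)"
       "parent_chain p t A" "parent_chain p t B"
      unfolding two_chains_def by auto
    have step: "K \<in> X \<longleftrightarrow> t \<in> X" if "K \<in> insert t (A \<union> B)" for K
      using that
    proof (induction "d K" arbitrary: K rule: less_induct)
      case less
      show ?case
      proof (cases "K = t")
        case False
        then have pK: "p K \<in> insert t (A \<union> B)"
          using less.prems S(2,3) unfolding parent_chain_def by blast
        then have "p K \<noteq> Q" using S(1) QN by blast
        moreover have "K \<in> ?N" using less.prems S(1) by blast
        ultimately show ?thesis using X less.hyps[OF _ pK] d by blast
      qed simp
    qed
    have "K \<in> insert t (A \<union> B)" "K' \<in> insert t (A \<union> B)"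
      using K S(1) by (auto simp: X_def)
    then show ?thesis using step K(1) by blast
  qed
  define W where "W = {c\<in>C. \<exists>K\<in>X. c \<in> K}"
  have "W = C"
  proof (rule component_connected[OF C])
    show "W \<subseteq> C" by (auto simp: W_def)
    show "W \<noteq> {}" using rX r by (auto simp: W_def nodes_def)
    fix x y assume x: "x \<in> W" and y: "y \<in> C" "adj x y"
    have "{x, y} \<subseteq> V" using x y componentD(2)[OF C] by (auto simp: W_def)
    then obtain K where "mclique V K" "{x, y} \<subseteq> K"
      using mclique_extend[OF fin, of "{x,y}"] y adj_sym by auto
    then have "K \<in> X" using sub[of x _ K] x y by (auto simp: W_def nodes_def)
    then show "y \<in> W" using y \<open>{x, y} \<subseteq> K\<close> by (auto simp: W_def)
  qed
  moreover obtain c where c: "c \<in> r'" "c \<in> C" using r' by (auto simp: nodes_def)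
  ultimately obtain K where "K \<in> X" "c \<in> K" unfolding W_def by blast
  then have "r' \<in> X" using sub[OF c(2) _ _ r'(1) c(1)] by blast
  then have "(r', r) \<in> ?E\<^sup>*" by (simp add: X_def)
  then show ?thesis
  proof (cases rule: converse_rtranclE)
    \<comment> \<open>The walk would go from \<open>r'\<close> to \<open>Q\<close>, where no edge
      starts.\<close>
    case (step y)
    then have "(Q, r) \<in> ?E\<^sup>*" using r' by auto
    then show ?thesis by (cases rule: converse_rtranclE) (use QN r in auto)
  qed simp
qed

text \<open>The path of a vertex of \<open>Q\<close> has top \<open>Q\<close>. Two nonempty arms
  would give two different children of \<open>Q\<close>, but a component allows only one.\<close>

lemma one_sided_component:
  assumes fin: "finite V" and C: "component V Q C" and T: "path_tree (nodes V C) Q p"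
  shows "one_sided (nodes V C) Q p"
proof -
  let ?N = "nodes V C"
  have QN: "Q \<notin> ?N" using base_notin_nodes[OF C] .
  obtain d :: "'a set \<Rightarrow> nat" where d: "\<And>x. x \<in> ?N \<Longrightarrow> p x \<in> insert Q ?N \<and> d (p x) < d x"
    using T unfolding path_tree_def parent_tree_def by blast
  have "parent_chain p Q {K\<in>?N. v \<in> K}" if v: "v \<in> Q" for v
  proof -
    have "two_chains p Q {K\<in>insert Q ?N. v \<in> K}" using T v unfolding path_tree_def by blast
    then obtain t A B where S: "{K\<in>insert Q ?N. v \<in> K} = insert t (A \<union> B)" "A \<inter> B = {}"
       "Q \<notin> A \<union> B" "parent_chain p t A" "parent_chain p t B"
      unfolding two_chains_def by auto
    have "Q \<in> {K\<in>insert Q ?N. v \<in> K}" using v by simp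
    then have t: "t = Q" using S(1,3) by blast
    have eq: "{K\<in>?N. v \<in> K} = A \<union> B"
    proof -
      have "{K\<in>?N. v \<in> K} = {K\<in>insert Q ?N. v \<in> K} - {Q}" using QN by auto
      then show ?thesis using S(1,3) t by auto
    qed
    have child: "\<exists>a\<in>D. p a = Q" if D: "D \<noteq> {}" "parent_chain p Q D" "D \<subseteq> ?N" for D
    proof -
      obtain a where a: "a \<in> D" "\<And>b. b \<in> D \<Longrightarrow> d a \<le> d b"
        using D(1) ex_has_least_nat[of "\<lambda>x. x \<in> D" _ d] by blast
      have "p a \<notin> D" using a d D(3) by fastforce
      then show ?thesis using a D(2) by (auto simp: parent_chain_def)
    qed
    have "A = {} \<or> B = {}"
    proof (rule ccontr)
      assume "\<not> ?thesis"
      moreover have AB: "A \<subseteq> ?N" "B \<subseteq> ?N" using eq by auto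
      ultimately obtain a b where ab: "a \<in> A" "p a = Q" "b \<in> B" "p b = Q"
        using child[of A] child[of B] S(4,5) unfolding t by auto
      then have "a \<in> ?N" "b \<in> ?N" using AB by auto
      then have "a = b" using path_tree_component_child[OF assms] ab(2,4) by blast
      then show False using ab S(2) by blast
    qed
    then show ?thesis using S(4,5) unfolding eq t by (elim disjE) simp_all
  qed
  moreover have "two_chains p Q {K\<in>?N. v \<in> K}" if "v \<in> \<Union>?N - Q" for v
  proof -
    have "two_chains p Q {K\<in>insert Q ?N. v \<in> K}" using T that unfolding path_tree_def by blast
    moreover have "{K\<in>insert Q ?N. v \<in> K} = {K\<in>?N. v \<in> K}" using that by auto
    ultimately show ?thesis by simp
  qed
  ultimately show ?thesis using T unfolding one_sided_def path_tree_def by blast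
qed

text \<open>Induction on the number of components. The one hung last is minimal for subordination;
  by comparability its foot is contained in, or disjoint from, every clique placed before, as
  merging requires.\<close>

lemma one_sided_color_class:
  assumes fin: "finite V" and Q: "mclique V Q"
    and trees: "\<And>C. component V Q C \<Longrightarrow> \<exists>p. path_tree (nodes V C) Q p"
    and cls: "finite \<C>" "\<And>C. C \<in> \<C> \<Longrightarrow> component V Q C"
    and comparable: "\<And>C C'. C \<in> \<C> \<Longrightarrow> C' \<in> \<C> \<Longrightarrow> C \<noteq> C' \<Longrightarrow> foot Q C \<inter> foot Q C' \<noteq> {} \<Longrightarrow>
      subordinate V Q C C' \<or> subordinate V Q C' C"
  shows "\<exists>p. one_sided (\<Union>C\<in>\<C>. nodes V C) Q p"
  using cls comparable
proof (induction "card \<C>" arbitrary: \<C>)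
  case 0
  then show ?case by simp
next
  case (Suc n)
  note foot = foot_iff[OF fin mcliqueD(1)[OF Q]]
  have foot_sub: "foot Q C \<subseteq> foot Q C'"
    if sub: "subordinate V Q C C'" "C' \<in> \<C>" for C C'
  proof -
    obtain v where v: "v \<in> foot Q C" "v \<in> foot Q C'" using sub(1) by (auto simp: subordinate_def)
    then obtain K where K: "K \<in> nodes V C'" "v \<in> K"
      using foot[OF Suc.prems(2)[OF sub(2)], of v] by blast
    then have "foot Q C \<subseteq> K" using sub(1) v unfolding subordinate_def by blast
    moreover have "foot Q C \<subseteq> Q" by (auto simp: foot_def)
    ultimately show ?thesis
      using foot[OF Suc.prems(2)[OF sub(2)]] K(1) by blast
  qed
  have trans: "subordinate V Q C C''"
    if sub: "subordinate V Q C C'" "subordinate V Q C' C''" "C' \<in> \<C>" "C'' \<in> \<C>" for C C' C''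
  proof -
    have "foot Q C \<subseteq> foot Q C'" "foot Q C' \<subseteq> foot Q C''"
      using foot_sub[OF sub(1,3)] foot_sub[OF sub(2,4)] .
    moreover have "foot Q C \<noteq> {}" using sub(1) by (auto simp: subordinate_def)
    moreover have "foot Q C' \<subseteq> K \<or> foot Q C' \<inter> K = {}" if "K \<in> nodes V C''" for K
      using sub(2) that by (simp add: subordinate_def)
    ultimately show ?thesis unfolding subordinate_def by blast
  qed
  \<comment> \<open>Distinct components may be subordinate to each other, so a minimal element is
    sought for the strict part of the relation.\<close>
  let ?R = "\<lambda>C' C. subordinate V Q C C' \<and> \<not> subordinate V Q C' C"
  have "\<exists>m\<in>\<C>. \<forall>x\<in>\<C>. x \<noteq> m \<longrightarrow> \<not> ?R m x"
    (is "\<exists>m\<in>\<C>. \<forall>x\<in>\<C>. x \<noteq> m \<longrightarrow> \<not> ?S x m")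
  proof (rule Finite_Set.bex_min_element)
    show "finite \<C>" by fact
    show "asymp_on \<C> ?S" by (auto simp: asymp_on_def)
    show "transp_on \<C> ?S"
    proof (rule transp_onI)
      fix x y z assume "x \<in> \<C>" "y \<in> \<C>" "z \<in> \<C>" "?S x y" "?S y z"
      then show "?S x z" using trans[of x y z] trans[of z x y] by blast
    qed
    show "\<C> \<noteq> {}" using Suc by auto
  qed
  then obtain C0 where C0: "C0 \<in> \<C>"
    "\<And>C. C \<in> \<C> \<Longrightarrow> C \<noteq> C0 \<Longrightarrow> subordinate V Q C C0 \<Longrightarrow> subordinate V Q C0 C" by blast
  let ?M1 = "\<Union>C\<in>\<C> - {C0}. nodes V C" and ?M2 = "nodes V C0"
  note comp0 = Suc.prems(2)[OF C0(1)]
  have "\<exists>p. one_sided ?M1 Q p"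
  proof (rule Suc.hyps(1))
    show "n = card (\<C> - {C0})" using Suc C0 by simp
  qed (use Suc.prems in auto)
  then obtain p1 where p1: "one_sided ?M1 Q p1" by blast
  obtain p2 where p2: "path_tree ?M2 Q p2" using trees[OF comp0] by blast
  have "\<exists>p. one_sided (?M1 \<union> ?M2) Q p"
  proof (rule one_sided_merge[OF p1 one_sided_component[OF fin comp0 p2]])
    show "?M1 \<inter> ?M2 = {}" "\<Union>?M1 \<inter> \<Union>?M2 \<subseteq> Q"
      using nodes_disjoint[OF Suc.prems(2) comp0] by blast+
    show "K = K'" if "K \<in> ?M2" "K' \<in> ?M2" "p2 K = Q" "p2 K' = Q" for K K'
      using path_tree_component_child[OF fin comp0 p2] that by blast
    fix v w K assume vw: "v \<in> Q" "w \<in> Q" "v \<in> \<Union>?M2" "w \<in> \<Union>?M2" and K: "K \<in> ?M1" "v \<in> K"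
    then obtain C where C: "C \<in> \<C>" "C \<noteq> C0" "K \<in> nodes V C" by blast
    have f: "v \<in> foot Q C0" "w \<in> foot Q C0" "v \<in> foot Q C"
      using foot[OF comp0] foot[OF Suc.prems(2)[OF C(1)]] vw K C(3) by blast+
    then have "subordinate V Q C C0 \<or> subordinate V Q C0 C"
      using Suc.prems(3)[OF C(1) C0(1) C(2)] by blast
    then have "subordinate V Q C0 C" using C0(2) C by blast
    then show "w \<in> K" using f C(3) K(2) unfolding subordinate_def by blast
  qed
  moreover have "?M1 \<union> ?M2 = (\<Union>C\<in>\<C>. nodes V C)" using C0(1) by auto
  ultimately show ?case by simp
qed

lemma path_tree_glue:
  assumes fin: "finite V" and Q: "mclique V Q" and col: "colorable V Q"
    and trees: "\<And>C. component V Q C \<Longrightarrow> \<exists>p. path_tree (nodes V C) Q p"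
  shows "\<exists>p. path_tree ({K. mclique V K} - {Q}) Q p"
proof -
  obtain g where g: "coloring V Q g" using col by (auto simp: colorable_def)
  note g1 = coloring_comparable[OF g] and g2 = coloring_two[OF g]
  let ?cls = "\<lambda>k. {C. component V Q C \<and> g C = k}"
  let ?M = "\<lambda>k. \<Union>C\<in>?cls k. nodes V C"
  let ?I = "g ` {C. component V Q C}"
  have finc: "finite (?cls k)" for k
    by (rule finite_subset[OF _ finite_components[OF fin, of Q]]) auto
  have "\<exists>p. one_sided (?M k) Q p" for k
    by (rule one_sided_color_class[OF fin Q trees finc]) (use g1 in auto)
  then obtain p where p: "\<And>k. one_sided (?M k) Q (p k)" by metis
  have disj: "?M i \<inter> ?M j = {}" "\<Union>(?M i) \<inter> \<Union>(?M j) \<subseteq> Q" if "i \<noteq> j" for i j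
  proof -
    have *: "nodes V C \<inter> nodes V C' = {}" "\<Union>(nodes V C) \<inter> \<Union>(nodes V C') \<subseteq> Q"
      if "C \<in> ?cls i" "C' \<in> ?cls j" for C C'
      using nodes_disjoint[of V Q C C'] that \<open>i \<noteq> j\<close> by auto
    show "?M i \<inter> ?M j = {}" using *(1) by blast
    show "\<Union>(?M i) \<inter> \<Union>(?M j) \<subseteq> Q" using *(2) by blast
  qed
  have "\<exists>p'. path_tree (\<Union>k\<in>?I. ?M k) Q p'"
  proof (rule one_sided_join[OF _ p])
    show "finite ?I" using finite_components[OF fin] by simp
    fix v assume v: "v \<in> Q"
    have occ: "\<exists>C. component V Q C \<and> g C = k \<and> v \<in> foot Q C" if "v \<in> \<Union>(?M k)" for k
      using that foot_iff[OF fin mcliqueD(1)[OF Q], of _ v] v by blast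
    have "\<exists>i j. \<forall>k. v \<in> \<Union>(?M k) \<longrightarrow> k = i \<or> k = j"
    proof (rule at_most_two)
      show "a = b \<or> a = c \<or> b = c"
        if "v \<in> \<Union>(?M a)" "v \<in> \<Union>(?M b)" "v \<in> \<Union>(?M c)" for a b c
        using occ[OF that(1)] occ[OF that(2)] occ[OF that(3)] g2 by metis
    qed
    then show "\<exists>i j. \<forall>k\<in>?I. v \<in> \<Union>(?M k) \<longrightarrow> k = i \<or> k = j"
      by (elim exE) (intro exI ballI, erule spec)
  qed (use disj in blast)+
  moreover have "(\<Union>k\<in>?I. ?M k) = {K. mclique V K} - {Q}"
  proof
    show "(\<Union>k\<in>?I. ?M k) \<subseteq> {K. mclique V K} - {Q}"
      using base_notin_nodes by (auto simp: nodes_def component_def)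
    show "{K. mclique V K} - {Q} \<subseteq> (\<Union>k\<in>?I. ?M k)"
      using mclique_cases[OF Q] by blast
  qed
  ultimately show ?thesis by simp
qed

text \<open>The components of \<open>C \<union> Q\<close> minus \<open>K\<close> embed by
  \<open>h\<close> into those of \<open>V\<close> minus \<open>K\<close>. Only the one containing
  \<open>q0\<close> can grow, and the vertices it gains see \<open>K\<close> only inside
  \<open>Q\<close>, whose vertices are adjacent to \<open>q0\<close> anyway. So feet do not change
  and the coloring can be pulled back.\<close>

lemma colorable_component:
  assumes fin: "finite V" and Q: "mclique V Q" and C: "component V Q C"
    and col: "\<And>K. mclique V K \<Longrightarrow> colorable V K" and K: "mclique (C \<union> Q) K"
  shows "colorable (C \<union> Q) K"
proof (cases "K = Q")
  case True
  have "C' = C" if "component (C \<union> Q) Q C'" for C'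
  proof (rule component_connected[OF C])
    show "C' \<subseteq> C" "C' \<noteq> {}" using componentD[OF that] by auto
    show "y \<in> C'" if "x \<in> C'" "y \<in> C" "adj x y" for x y
      using componentD(4)[OF \<open>component (C \<union> Q) Q C'\<close> that(1) _ _ that(3)] that(2)
        componentD(3)[OF C] by blast
  qed
  then have "coloring (C \<union> Q) Q (\<lambda>_. 0)" by (intro coloringI) blast+
  then show ?thesis unfolding colorable_def True by blast
next
  case False
  let ?V' = "C \<union> Q"
  have V': "?V' \<subseteq> V" using componentD(2)[OF C] mcliqueD(1)[OF Q] by blast
  have KN: "K \<in> nodes V C" using mclique_component[OF Q C] K False by blast
  then have KV: "mclique V K" by (simp add: nodes_def)
  obtain q0 where q0: "q0 \<in> Q" "q0 \<notin> K" using mclique_subset_eq[OF Q KV] False by blast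
  have sub_mclique: "mclique V L" if "mclique ?V' L" for L
    using that mclique_component[OF Q C] Q by (auto simp: nodes_def)
  define h where "h C' = (SOME D. component V K D \<and> C' \<subseteq> D)" for C'
  have h: "component V K (h C')" "C' \<subseteq> h C'" if C': "component ?V' K C'" for C'
  proof -
    obtain x where x: "x \<in> C'" using componentD(1)[OF C'] by blast
    then have "x \<in> V - K" using componentD(2,3)[OF C'] V' by blast
    then obtain D where D: "component V K D" "x \<in> D" using component_exists by blast
    have "C' \<inter> D = C'"
    proof (rule component_connected[OF C'])
      show "z \<in> C' \<inter> D" if "y \<in> C' \<inter> D" "z \<in> C'" "adj y z" for y z
        using that componentD(4)[OF D(1), of y z] componentD(2,3)[OF C'] V' by blast
    qed (use x D in auto)
    then have "\<exists>D. component V K D \<and> C' \<subseteq> D" using D by blast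
    then show "component V K (h C')" "C' \<subseteq> h C'" unfolding h_def by (metis (mono_tags, lifting) someI_ex)+
  qed
  \<comment> \<open>A vertex of \<open>V\<close> outside \<open>?V'\<close> sees \<open>?V'\<close> only in \<open>Q\<close>, and \<open>Q - K\<close> lies in one component.\<close>
  have outside: "x \<in> Q" if "x \<in> ?V'" "y \<in> V" "y \<notin> ?V'" "adj x y" for x y
    using that componentD(4)[OF C, of x y] by blast
  have local: "h C' = C'" if C': "component ?V' K C'" and q: "q0 \<notin> C'" for C'
  proof (rule sym, rule component_connected[OF h(1)[OF C'] h(2)[OF C'] componentD(1)[OF C']])
    fix x y assume x: "x \<in> C'" and y: "y \<in> h C'" "adj x y"
    have xK: "x \<notin> K" "x \<in> ?V'" using x componentD(2,3)[OF C'] by auto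
    have "x \<notin> Q"
    proof
      assume "x \<in> Q"
      then have "adj x q0" using mcliqueD(2)[OF Q, of x q0] q0 x q by blast
      then show False using componentD(4)[OF C' x, of q0] q0 q by blast
    qed
    moreover have "y \<in> V" "y \<notin> K" using y componentD(2,3)[OF h(1)[OF C']] by auto
    ultimately have "y \<in> ?V'" using outside[OF xK(2) _ _ y(2)] by blast
    then show "y \<in> C'" using componentD(4)[OF C' x _ _ y(2)] \<open>y \<notin> K\<close> by blast
  qed
  have inj: "C1 = C2" if c: "component ?V' K C1" "component ?V' K C2" "h C1 = h C2" for C1 C2
  proof (cases "q0 \<in> C1 \<and> q0 \<in> C2")
    case True
    then show ?thesis using component_unique c by blast
  next
    case False
    have *: "C1 = C2" if "component ?V' K C1" "component ?V' K C2" "h C1 = h C2" "q0 \<notin> C1" for C1 C2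
    proof -
      have "C2 \<subseteq> C1" using local[OF that(1,4)] h(2)[OF that(2)] that(3) by simp
      then show ?thesis using component_unique[OF that(1,2)] componentD(1)[OF that(2)] by blast
    qed
    show ?thesis using False *[of C1 C2] *[of C2 C1] c by metis
  qed
  have foot: "foot K (h C') = foot K C'" if C': "component ?V' K C'" for C'
  proof
    show "foot K C' \<subseteq> foot K (h C')" using h(2)[OF C'] by (auto simp: foot_def)
    show "foot K (h C') \<subseteq> foot K C'"
    proof
      fix v assume "v \<in> foot K (h C')"
      then obtain y where y: "v \<in> K" "y \<in> h C'" "adj v y" by (auto simp: foot_def)
      have yV: "y \<in> V" "y \<notin> K" using y componentD(2,3)[OF h(1)[OF C']] by auto
      show "v \<in> foot K C'"
      proof (cases "y \<in> ?V'")
        case True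
        then have "y \<in> ?V' - K" using yV by blast
        then obtain D where D: "component ?V' K D" "y \<in> D" using component_exists by blast
        then have "h D = h C'"
          using h[OF D(1)] component_unique[OF h(1)[OF D(1)] h(1)[OF C'], of y] y(2) by blast
        then have "D = C'" using inj D(1) C' by blast
        then show ?thesis using y D by (auto simp: foot_def)
      next
        case False
        have "q0 \<in> C'"
        proof (rule ccontr)
          assume "q0 \<notin> C'"
          then have "h C' = C'" using local[OF C'] by blast
          then show False using y(2) False componentD(2)[OF C'] by blast
        qed
        have "v \<in> ?V'" using y(1) mcliqueD(1)[OF K] by blast
        then have "v \<in> Q" using outside[OF _ yV(1) False y(3)] by blast
        then have "adj v q0" using mcliqueD(2)[OF Q, of v q0] q0 y(1) by blast
        then show ?thesis using \<open>q0 \<in> C'\<close> y(1) by (auto simp: foot_def)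
      qed
    qed
  qed
  have sub: "subordinate ?V' K C1 C2"
    if c: "component ?V' K C1" "component ?V' K C2" "subordinate V K (h C1) (h C2)" for C1 C2
  proof -
    have "nodes ?V' C2 \<subseteq> nodes V (h C2)"
      using sub_mclique h(2)[OF c(2)] unfolding nodes_def by blast
    then show ?thesis using c(3) foot[OF c(1)] foot[OF c(2)] unfolding subordinate_def by auto
  qed
  obtain g where g: "coloring V K g" using col[OF KV] by (auto simp: colorable_def)
  note g1 = coloring_comparable[OF g] and g2 = coloring_two[OF g]
  have "coloring ?V' K (\<lambda>C. g (h C))"
  proof (rule coloringI)
    fix C1 C2 assume c: "component ?V' K C1" "component ?V' K C2" "C1 \<noteq> C2" "g (h C1) = g (h C2)"
      "foot K C1 \<inter> foot K C2 \<noteq> {}"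
    then have "subordinate V K (h C1) (h C2) \<or> subordinate V K (h C2) (h C1)"
      using g1[OF h(1) h(1), of C1 C2] inj[of C1 C2] foot by auto
    then show "subordinate ?V' K C1 C2 \<or> subordinate ?V' K C2 C1" using sub c by blast
  next
    fix v C1 C2 C3 assume "component ?V' K C1" "component ?V' K C2" "component ?V' K C3"
      "v \<in> foot K C1" "v \<in> foot K C2" "v \<in> foot K C3"
    then show "g (h C1) = g (h C2) \<or> g (h C1) = g (h C3) \<or> g (h C2) = g (h C3)"
      using g2[of "h C1" "h C2" "h C3" v] h(1) foot by auto
  qed
  then show ?thesis by (auto simp: colorable_def)
qed

end

section \<open>Clique trees of chordal graphs\<close>

context ugraph
begin

section \<open>Induced cycles and dominating vertices\<close>

definition hole_free :: "'a set \<Rightarrow> bool" where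
  "hole_free V \<longleftrightarrow> \<not> (\<exists>xs. 4 \<le> length xs \<and> distinct xs \<and> set xs \<subseteq> V \<and>
     (\<forall>i<length xs. \<forall>j<length xs.
        adj (xs ! i) (xs ! j) \<longleftrightarrow> j = Suc i mod length xs \<or> i = Suc j mod length xs))"

lemma hole_free_subset: "hole_free V \<Longrightarrow> U \<subseteq> V \<Longrightarrow> hole_free U"
  unfolding hole_free_def by (meson subset_trans)

text \<open>The vertices \<open>w, r 0, ..., r m, v\<close> form an induced cycle of length
  \<open>m + 3\<close>, which is at least four as \<open>1 \<le> m\<close>.\<close>

lemma hole_freeD:
  assumes "hole_free V" and "1 \<le> m" and V: "w \<in> V" "v \<in> V" "\<And>k. k \<le> m \<Longrightarrow> r k \<in> V"
    and wv: "adj w v" "w \<noteq> v" "\<And>k. k \<le> m \<Longrightarrow> w \<noteq> r k" "\<And>k. k \<le> m \<Longrightarrow> v \<noteq> r k"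
    and w: "\<And>k. k \<le> m \<Longrightarrow> adj w (r k) \<longleftrightarrow> k = 0"
    and v: "\<And>k. k \<le> m \<Longrightarrow> adj (r k) v \<longleftrightarrow> k = m"
    and r: "\<And>j k. j < k \<Longrightarrow> k \<le> m \<Longrightarrow> adj (r j) (r k) \<longleftrightarrow> k = Suc j"
      "\<And>j k. j < k \<Longrightarrow> k \<le> m \<Longrightarrow> r j \<noteq> r k"
  shows False
proof -
  define e where "e i = (if i = 0 then w else if i \<le> m + 1 then r (i - 1) else v)" for i
  define L where "L = m + 3"
  have lt: "e i \<noteq> e j \<and> (adj (e i) (e j) \<longleftrightarrow> j = Suc i \<or> i = 0 \<and> j = m + 2)"
    if "i < j" "j < L" for i j
  proof -
    have "j \<le> m + 1 \<or> j = m + 2" using that by (auto simp: L_def)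
    then consider "i = 0" "j \<le> m + 1" | "i = 0" "j = m + 2" | "0 < i" "j \<le> m + 1" | "0 < i" "j = m + 2"
      by blast
    then show ?thesis
    proof cases
      case 1
      then show ?thesis using that w[of "j - 1"] wv(3)[of "j - 1"] by (auto simp: e_def)
    next
      case 2
      then show ?thesis using wv by (auto simp: e_def)
    next
      case 3
      then show ?thesis using that r[of "i - 1" "j - 1"] by (auto simp: e_def)
    next
      case 4
      then have "i - 1 \<le> m" using that by arith
      then show ?thesis using 4 that v[of "i - 1"] wv(4)[of "i - 1"] by (auto simp: e_def)
    qed
  qed
  have suc_mod: "Suc i mod L = (if i = m + 2 then 0 else Suc i)" if "i < L" for i
  proof (cases "i = m + 2")
    case True
    then have "Suc i = L" by (simp add: L_def)
    then show ?thesis using True by simp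
  next
    case False
    then have "Suc i < L" using that by (simp add: L_def)
    then show ?thesis using False by simp
  qed
  have adj: "adj (e i) (e j) \<longleftrightarrow> j = Suc i mod L \<or> i = Suc j mod L" if "i < L" "j < L" for i j
  proof (cases i j rule: linorder_cases)
    case less
    then show ?thesis using lt[OF less that(2)] suc_mod[OF that(1)] suc_mod[OF that(2)] that by (auto simp: L_def)
  next
    case equal
    then show ?thesis using adj_irrefl suc_mod[OF that(1)] that by (auto simp: L_def)
  next
    case greater
    then show ?thesis using lt[OF greater that(1)] suc_mod[OF that(1)] suc_mod[OF that(2)] that adj_sym
      by (auto simp: L_def)
  qed
  let ?xs = "map e [0..<L]"
  have "distinct ?xs"
    using lt by (auto simp: distinct_map inj_on_def) (metis nat_neq_iff)
  moreover have "set ?xs \<subseteq> V" using V by (auto simp: e_def)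
  moreover have "4 \<le> length ?xs" using \<open>1 \<le> m\<close> by (simp add: L_def)
  moreover have "\<forall>i<length ?xs. \<forall>j<length ?xs.
      adj (?xs ! i) (?xs ! j) \<longleftrightarrow> j = Suc i mod length ?xs \<or> i = Suc j mod length ?xs"
    using adj by simp
  ultimately show False
    using assms(1) unfolding hole_free_def by (elim notE) (intro exI[of _ ?xs] conjI)
qed

text \<open>A vertex \<open>c\<close> of \<open>C\<close> with most neighbors in \<open>Q\<close>
  works. If it missed \<open>v\<close>, take a shortest path in \<open>C\<close> from
  \<open>c\<close> to a neighbor \<open>q n\<close> of \<open>v\<close>. By the choice of
  \<open>c\<close>, some \<open>w\<close> in \<open>Q\<close> sees \<open>c\<close> but not
  \<open>q n\<close>. The part of the path from the last neighbor of \<open>w\<close> on, together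
  with \<open>v\<close> and \<open>w\<close>, is a hole.\<close>

lemma dominating_vertex:
  assumes fin: "finite V" and hf: "hole_free V" and Q: "mclique V Q" and C: "component V Q C"
  shows "\<exists>c\<in>C. \<forall>v\<in>foot Q C. adj v c"
proof -
  have finC: "finite C" "C \<noteq> {}" using fin componentD(1,2)[OF C] finite_subset by auto
  have finQ: "finite Q" using fin mcliqueD(1)[OF Q] finite_subset by auto
  define h where "h c = card (foot Q {c})" for c
  obtain c where c: "c \<in> C" "\<And>d. d \<in> C \<Longrightarrow> h d \<le> h c"
  proof -
    have "Max (h ` C) \<in> h ` C" using finC by simp
    then obtain c where "c \<in> C" "h c = Max (h ` C)" by auto
    then show thesis using that[of c] finC by simp
  qed
  have "adj v c" if v: "v \<in> foot Q C" for v
  proof (rule ccontr)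
    assume nvc: "\<not> adj v c"
    have vQ: "v \<in> Q" using v by (simp add: foot_def)
    \<comment> \<open>\<open>lev n\<close> collects the ends of walks of length \<open>n\<close> in
      \<open>C\<close> that start at neighbors of \<open>v\<close>. Levels may overlap;
      \<open>dst\<close> is the distance.\<close>
    define lev where "lev n = ((\<lambda>S. {x\<in>C. \<exists>y\<in>S. adj x y}) ^^ n) {x\<in>C. adj v x}" for n
    have lev0: "lev 0 = {x\<in>C. adj v x}" and levS: "\<And>n. lev (Suc n) = {x\<in>C. \<exists>y\<in>lev n. adj x y}"
      by (simp_all add: lev_def)
    have levC: "lev n \<subseteq> C" for n by (cases n) (auto simp: lev0 levS)
    have "(\<Union>n. lev n) = C"
    proof (rule component_connected[OF C])
      show "(\<Union>n. lev n) \<subseteq> C" using levC by blast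
      have "lev 0 \<noteq> {}" using v by (auto simp: lev0 foot_def)
      then show "(\<Union>n. lev n) \<noteq> {}" by blast
      fix x y assume "x \<in> (\<Union>n. lev n)" "y \<in> C" "adj x y"
      then obtain n where "y \<in> lev (Suc n)" using adj_sym by (auto simp: levS)
      then show "y \<in> (\<Union>n. lev n)" by blast
    qed
    then have ex: "\<exists>n. x \<in> lev n" if "x \<in> C" for x using that by blast
    define dst where "dst x = (LEAST n. x \<in> lev n)" for x
    have dst: "x \<in> lev (dst x)" if "x \<in> C" for x
      using ex[OF that] unfolding dst_def by (rule LeastI_ex)
    have dst_le: "dst x \<le> n" if "x \<in> lev n" for x n
      using that unfolding dst_def by (rule Least_le)
    have dst0: "adj v x \<longleftrightarrow> dst x = 0" if "x \<in> C" for x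
      using dst[OF that] dst_le[of x 0] that by (auto simp: lev0)
    have dst_adj: "dst x \<le> Suc (dst y)" if "x \<in> C" "y \<in> C" "adj x y" for x y
      using dst[OF that(2)] that by (intro dst_le) (auto simp: levS)
    have descend: "\<exists>y\<in>C. adj x y \<and> dst y = n" if x: "x \<in> C" "dst x = Suc n" for x n
    proof -
      obtain y where y: "y \<in> lev n" "adj x y" using dst[OF x(1)] x(2) by (auto simp: levS)
      then have "y \<in> C" using levC by blast
      then show ?thesis using y dst_le[OF y(1)] dst_adj[OF x(1) _ y(2)] x(2) by force
    qed
    have path: "\<exists>q. q 0 = x \<and> (\<forall>i\<le>n. q i \<in> C \<and> dst (q i) = n - i) \<and> (\<forall>i<n. adj (q i) (q (Suc i)))"
      if "x \<in> C" "dst x = n" for x n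
      using that
    proof (induction n arbitrary: x)
      case 0
      then show ?case by (intro exI[of _ "\<lambda>_. x"]) auto
    next
      case (Suc n)
      obtain y where y: "y \<in> C" "adj x y" "dst y = n" using descend Suc.prems by blast
      obtain q where q: "q 0 = y" "\<forall>i\<le>n. q i \<in> C \<and> dst (q i) = n - i"
        "\<forall>i<n. adj (q i) (q (Suc i))"
        using Suc.IH[OF y(1,3)] by blast
      show ?case
        by (rule exI[of _ "\<lambda>i. case i of 0 \<Rightarrow> x | Suc j \<Rightarrow> q j"])
          (use q y Suc.prems in \<open>auto split: nat.split\<close>)
    qed
    define n where "n = dst c"
    obtain q where q: "q 0 = c" "\<And>i. i \<le> n \<Longrightarrow> q i \<in> C" "\<And>i. i \<le> n \<Longrightarrow> dst (q i) = n - i"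
        "\<And>i. i < n \<Longrightarrow> adj (q i) (q (Suc i))"
      using path[OF c(1)] n_def by blast
    have vqn: "adj v (q n)" using dst0[OF q(2)] q(3)[of n] by simp
    \<comment> \<open>Otherwise \<open>q n\<close> would have more neighbors in \<open>Q\<close>
      than \<open>c\<close>, the additional one being \<open>v\<close>.\<close>
    have "\<not> foot Q {c} \<subseteq> foot Q {q n}"
    proof
      assume "foot Q {c} \<subseteq> foot Q {q n}"
      then have "insert v (foot Q {c}) \<subseteq> foot Q {q n}" using vqn vQ by (auto simp: foot_def)
      moreover have "finite (foot Q {q n})" "finite (foot Q {c})"
        using finQ by (auto simp: foot_def)
      moreover have "v \<notin> foot Q {c}" using nvc by (simp add: foot_def)
      ultimately have "Suc (h c) \<le> h (q n)"
        using card_mono[of "foot Q {q n}" "insert v (foot Q {c})"] by (simp add: h_def)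
      then show False using c(2)[OF q(2)[of n]] by simp
    qed
    then obtain w where w: "w \<in> Q" "adj w c" "\<not> adj w (q n)" by (auto simp: foot_def)
    \<comment> \<open>The last contact of \<open>w\<close> with the path. It lies before
      \<open>n\<close>, so the rest of the path has an edge and the cycle at least four
      vertices.\<close>
    define i0 where "i0 = Max {i. i \<le> n \<and> adj w (q i)}"
    have fin_i: "finite {i. i \<le> n \<and> adj w (q i)}" by (rule finite_subset[of _ "{..n}"]) auto
    have "0 \<in> {i. i \<le> n \<and> adj w (q i)}" using w q by simp
    then have "i0 \<in> {i. i \<le> n \<and> adj w (q i)}" unfolding i0_def using fin_i Max_in by blast
    then have i0: "i0 \<le> n" "adj w (q i0)" by auto
    then have "i0 < n" using w by (cases "i0 = n") auto
    have i0_max: "\<not> adj w (q i)" if "i0 < i" "i \<le> n" for i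
    proof
      assume "adj w (q i)"
      then have "i \<le> i0" unfolding i0_def using that(2) by (intro Max_ge[OF fin_i]) simp
      then show False using that(1) by simp
    qed
    define m where "m = n - i0"
    define r where "r k = q (i0 + k)" for k
    have rC: "r k \<in> C" and rd: "dst (r k) = m - k" if "k \<le> m" for k
      using that q(2,3)[of "i0 + k"] \<open>i0 < n\<close> by (auto simp: r_def m_def)
    have CQ: "C \<subseteq> V" "C \<inter> Q = {}" "Q \<subseteq> V" using componentD[OF C] mcliqueD(1)[OF Q] by auto
    have wv: "w \<noteq> v" using w nvc by blast
    show False
    proof (rule hole_freeD[OF hf, of m w v r])
      show "1 \<le> m" using \<open>i0 < n\<close> by (simp add: m_def)
      show "w \<in> V" "v \<in> V" using w vQ CQ by auto
      show "r k \<in> V" "w \<noteq> r k" "v \<noteq> r k" if "k \<le> m" for k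
        using rC[OF that] w vQ CQ by auto
      show "adj w v" using mcliqueD(2)[OF Q w(1) vQ wv] .
      show "w \<noteq> v" by fact
      show "adj w (r k) \<longleftrightarrow> k = 0" if "k \<le> m" for k
        using i0_max[of "i0 + k"] i0 that \<open>i0 < n\<close> by (cases "k = 0") (auto simp: r_def m_def)
      show "adj (r k) v \<longleftrightarrow> k = m" if "k \<le> m" for k
        using dst0[OF rC[OF that]] rd[OF that] that adj_sym by auto
      show "r j \<noteq> r k" if "j < k" "k \<le> m" for j k
        using rd[of j] rd[of k] that by auto
      show "adj (r j) (r k) \<longleftrightarrow> k = Suc j" if jk: "j < k" "k \<le> m" for j k
      proof
        assume "adj (r j) (r k)"
        then show "k = Suc j" using dst_adj[OF rC rC, of j k] rd[of j] rd[of k] jk by simp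
      next
        assume "k = Suc j"
        then show "adj (r j) (r k)" using q(4)[of "i0 + j"] jk by (simp add: r_def m_def)
      qed
    qed
  qed
  then show ?thesis using c(1) by blast
qed

lemma path_tree_singleton: "path_tree {} q p"
proof -
  have "two_chains p q {K\<in>{q}. v \<in> K}" if "v \<in> q" for v
    unfolding two_chains_def
    by (rule exI[of _ q], rule exI[of _ "{}"], rule exI[of _ "{}"]) (use that in auto)
  then show ?thesis by (simp add: path_tree_def parent_tree_def)
qed

lemma path_tree_edge:
  assumes "r \<noteq> q"
  shows "path_tree {r} q (\<lambda>_. q)"
proof -
  have "parent_tree (\<lambda>_. q) q {r}"
    unfolding parent_tree_def
    using assms by (intro conjI exI[of _ "\<lambda>K. if K = q then 0 else 1"]) auto
  moreover have "two_chains (\<lambda>_. q) q {K\<in>{q, r}. v \<in> K}" if v: "v \<in> q \<or> v \<in> r" for v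
  proof (cases "v \<in> q")
    case True
    then show ?thesis
      unfolding two_chains_def
      by (intro exI[of _ q] exI[of _ "if v \<in> r then {r} else {}"] exI[of _ "{}"])
        (use assms in \<open>auto simp: parent_chain_def\<close>)
  next
    case False
    then show ?thesis
      unfolding two_chains_def using v
      by (intro exI[of _ r] exI[of _ "{}"]) auto
  qed
  ultimately show ?thesis by (auto simp: path_tree_def)
qed

text \<open>
  If no maximal clique separates, then \<open>Q\<close> and a maximal clique \<open>Q'\<close> through the foot of
  \<open>V - Q\<close> and a vertex dominating it cover everything, because \<open>Q - Q'\<close> is a component
  of \<open>V - Q'\<close>.
\<close>

lemma path_tree_no_separator:
  assumes fin: "finite V" and hf: "hole_free V" and Q: "mclique V Q"
    and nosep: "\<And>K C C'. mclique V K \<Longrightarrow> component V K C \<Longrightarrow> component V K C' \<Longrightarrow> C = C'"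
  shows "\<exists>p. path_tree ({K. mclique V K} - {Q}) Q p"
proof (cases "V \<subseteq> Q")
  case True
  then have "{K. mclique V K} - {Q} = {}"
    using mclique_subset_eq[OF _ Q] mcliqueD(1) by blast
  then show ?thesis using path_tree_singleton by (simp only:) blast
next
  case False
  then obtain C where C: "component V Q C" using component_exists by blast
  have VQ: "x \<in> C" if "x \<in> V" "x \<notin> Q" for x
    using component_exists[of x V Q] nosep[OF Q C] that by blast
  obtain c where c: "c \<in> C" "\<And>v. v \<in> foot Q C \<Longrightarrow> adj v c"
    using dominating_vertex[OF fin hf Q C] by blast
  have cV: "c \<in> V" "c \<notin> Q" using c componentD[OF C] by auto
  have "\<exists>L. mclique V L \<and> insert c (foot Q C) \<subseteq> L"
  proof (rule mclique_extend[OF fin])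
    show "insert c (foot Q C) \<subseteq> V" using cV mcliqueD(1)[OF Q] by (auto simp: foot_def)
    show "\<forall>x\<in>insert c (foot Q C). \<forall>y\<in>insert c (foot Q C). x \<noteq> y \<longrightarrow> adj x y"
      using c(2) adj_sym mcliqueD(2)[OF Q] by (auto simp: foot_def)
  qed
  then obtain Q' where Q': "mclique V Q'" "c \<in> Q'" "foot Q C \<subseteq> Q'" by auto
  \<comment> \<open>A vertex of \<open>Q\<close> outside \<open>Q'\<close> is not in the foot, so
    all its neighbors lie in \<open>Q\<close>.\<close>
  have no_edge: "\<not> adj x y" if "x \<in> Q - Q'" "y \<in> V" "y \<notin> Q" for x y
    using that VQ Q'(3) by (auto simp: foot_def)
  have "component V Q' (Q - Q')"
  proof (rule componentI)
    show "Q - Q' \<noteq> {}" using mclique_subset_eq[OF Q Q'(1)] Q'(2) cV by blast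
    show "Q - Q' \<subseteq> V - Q'" using mcliqueD(1)[OF Q] by blast
    show "y \<in> Q - Q'" if "x \<in> Q - Q'" "y \<in> V - Q'" "adj x y" for x y
      using no_edge that by blast
    show "W = Q - Q'" if "W \<subseteq> Q - Q'" "W \<noteq> {}" "\<forall>x\<in>W. \<forall>y\<in>Q - Q'. adj x y \<longrightarrow> y \<in> W" for W
      using that mcliqueD(2)[OF Q] by blast
  qed
  then have VQ': "x \<in> Q" if "x \<in> V" "x \<notin> Q'" for x
    using component_exists[of x V Q'] nosep[OF Q'(1)] that by blast
  have "K = Q \<or> K = Q'" if K: "mclique V K" for K
  proof (cases "K \<subseteq> Q'")
    case True
    then show ?thesis using mclique_subset_eq K Q' by blast
  next
    case False
    then obtain x where x: "x \<in> K" "x \<in> Q - Q'" using VQ' mcliqueD(1)[OF K] by blast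
    have "K \<subseteq> Q"
    proof
      fix y assume y: "y \<in> K"
      show "y \<in> Q"
      proof (rule ccontr)
        assume "y \<notin> Q"
        moreover from this have "adj x y" using mcliqueD(2)[OF K x(1) y] x by blast
        ultimately show False using no_edge[OF x(2), of y] y mcliqueD(1)[OF K] by blast
      qed
    qed
    then show ?thesis using mclique_subset_eq[OF K Q] by blast
  qed
  then have "{K. mclique V K} - {Q} = {Q'}" "Q' \<noteq> Q" using Q' cV by auto
  then show ?thesis using path_tree_edge by metis
qed

text \<open>The separating clique \<open>K\<close> need not be the root \<open>Q\<close> asked for.
  All smaller graphs \<open>C \<union> K\<close> are treated with root \<open>K\<close>, and the
  glued tree is rerooted at \<open>Q\<close>.\<close>

lemma path_tree_exists:
  assumes "finite V" "hole_free V" "\<And>K. mclique V K \<Longrightarrow> colorable V K" "mclique V Q"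
  shows "\<exists>p. path_tree ({K. mclique V K} - {Q}) Q p"
  using assms
proof (induction "card V" arbitrary: V Q rule: less_induct)
  case less
  note fin = less.prems(1)
  show ?case
  proof (cases "\<forall>K C C'. mclique V K \<longrightarrow> component V K C \<longrightarrow> component V K C' \<longrightarrow> C = C'")
    case True
    then show ?thesis using path_tree_no_separator[OF less.prems(1,2,4)] by blast
  next
    case False
    then obtain K C1 C2 where K: "mclique V K"
      and C12: "component V K C1" "component V K C2" "C1 \<noteq> C2" by blast
    have "\<exists>p. path_tree ({L. mclique V L} - {K}) K p"
    proof (rule path_tree_glue[OF fin K less.prems(3)[OF K]])
      fix C assume C: "component V K C"
      let ?V' = "C \<union> K"
      \<comment> \<open>A second component makes \<open>C \<union> K\<close> strictly smaller than
        \<open>V\<close>.\<close>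
      obtain D where D: "component V K D" "D \<noteq> C" using C12 by metis
      obtain x where x: "x \<in> D" using componentD(1)[OF D(1)] by blast
      then have "x \<notin> ?V'" using component_unique[OF D(1) C] D componentD(3)[OF D(1)] by blast
      moreover have "x \<in> V" using x componentD(2)[OF D(1)] by blast
      moreover have sub: "?V' \<subseteq> V" using componentD(2)[OF C] mcliqueD(1)[OF K] by blast
      ultimately have "card ?V' < card V" using fin by (intro psubset_card_mono) auto
      moreover have "finite ?V'" using fin sub finite_subset by blast
      moreover have "hole_free ?V'" using hole_free_subset[OF less.prems(2) sub] .
      moreover have "mclique ?V' K" using mclique_component[OF K C] by blast
      ultimately have "\<exists>p. path_tree ({L. mclique ?V' L} - {K}) K p"
        using less.hyps[of ?V' K] colorable_component[OF fin K C less.prems(3)] by blast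
      moreover have "{L. mclique ?V' L} - {K} = nodes V C"
        using mclique_component[OF K C] base_notin_nodes[OF C] by auto
      ultimately show "\<exists>p. path_tree (nodes V C) K p" by simp
    qed
    then obtain p where p: "path_tree ({L. mclique V L} - {K}) K p" by blast
    have "insert K ({L. mclique V L} - {K}) = {L. mclique V L}" using K by auto
    then show ?thesis using path_tree_reroot[OF p, of Q] less.prems(4) by simp
  qed
qed

end

section \<open>Trees as digraphs\<close>

definition parent_digraph :: "('n \<Rightarrow> 'n) \<Rightarrow> 'n \<Rightarrow> 'n set \<Rightarrow> ('n, 'n \<times> 'n) pre_digraph" where
  "parent_digraph p q M = \<lparr>verts = insert q M, arcs = {(x, p x) |x. x \<in> M} \<union> {(p x, x) |x. x \<in> M},
     tail = fst, head = snd\<rparr>"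

lemma arcs_ends_fst_snd: "tail G = fst \<Longrightarrow> head G = snd \<Longrightarrow> arcs_ends G = arcs G"
  by (simp add: arcs_ends_conv)

lemma arcs_ends_parent_digraph:
  "(x, y) \<in> arcs_ends (parent_digraph p q M) \<longleftrightarrow> x \<in> M \<and> p x = y \<or> y \<in> M \<and> p y = x"
  by (subst arcs_ends_fst_snd) (auto simp: parent_digraph_def)

lemma set_vwalk_arcs_subset:
  "set (vwalk_arcs xs) \<subseteq> R \<longleftrightarrow> successively (\<lambda>x y. (x, y) \<in> R) xs"
  by (induction xs rule: vwalk_arcs.induct) auto

lemma vpath_iff:
  "vpath xs G \<longleftrightarrow> xs \<noteq> [] \<and> distinct xs \<and> set xs \<subseteq> verts G \<and> successively (dominates G) xs"
  by (auto simp: vpath_def vwalk_def set_vwalk_arcs_subset)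

lemma successively_nthD:
  "successively P xs \<Longrightarrow> Suc i < length xs \<Longrightarrow> P (xs ! i) (xs ! Suc i)"
proof (induction xs arbitrary: i)
  case (Cons x xs)
  then show ?case by (cases i) (auto simp: successively_Cons hd_conv_nth)
qed simp

lemma successively_nthI:
  "(\<And>i. Suc i < length xs \<Longrightarrow> P (xs ! i) (xs ! Suc i)) \<Longrightarrow> successively P xs"
proof (induction xs)
  case (Cons x xs)
  have "successively P xs" using Cons.prems[of "Suc _"] by (intro Cons.IH) auto
  then show ?case using Cons.prems[of 0] by (cases xs) auto
qed simp

text \<open>In cyclic form all positions are alike, so an argument at an arbitrary vertex of the
  cycle needs no special case for the ends of the list.\<close>

lemma graph_cycle_iff:
  "graph_cycle G xs \<longleftrightarrow> 3 \<le> length xs \<and> distinct xs \<and> set xs \<subseteq> verts G \<and>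
     (\<forall>i<length xs. xs ! i \<rightarrow>\<^bsub>G\<^esub> xs ! (Suc i mod length xs))"
proof (cases "3 \<le> length xs")
  case len: True
  then have ne: "xs \<noteq> []" by auto
  have hl: "hd xs = xs ! 0" "last xs = xs ! (length xs - 1)"
    using ne by (auto simp: hd_conv_nth last_conv_nth)
  have "successively (dominates G) xs \<and> last xs \<rightarrow>\<^bsub>G\<^esub> hd xs \<longleftrightarrow>
      (\<forall>i<length xs. xs ! i \<rightarrow>\<^bsub>G\<^esub> xs ! (Suc i mod length xs))" (is "?L \<longleftrightarrow> ?R")
  proof
    assume L: ?L
    show ?R
    proof (intro allI impI)
      fix i assume i: "i < length xs"
      show "xs ! i \<rightarrow>\<^bsub>G\<^esub> xs ! (Suc i mod length xs)"
      proof (cases "Suc i = length xs")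
        case True
        then have "i = length xs - 1" by simp
        then show ?thesis using L hl True by simp
      next
        case False
        then show ?thesis using L i successively_nthD[of "dominates G" xs i] by simp
      qed
    qed
  next
    assume R: ?R
    have "xs ! i \<rightarrow>\<^bsub>G\<^esub> xs ! Suc i" if "Suc i < length xs" for i
      using R[rule_format, of i] that by simp
    moreover have "last xs \<rightarrow>\<^bsub>G\<^esub> hd xs"
    proof -
      have "Suc (length xs - 1) = length xs" "length xs - 1 < length xs" using len by auto
      then show ?thesis using R[rule_format, of "length xs - 1"] hl by simp
    qed
    ultimately show ?L by (auto intro: successively_nthI)
  qed
  then show ?thesis using len ne by (auto simp: graph_cycle_def vpath_iff)
qed (simp add: graph_cycle_def)

locale parent_structure =
  fixes p :: "'n \<Rightarrow> 'n" and q :: 'n and M :: "'n set"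
  assumes tree: "parent_tree p q M"
begin

definition depth :: "'n \<Rightarrow> nat" where
  "depth = (SOME d. \<forall>x\<in>M. p x \<in> insert q M \<and> d (p x) < d x)"

lemma depth: "x \<in> M \<Longrightarrow> p x \<in> insert q M" "x \<in> M \<Longrightarrow> depth (p x) < depth x"
proof -
  have "\<exists>d. \<forall>x\<in>M. p x \<in> insert q M \<and> (d::'n \<Rightarrow> nat) (p x) < d x"
    using tree by (simp add: parent_tree_def)
  then have "\<forall>x\<in>M. p x \<in> insert q M \<and> depth (p x) < depth x"
    unfolding depth_def by (rule someI_ex)
  then show "x \<in> M \<Longrightarrow> p x \<in> insert q M" "x \<in> M \<Longrightarrow> depth (p x) < depth x" by auto
qed

lemma root: "q \<notin> M" using tree by (simp add: parent_tree_def)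

lemma parent_ne: "x \<in> M \<Longrightarrow> p x \<noteq> x" "x \<in> M \<Longrightarrow> x \<noteq> p x" using depth(2)[of x] by auto

lemma wf_parent_digraph: "wf_digraph (parent_digraph p q M)"
  by unfold_locales (auto simp: parent_digraph_def dest: depth(1))

lemma symmetric_parent_digraph: "symmetric (parent_digraph p q M)"
  unfolding symmetric_def by (rule symI) (auto simp: arcs_ends_parent_digraph)

lemma reachable_parent_digraph:
  assumes "x \<in> insert q M" "y \<in> insert q M"
  shows "x \<rightarrow>\<^sup>*\<^bsub>parent_digraph p q M\<^esub> y"
proof -
  have V: "verts (parent_digraph p q M) = insert q M" by (simp add: parent_digraph_def)
  have to_root: "x \<rightarrow>\<^sup>*\<^bsub>parent_digraph p q M\<^esub> q" if "x \<in> insert q M" for x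
  proof -
    have "{(y, p y) |y. y \<in> M} \<subseteq> arcs_ends (parent_digraph p q M)"
      by (auto simp: arcs_ends_parent_digraph)
    then have "(x, q) \<in> (arcs_ends (parent_digraph p q M))\<^sup>*"
      using parent_tree_reach[OF tree that] rtrancl_mono by blast
    then show ?thesis using wf_digraph.reachable_conv'[OF wf_parent_digraph] that V by metis
  qed
  then show ?thesis
    using to_root[OF assms(1)] symmetric_reachable[OF symmetric_parent_digraph to_root[OF assms(2)]]
      wf_digraph.reachable_trans[OF wf_parent_digraph] by blast
qed

text \<open>On a cycle, a deepest node can only be next to its parent, so its predecessor and
  successor coincide. This is impossible from length three on.\<close>

lemma graph_tree_parent_digraph:
  assumes fin: "finite M"
  shows "graph_tree (parent_digraph p q M)"
proof -
  let ?T = "parent_digraph p q M"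
  interpret wf_digraph ?T by (rule wf_parent_digraph)
  have "graph ?T"
  proof
    show "finite (verts ?T)" using fin by (simp add: parent_digraph_def)
    have "arcs ?T \<subseteq> insert q M \<times> insert q M"
      using depth(1) by (auto simp: parent_digraph_def)
    then show "finite (arcs ?T)" by (rule finite_subset) (use fin in simp)
    show "tail ?T e \<noteq> head ?T e" if "e \<in> arcs ?T" for e
      using that parent_ne by (auto simp: parent_digraph_def)
    show "e1 = e2" if "arc_to_ends ?T e1 = arc_to_ends ?T e2" for e1 e2
      using that by (auto simp: parent_digraph_def arc_to_ends_def prod_eq_iff)
    show "symmetric ?T" by (rule symmetric_parent_digraph)
  qed
  moreover have "Digraph_Component.connected ?T"
    unfolding connected_def strongly_connected_def
    using reachable_parent_digraph reachable_mk_symmetricI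
    by (auto simp: parent_digraph_def)
  moreover have "\<not> graph_cycle ?T xs" for xs
  proof
    assume c: "graph_cycle ?T xs"
    then have len: "3 \<le> length xs" and dist: "distinct xs" and
      e: "\<And>i. i < length xs \<Longrightarrow> xs ! i \<rightarrow>\<^bsub>?T\<^esub> xs ! (Suc i mod length xs)"
      by (auto simp: graph_cycle_iff)
    have "Max (depth ` set xs) \<in> depth ` set xs" using len by (intro Max_in) auto
    then obtain i where i: "i < length xs" "depth (xs ! i) = Max (depth ` set xs)"
      by (auto simp: in_set_conv_nth)
    have max: "depth (xs ! j) \<le> depth (xs ! i)" if "j < length xs" for j
      unfolding i(2) using that by (intro Max_ge) auto
    have parent: "xs ! j = p (xs ! i)"
      if "j < length xs" "xs ! i \<rightarrow>\<^bsub>?T\<^esub> xs ! j \<or> xs ! j \<rightarrow>\<^bsub>?T\<^esub> xs ! i" for j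
      using that max[OF that(1)] depth(2)[of "xs ! j"] by (auto simp: arcs_ends_parent_digraph)
    define n where "n = length xs"
    define j where "j = Suc i mod n"
    \<comment> \<open>The position before \<open>i\<close>; adding \<open>n - 1\<close> avoids
      truncated subtraction.\<close>
    define k where "k = (i + (n - 1)) mod n"
    have "0 < n" using len by (simp only: n_def)
    then have jk: "j < n" "k < n" by (simp_all add: j_def k_def)
    have k: "Suc k mod n = i"
    proof -
      have "Suc k mod n = Suc (i + (n - 1)) mod n" unfolding k_def by (rule mod_Suc_eq)
      also have "Suc (i + (n - 1)) = i + n" using \<open>0 < n\<close> by simp
      finally have "Suc k mod n = (i + n) mod n" .
      then show ?thesis using i(1) by (simp add: n_def)
    qed
    have "xs ! j = p (xs ! i)" using parent[of j] e[OF i(1)] jk by (simp add: j_def n_def)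
    moreover have "xs ! k = p (xs ! i)" using parent[of k] e[of k] jk k by (simp add: n_def)
    ultimately have "xs ! j = xs ! k" by simp
    then have "j = k" using nth_eq_iff_index_eq[OF dist] jk by (simp add: n_def)
    moreover have "Suc (Suc k) mod n = Suc i mod n" using k by (metis mod_Suc_eq)
    ultimately have "Suc (Suc k) mod n = k" by (simp add: j_def)
    moreover have "3 \<le> n" using len by (simp add: n_def)
    ultimately show False using jk(2)
      by (cases "Suc (Suc k) < n"; cases "Suc (Suc k) = n") (auto simp: mod_if split: if_splits)
  qed
  ultimately show ?thesis by (simp add: graph_tree_def)
qed

end

text \<open>Parents are neighbors nearer to \<open>q\<close>. The parent edges already connect
  everything, so any further edge of \<open>T\<close> would close a cycle with the path between its
  ends.\<close>

lemma graph_tree_parent_tree: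
  assumes T: "graph_tree T" and q: "q \<in> verts T"
  shows "\<exists>p. parent_tree p q (verts T - {q}) \<and>
    (\<forall>x y. x \<rightarrow>\<^bsub>T\<^esub> y \<longleftrightarrow> x \<in> verts T - {q} \<and> p x = y \<or> y \<in> verts T - {q} \<and> p y = x)"
proof -
  interpret T: graph T using T by (simp add: graph_tree_def)
  have symT: "x \<rightarrow>\<^bsub>T\<^esub> y \<Longrightarrow> y \<rightarrow>\<^bsub>T\<^esub> x" for x y
    using arcs_ends_symmetric[OF T.sym_arcs] .
  have reach: "\<exists>n. (x, q) \<in> arcs_ends T ^^ n" if "x \<in> verts T" for x
  proof -
    have "x \<rightarrow>\<^sup>*\<^bsub>mk_symmetric T\<^esub> q"
      using T q that by (auto simp: graph_tree_def connected_def strongly_connected_def)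
    then have "x \<rightarrow>\<^sup>*\<^bsub>T\<^esub> q" using T.reachable_mk_symmetric_eq[OF T.sym_arcs] by blast
    then show ?thesis using reachable_rtranclI rtrancl_power by metis
  qed
  define d where "d x = (LEAST n. (x, q) \<in> arcs_ends T ^^ n)" for x
  have d: "(x, q) \<in> arcs_ends T ^^ d x" if "x \<in> verts T" for x
    using reach[OF that] unfolding d_def by (rule LeastI_ex)
  have "\<exists>y. x \<rightarrow>\<^bsub>T\<^esub> y \<and> d y < d x" if x: "x \<in> verts T" "x \<noteq> q" for x
  proof -
    obtain m where m: "d x = Suc m"
      using d[OF x(1)] x(2) by (cases "d x") auto
    then obtain y where y: "x \<rightarrow>\<^bsub>T\<^esub> y" "(y, q) \<in> arcs_ends T ^^ m"
      using d[OF x(1)] relpow_Suc_D2[of x q m "arcs_ends T"] by auto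
    have "d y \<le> m" unfolding d_def using y(2) by (rule Least_le)
    then show ?thesis using y m by auto
  qed
  then obtain p where p: "\<And>x. x \<in> verts T \<Longrightarrow> x \<noteq> q \<Longrightarrow> x \<rightarrow>\<^bsub>T\<^esub> p x \<and> d (p x) < d x"
    by metis
  let ?M = "verts T - {q}"
  have tree: "parent_tree p q ?M"
    unfolding parent_tree_def
  proof (intro conjI exI[of _ d] ballI)
    show "p x \<in> insert q ?M" if "x \<in> ?M" for x
      using T.adj_in_verts(2)[of x "p x"] p[of x] that by auto
  qed (use p in auto)
  interpret parent_structure p q ?M by unfold_locales (rule tree)
  let ?T' = "parent_digraph p q ?M"
  have sub: "x \<rightarrow>\<^bsub>T\<^esub> y" if "x \<rightarrow>\<^bsub>?T'\<^esub> y" for x y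
    using that p symT by (auto simp: arcs_ends_parent_digraph)
  have V': "verts ?T' = verts T" using q by (auto simp: parent_digraph_def)
  have "x \<rightarrow>\<^bsub>?T'\<^esub> y" if xy: "x \<rightarrow>\<^bsub>T\<^esub> y" for x y
  proof (rule ccontr)
    assume no: "\<not> x \<rightarrow>\<^bsub>?T'\<^esub> y"
    have V: "x \<in> verts T" "y \<in> verts T" "x \<noteq> y"
      using xy T.adj_in_verts T.adj_not_same by auto
    then have "x \<rightarrow>\<^sup>*\<^bsub>?T'\<^esub> y" by (intro reachable_parent_digraph) auto
    then obtain xs where xs: "vpath xs ?T'" "hd xs = x" "last xs = y"
      using wf_digraph.reachable_vpath_conv[OF wf_parent_digraph] by blast
    have "3 \<le> length xs"
    proof (rule ccontr)
      assume "\<not> 3 \<le> length xs"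
      then have "length xs = 0 \<or> length xs = 1 \<or> length xs = 2" by linarith
      then show False
        using xs V(3) no by (auto simp: vpath_iff length_Suc_conv numeral_2_eq_2)
    qed
    moreover have "vpath xs T"
    proof -
      have "successively (dominates ?T') xs" using xs by (simp add: vpath_iff)
      then have "successively (dominates T) xs" by (rule successively_mono) (use sub in blast)
      then show ?thesis using xs V' by (simp add: vpath_iff)
    qed
    ultimately have "graph_cycle T xs" using symT[OF xy] xs by (simp add: graph_cycle_def)
    then show False using T by (auto simp: graph_tree_def)
  qed
  then have "x \<rightarrow>\<^bsub>T\<^esub> y \<longleftrightarrow> x \<rightarrow>\<^bsub>?T'\<^esub> y" for x y using sub by blast
  then have "\<forall>x y. x \<rightarrow>\<^bsub>T\<^esub> y \<longleftrightarrow> x \<in> ?M \<and> p x = y \<or> y \<in> ?M \<and> p y = x"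
    unfolding arcs_ends_parent_digraph by blast
  then show ?thesis using tree by blast
qed

text \<open>A chord of a path closes a cycle.\<close>

lemma graph_tree_path_neighbors:
  assumes T: "graph_tree T" and xs: "vpath xs T"
    and abc: "x \<in> set xs" "a \<in> set xs" "b \<in> set xs" "c \<in> set xs"
    and e: "x \<rightarrow>\<^bsub>T\<^esub> a" "x \<rightarrow>\<^bsub>T\<^esub> b" "x \<rightarrow>\<^bsub>T\<^esub> c"
  shows "a = b \<or> a = c \<or> b = c"
proof -
  interpret T: graph T using T by (simp add: graph_tree_def)
  have symT: "x \<rightarrow>\<^bsub>T\<^esub> y \<Longrightarrow> y \<rightarrow>\<^bsub>T\<^esub> x" for x y
    using arcs_ends_symmetric[OF T.sym_arcs] .
  have chord: "j = Suc i"
    if ij: "i < j" "j < length xs" and "xs ! i \<rightarrow>\<^bsub>T\<^esub> xs ! j" for i j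
  proof (rule ccontr)
    assume "j \<noteq> Suc i"
    define ys where "ys = drop i (take (Suc j) xs)"
    have len: "length ys = Suc j - i" using ij by (simp add: ys_def)
    then have ne: "ys \<noteq> []" using ij by auto
    have nth: "ys ! k = xs ! (i + k)" if "k < length ys" for k
      using that ij by (simp add: ys_def)
    have "successively (dominates T) ys"
    proof (rule successively_nthI)
      fix k assume k: "Suc k < length ys"
      then have "Suc (i + k) < length xs" using len ij by simp
      then show "ys ! k \<rightarrow>\<^bsub>T\<^esub> ys ! Suc k"
        using xs nth[of k] nth[of "Suc k"] k successively_nthD[of "dominates T" xs "i + k"]
        by (simp add: vpath_iff)
    qed
    moreover have "set ys \<subseteq> set xs" unfolding ys_def by (meson set_drop_subset set_take_subset subset_trans)
    moreover have "distinct ys" using xs by (simp add: ys_def vpath_iff)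
    ultimately have "vpath ys T" using xs ne by (auto simp: vpath_iff)
    moreover have "hd ys = xs ! i" "last ys = xs ! j"
      using nth[of 0] nth[of "length ys - 1"] ne len ij by (auto simp: hd_conv_nth last_conv_nth)
    moreover have "3 \<le> length ys" using len ij \<open>j \<noteq> Suc i\<close> by simp
    ultimately have "graph_cycle T ys" using symT[OF that(3)] by (simp add: graph_cycle_def)
    then show False using T by (auto simp: graph_tree_def)
  qed
  obtain i where i: "i < length xs" "xs ! i = x" using abc by (auto simp: in_set_conv_nth)
  \<comment> \<open>Without chords, neighbors of \<open>x\<close> on the path are next to it in the
    list. For \<open>i = 0\<close> the first candidate is \<open>x\<close> itself, which is
    harmless.\<close>
  have nb: "y = xs ! (i - 1) \<or> y = xs ! Suc i" if "y \<in> set xs" "x \<rightarrow>\<^bsub>T\<^esub> y" for y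
  proof -
    obtain j where j: "j < length xs" "xs ! j = y" using \<open>y \<in> set xs\<close> by (auto simp: in_set_conv_nth)
    have "i \<noteq> j" using i j that T.adj_not_same by auto
    then show ?thesis
      using chord[of i j] chord[of j i] i j that symT[OF that(2)] by (cases i j rule: linorder_cases) auto
  qed
  show ?thesis using nb abc e by metis
qed

section \<open>Colorings from path representations\<close>

context parent_structure
begin

abbreviation "anc x y \<equiv> (x, y) \<in> {(z, p z) |z. z \<in> M}\<^sup>*"

text \<open>The connected node sets of a rooted tree, each described by its topmost node.\<close>

definition subtree_at :: "'n \<Rightarrow> 'n set \<Rightarrow> bool" where
  "subtree_at t S \<longleftrightarrow> t \<in> S \<and> (\<forall>x\<in>S - {t}. x \<in> M \<and> p x \<in> S)"

lemma anc_step: "x \<in> M \<Longrightarrow> anc (p x) y \<Longrightarrow> anc x y"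
  by (rule converse_rtrancl_into_rtrancl[of x "p x"]) auto

lemma anc_cases: "anc x y \<Longrightarrow> x = y \<or> x \<in> M \<and> anc (p x) y"
  by (erule converse_rtranclE) auto

lemma anc_depth: "anc x y \<Longrightarrow> x = y \<or> depth y < depth x"
proof (induction rule: converse_rtrancl_induct)
  case (step x z)
  then have "x \<in> M" "z = p x" by auto
  then show ?case using step.IH depth(2)[of x] by auto
qed simp

lemma subtree_anc:
  assumes S: "subtree_at t S" and x: "x \<in> S"
  shows "anc x t"
  using x
proof (induction "depth x" arbitrary: x rule: less_induct)
  case less
  show ?case
  proof (cases "x = t")
    case False
    then have "x \<in> M" "p x \<in> S" using S less.prems by (auto simp: subtree_at_def)
    then show ?thesis using less.hyps depth(2) anc_step by blast
  qed simp
qed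

lemma subtree_between:
  assumes S: "subtree_at t S" and xy: "anc x y" and x: "x \<in> S" and y: "anc y t"
  shows "y \<in> S"
  using xy x y
proof (induction rule: converse_rtrancl_induct)
  case (step x z)
  then have z: "x \<in> M" "z = p x" "anc z y" by auto
  have "x \<noteq> t"
  proof
    assume "x = t"
    then show False
      using anc_depth[OF z(3)] anc_depth[OF step.prems(2)] depth(2)[OF z(1)] z(2) by auto
  qed
  then have "z \<in> S" using S step.prems(1) z(2) by (auto simp: subtree_at_def)
  then show ?case using step by blast
qed simp

lemma subtree_insert:
  assumes S: "subtree_at t S" and y: "y \<in> S"
    and xy: "x \<in> M \<and> p x = y \<or> y \<in> M \<and> p y = x"
  shows "\<exists>t'. subtree_at t' (insert x S)"
proof -
  consider "x \<in> M" "p x = y" | "y = t" "y \<in> M" "p y = x" | "y \<noteq> t" "p y = x" using xy by blast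
  then show ?thesis
  proof cases
    case 1
    then have "subtree_at t (insert x S)" using S y by (auto simp: subtree_at_def)
    then show ?thesis by blast
  next
    case 2
    then have "subtree_at x (insert x S)" using S by (auto simp: subtree_at_def)
    then show ?thesis by blast
  next
    case 3
    then have "insert x S = S" using S y by (auto simp: subtree_at_def)
    then show ?thesis using S by auto
  qed
qed

lemma subtree_vpath:
  assumes "xs \<noteq> []" "successively (\<lambda>x y. x \<in> M \<and> p x = y \<or> y \<in> M \<and> p y = x) xs"
  shows "\<exists>t. subtree_at t (set xs)"
  using assms
proof (induction xs)
  case (Cons x xs)
  show ?case
  proof (cases "xs = []")
    case True
    then show ?thesis by (auto simp: subtree_at_def)
  next
    case False
    then obtain t where "subtree_at t (set xs)" using Cons by (auto simp: successively_Cons)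
    then show ?thesis
      using subtree_insert[of t "set xs" "hd xs" x] Cons.prems False
      by (auto simp: successively_Cons)
  qed
qed simp

text \<open>Climbing from a common node stays in both sets until the first of the two tops is
  reached.\<close>

lemma subtree_meet:
  assumes S: "subtree_at t S" "subtree_at t' S'" and x: "x \<in> S" "x \<in> S'"
  shows "t \<in> S' \<or> t' \<in> S"
  using x
proof (induction "depth x" arbitrary: x rule: less_induct)
  case less
  show ?case
  proof (cases "x = t \<or> x = t'")
    case False
    then have "x \<in> M" "p x \<in> S" "p x \<in> S'" using S less.prems by (auto simp: subtree_at_def)
    then show ?thesis using less.hyps depth(2) by blast
  qed (use less.prems in auto)
qed

lemma subtree_Un:
  assumes "subtree_at t S" "subtree_at t' S'" "S \<inter> S' \<noteq> {}"
  shows "\<exists>t. subtree_at t (S \<union> S')"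
proof -
  have "t \<in> S' \<or> t' \<in> S" using subtree_meet assms by blast
  then have "subtree_at t' (S \<union> S') \<or> subtree_at t (S \<union> S')"
    using assms by (auto simp: subtree_at_def)
  then show ?thesis by blast
qed

text \<open>The deepest of the tops lies in all sets: if \<open>t i\<close> missed
  \<open>S j\<close>, then \<open>t j\<close> would lie in \<open>S i\<close>, hence below
  \<open>t i\<close> yet no deeper, and so be equal to it.\<close>

lemma subtree_Helly:
  assumes fin: "finite F" "F \<noteq> {}" and S: "\<And>i. i \<in> F \<Longrightarrow> subtree_at (t i) (S i)"
    and meet: "\<And>i j. i \<in> F \<Longrightarrow> j \<in> F \<Longrightarrow> S i \<inter> S j \<noteq> {}"
  shows "\<exists>i\<in>F. \<forall>j\<in>F. t i \<in> S j"
proof -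
  have "Max ((\<lambda>i. depth (t i)) ` F) \<in> (\<lambda>i. depth (t i)) ` F" using fin by simp
  then obtain i where i: "i \<in> F" "depth (t i) = Max ((\<lambda>i. depth (t i)) ` F)" by auto
  have max: "depth (t j) \<le> depth (t i)" if "j \<in> F" for j
    unfolding i(2) using fin that by simp
  have "t i \<in> S j" if j: "j \<in> F" for j
  proof -
    obtain x where x: "x \<in> S i" "x \<in> S j" using meet i(1) j by blast
    show ?thesis
    proof (cases "t i \<in> S j")
      case False
      then have "t j \<in> S i" using subtree_meet[OF S[OF i(1)] S[OF j] x] by blast
      then have "anc (t j) (t i)" using subtree_anc S i(1) by blast
      then have "t j = t i" using anc_depth max[OF j] by force
      then show ?thesis using S[OF j] by (simp add: subtree_at_def)
    qed
  qed
  then show ?thesis using i(1) by blast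
qed

text \<open>\<open>b x\<close> is the child of \<open>q\<close> above \<open>x\<close>, found by
  iterating \<open>p\<close> one step less than it takes to reach \<open>q\<close>.\<close>

lemma branch_exists:
  "\<exists>b. \<forall>x\<in>M. if p x = q then b x = x else b x = b (p x)"
proof -
  define n where "n x = (LEAST n. (p ^^ Suc n) x = q)" for x
  define b where "b x = (p ^^ n x) x" for x
  have ex: "\<exists>n. (p ^^ Suc n) x = q" if "x \<in> M" for x
    using that
  proof (induction "depth x" arbitrary: x rule: less_induct)
    case less
    show ?case
    proof (cases "p x = q")
      case True
      then show ?thesis by (intro exI[of _ 0]) simp
    next
      case False
      then have "p x \<in> M" using depth(1) less.prems by blast
      then obtain n where "(p ^^ Suc n) (p x) = q" using less depth(2) by blast
      then show ?thesis by (intro exI[of _ "Suc n"]) (simp only: funpow_Suc_right o_apply)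
    qed
  qed
  have "if p x = q then b x = x else b x = b (p x)" if x: "x \<in> M" for x
  proof (cases "p x = q")
    case True
    then have "n x = 0" unfolding n_def by (intro Least_eq_0) simp
    then show ?thesis using True by (simp add: b_def)
  next
    case False
    obtain m where m: "(p ^^ Suc m) x = q" using ex[OF x] by blast
    have "n x = Suc (LEAST m. (p ^^ Suc (Suc m)) x = q)"
      unfolding n_def by (rule Least_Suc[of "\<lambda>n. (p ^^ Suc n) x = q" m, OF m]) (use False in simp)
    also have "(LEAST m. (p ^^ Suc (Suc m)) x = q) = n (p x)"
      unfolding n_def by (simp only: funpow_Suc_right o_apply)
    finally have "n x = Suc (n (p x))" .
    then have "b x = b (p x)" unfolding b_def by (simp only: funpow_Suc_right o_apply)
    then show ?thesis using False by simp
  qed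
  then show ?thesis by blast
qed

end

text \<open>Of the paths \<open>P v\<close> only connectedness and \<open>degree\<close> are kept: a
  node of a path has at most two neighbors on it. The root is a node common to all paths of
  \<open>Q\<close>.\<close>

locale rooted_representation = ugraph adj + parent_structure p q M
  for adj :: "'a \<Rightarrow> 'a \<Rightarrow> bool" and p :: "nat \<Rightarrow> nat" and q M +
  fixes V Q :: "'a set" and P :: "'a \<Rightarrow> nat set"
  assumes fin: "finite V" and Q: "mclique V Q"
    and subtree: "v \<in> V \<Longrightarrow> \<exists>t. subtree_at t (P v)"
    and P_sub: "v \<in> V \<Longrightarrow> P v \<subseteq> insert q M"
    and adj_iff: "u \<in> V \<Longrightarrow> v \<in> V \<Longrightarrow> u \<noteq> v \<Longrightarrow> adj u v \<longleftrightarrow> P u \<inter> P v \<noteq> {}"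
    and degree: "v \<in> V \<Longrightarrow> x \<in> P v \<Longrightarrow> y1 \<in> P v \<Longrightarrow> y2 \<in> P v \<Longrightarrow> y3 \<in> P v \<Longrightarrow>
      (\<And>y. y \<in> {y1, y2, y3} \<Longrightarrow> x \<in> M \<and> p x = y \<or> y \<in> M \<and> p y = x) \<Longrightarrow>
      y1 = y2 \<or> y1 = y3 \<or> y2 = y3"
    and root_in: "v \<in> Q \<Longrightarrow> q \<in> P v"
begin

lemma anc_root: "x \<in> insert q M \<Longrightarrow> anc x q"
  using parent_tree_reach[OF tree] .

lemma subtree_Q: "v \<in> Q \<Longrightarrow> subtree_at q (P v)"
  using subtree[of v] root_in[of v] root mcliqueD(1)[OF Q] unfolding subtree_at_def by blast

lemma up_Q: "v \<in> Q \<Longrightarrow> x \<in> P v \<Longrightarrow> anc x y \<Longrightarrow> y \<in> insert q M \<Longrightarrow> y \<in> P v"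
  using subtree_between[OF subtree_Q] anc_root by blast

text \<open>A path through \<open>q\<close> meets all paths of \<open>Q\<close>, so its vertex would
  extend the maximal clique \<open>Q\<close>.\<close>

lemma root_notin: "v \<in> V \<Longrightarrow> v \<notin> Q \<Longrightarrow> q \<notin> P v"
  using mcliqueD(3)[OF Q, of v] adj_iff[of v] root_in mcliqueD(1)[OF Q] by blast

text \<open>The node \<open>p x\<close> already has its own parent as a neighbor in
  \<open>P v\<close>, which leaves room for one child.\<close>

lemma inj_Q:
  assumes v: "v \<in> Q" and xy: "x \<in> P v" "y \<in> P v" "x \<in> M" "y \<in> M" "p x = p y" "p x \<noteq> q"
  shows "x = y"
proof -
  have vV: "v \<in> V" using v mcliqueD(1)[OF Q] by blast
  have z: "p x \<in> P v" "p x \<in> M" "p (p x) \<in> P v"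
    using subtree_Q[OF v] xy root depth(1)[OF xy(3)] by (auto simp: subtree_at_def)
  have "p (p x) \<noteq> x" "p (p x) \<noteq> y"
    using depth(2)[OF z(2)] depth(2)[OF xy(3)] depth(2)[OF xy(4)] xy(5) by auto
  moreover have "p (p x) = x \<or> p (p x) = y \<or> x = y"
    by (rule degree[OF vV z(1,3) xy(1,2)]) (use z xy in auto)
  ultimately show ?thesis by blast
qed

definition region :: "'a set \<Rightarrow> nat set" where
  "region C = (\<Union>c\<in>C. P c)"

text \<open>A maximal part \<open>W\<close> of \<open>C\<close> with connected region is closed
  under adjacency in \<open>C\<close>, because adjacent vertices have meeting paths.\<close>

lemma region_subtree:
  assumes C: "component V Q C"
  shows "\<exists>t. subtree_at t (region C)"
proof -
  let ?F = "{W. W \<subseteq> C \<and> W \<noteq> {} \<and> (\<exists>t. subtree_at t (region W))}"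
  have CV: "C \<subseteq> V" "C \<noteq> {}" using componentD[OF C] by auto
  have finC: "finite C" using CV fin finite_subset by blast
  have "finite ?F" by (rule finite_subset[of _ "Pow C"]) (use finC in auto)
  moreover obtain c where "c \<in> C" using CV by blast
  then have "{c} \<in> ?F" using subtree[of c] CV by (auto simp: region_def)
  then have "?F \<noteq> {}" by blast
  ultimately obtain W where W: "W \<in> ?F" "\<forall>W'\<in>?F. W \<subseteq> W' \<longrightarrow> W = W'"
    by (meson finite_has_maximal)
  have "W = C"
  proof (rule component_connected[OF C])
    show "W \<subseteq> C" "W \<noteq> {}" using W(1) by auto
    fix x y assume xy: "x \<in> W" "y \<in> C" "adj x y"
    have V: "x \<in> V" "y \<in> V" "x \<noteq> y" using xy CV W(1) adj_irrefl by auto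
    then have "P x \<inter> P y \<noteq> {}" using adj_iff xy by blast
    then have "region W \<inter> P y \<noteq> {}" using xy(1) by (auto simp: region_def)
    moreover obtain t t' where "subtree_at t (region W)" "subtree_at t' (P y)"
      using W(1) subtree[OF V(2)] by blast
    ultimately have "\<exists>t. subtree_at t (region W \<union> P y)" using subtree_Un by blast
    moreover have "region W \<union> P y = region (insert y W)" by (auto simp: region_def)
    ultimately have "insert y W \<in> ?F" using W(1) xy by auto
    then have "W \<subseteq> insert y W \<longrightarrow> W = insert y W" by (rule bspec[OF W(2)])
    then show "y \<in> W" by auto
  qed
  then show ?thesis using W(1) by blast
qed

definition apex :: "'a set \<Rightarrow> nat" where
  "apex C = (SOME t. subtree_at t (region C))"

lemma apex: "component V Q C \<Longrightarrow> subtree_at (apex C) (region C)"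
  unfolding apex_def using region_subtree by (rule someI_ex)

lemma region_sub:
  assumes "component V Q C"
  shows "region C \<subseteq> M"
proof
  fix x assume "x \<in> region C"
  then obtain c where c: "c \<in> C" "x \<in> P c" by (auto simp: region_def)
  then have "c \<in> V" "c \<notin> Q" using componentD[OF assms] by auto
  then show "x \<in> M" using root_notin P_sub c(2) by blast
qed

lemma apex_in: "component V Q C \<Longrightarrow> apex C \<in> region C" "component V Q C \<Longrightarrow> apex C \<in> M"
  using apex region_sub by (auto simp: subtree_at_def)

lemma region_disjoint:
  assumes C: "component V Q C" "component V Q C'" "C \<noteq> C'"
  shows "region C \<inter> region C' = {}"
proof (rule ccontr)
  assume "region C \<inter> region C' \<noteq> {}"
  then obtain c c' where c: "c \<in> C" "c' \<in> C'" "P c \<inter> P c' \<noteq> {}" by (auto simp: region_def)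
  have disj: "C \<inter> C' = {}" using component_unique C by blast
  then have "adj c c'" using c adj_iff[of c c'] componentD(2)[OF C(1)] componentD(2)[OF C(2)] by blast
  then show False
    using componentD(4)[OF C(1) c(1), of c'] c componentD(2,3)[OF C(2)] disj by blast
qed

text \<open>A path of \<open>Q\<close> contains \<open>q\<close> and hence all nodes above any of
  its nodes; so it meets the region of \<open>C\<close> exactly if it contains the top of the
  region.\<close>

lemma foot_iff_apex:
  assumes C: "component V Q C"
  shows "v \<in> foot Q C \<longleftrightarrow> v \<in> Q \<and> apex C \<in> P v"
proof
  assume "v \<in> foot Q C"
  then obtain c where c: "v \<in> Q" "c \<in> C" "adj v c" by (auto simp: foot_def)
  then have "v \<in> V" "c \<in> V" "v \<noteq> c" using mcliqueD(1)[OF Q] componentD[OF C] by auto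
  then obtain x where x: "x \<in> P v" "x \<in> P c" using adj_iff c by blast
  then have "x \<in> region C" using c by (auto simp: region_def)
  then have "anc x (apex C)" using subtree_anc apex[OF C] by blast
  then show "v \<in> Q \<and> apex C \<in> P v" using up_Q[OF c(1) x(1)] c(1) apex_in[OF C] by blast
next
  assume v: "v \<in> Q \<and> apex C \<in> P v"
  obtain c where c: "c \<in> C" "apex C \<in> P c" using apex_in[OF C] by (auto simp: region_def)
  then have "v \<in> V" "c \<in> V" "v \<noteq> c" using v mcliqueD(1)[OF Q] componentD[OF C] by auto
  then show "v \<in> foot Q C" using adj_iff v c by (auto simp: foot_def)
qed

definition branch :: "nat \<Rightarrow> nat" where
  "branch = (SOME b. \<forall>x\<in>M. if p x = q then b x = x else b x = b (p x))"

lemma branch: "x \<in> M \<Longrightarrow> p x = q \<Longrightarrow> branch x = x" "x \<in> M \<Longrightarrow> p x \<noteq> q \<Longrightarrow> branch x = branch (p x)"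
proof -
  have "\<forall>x\<in>M. if p x = q then branch x = x else branch x = branch (p x)"
    unfolding branch_def using branch_exists by (rule someI_ex)
  then show "x \<in> M \<Longrightarrow> p x = q \<Longrightarrow> branch x = x" "x \<in> M \<Longrightarrow> p x \<noteq> q \<Longrightarrow> branch x = branch (p x)"
    by auto
qed

lemma branch_child:
  assumes "x \<in> M"
  shows "anc x (branch x)" "branch x \<in> M" "p (branch x) = q"
proof -
  have "anc x (branch x) \<and> branch x \<in> M \<and> p (branch x) = q"
    using assms
  proof (induction "depth x" arbitrary: x rule: less_induct)
    case less
    show ?case
    proof (cases "p x = q")
      case True
      then show ?thesis using branch(1) less.prems by simp
    next
      case False
      then have "p x \<in> M" using depth(1) less.prems by blast
      then have "anc (p x) (branch (p x)) \<and> branch (p x) \<in> M \<and> p (branch (p x)) = q"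
        using less.hyps[of "p x"] depth(2)[OF less.prems] by blast
      then show ?thesis
        using anc_step[OF less.prems] by (simp only: branch(2)[OF less.prems False])
    qed
  qed
  then show "anc x (branch x)" "branch x \<in> M" "p (branch x) = q" by auto
qed

lemma anc_branch: "anc x y \<Longrightarrow> y \<in> M \<Longrightarrow> branch x = branch y"
proof (induction rule: converse_rtrancl_induct)
  case (step x z)
  then have x: "x \<in> M" "z = p x" by auto
  have "z \<in> M" using step.hyps(2) step.prems anc_cases by blast
  then show ?case using step x branch(2)[of x] root by auto
qed simp

text \<open>Inside one branch \<open>P v\<close> is a single chain, since none of its nodes except
  \<open>q\<close> has two children in it. The induction moves to both parents at once.\<close>

lemma comparable_in_branch:
  assumes v: "v \<in> Q" and xy: "x \<in> P v" "y \<in> P v" "x \<in> M" "y \<in> M" "branch x = branch y"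
  shows "anc x y \<or> anc y x"
  using xy
proof (induction "depth x + depth y" arbitrary: x y rule: less_induct)
  case less
  consider "p x = q" | "p y = q" | "p x \<noteq> q" "p y \<noteq> q" by blast
  then show ?case
  proof cases
    case 1
    then show ?thesis using branch(1) branch_child(1)[of y] less.prems by simp
  next
    case 2
    then show ?thesis using branch(1) branch_child(1)[of x] less.prems by simp
  next
    case 3
    have pM: "p x \<in> M" "p y \<in> M" using 3 depth(1) less.prems by blast+
    have pP: "p x \<in> P v" "p y \<in> P v"
      using subtree_Q[OF v] less.prems root by (auto simp: subtree_at_def)
    have step: "anc a b" if "anc (p a) (p b)" "a \<in> P v" "b \<in> P v" "a \<in> M" "b \<in> M" "p a \<noteq> q" "p b \<noteq> q"
      for a b
    proof -
      show ?thesis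
        using that(1)
      proof (cases rule: rtranclE)
        case base
        then have "a = b" using inj_Q[OF v] that by blast
        then show ?thesis by simp
      next
        \<comment> \<open>\<open>z\<close> is the child of \<open>p b\<close> on the way up from
          \<open>p a\<close>. It lies in \<open>P v\<close>, so injectivity identifies it with
          \<open>b\<close>.\<close>
        case (step z)
        then have z: "z \<in> M" "p z = p b" "anc (p a) z" by auto
        then have "anc a z" using anc_step[OF that(4)] by blast
        then have "z \<in> P v" using up_Q[OF v that(2), of z] z(1) by blast
        then have "z = b" using inj_Q[OF v _ that(3) z(1) that(5) z(2)] that(7) z(2) by simp
        then show ?thesis using \<open>anc a z\<close> by simp
      qed
    qed
    have "depth (p x) + depth (p y) < depth x + depth y"
      using depth(2) less.prems by (intro add_strict_mono) auto
    moreover have "branch (p x) = branch (p y)" using branch(2) 3 less.prems by simp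
    ultimately have "anc (p x) (p y) \<or> anc (p y) (p x)" using less.hyps pP pM by blast
    then show ?thesis using step 3 less.prems by blast
  qed
qed

text \<open>By the Helly property the paths of \<open>K\<close> share a node \<open>x\<close>, which
  lies in the region of \<open>C'\<close>. A vertex \<open>v\<close> in \<open>K\<close> and in the
  foot of \<open>C\<close> makes \<open>x\<close> comparable with the top of \<open>C\<close>, and
  disjointness of the regions puts \<open>x\<close> above it. Then each \<open>w\<close> in the foot
  has \<open>x\<close> on its path, is adjacent to all other vertices of \<open>K\<close>, and so
  belongs to \<open>K\<close>.\<close>

lemma subordinate_if_above:
  assumes C: "component V Q C" and C': "component V Q C'" and ne: "C \<noteq> C'"
    and above: "anc (apex C) (apex C')" and meet: "foot Q C \<inter> foot Q C' \<noteq> {}"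
  shows "subordinate V Q C C'"
proof -
  have "foot Q C \<subseteq> K" if K: "K \<in> nodes V C'" and v: "v \<in> foot Q C" "v \<in> K" for K v
  proof
    fix w assume w: "w \<in> foot Q C"
    have KV: "mclique V K" using K by (simp add: nodes_def)
    have finK: "finite K" using fin mcliqueD(1)[OF KV] finite_subset by blast
    have "\<exists>t. \<forall>k\<in>K. subtree_at (t k) (P k)"
      using subtree mcliqueD(1)[OF KV] by (intro bchoice) blast
    then obtain t where t: "\<And>k. k \<in> K \<Longrightarrow> subtree_at (t k) (P k)" by blast
    have "\<exists>i\<in>K. \<forall>j\<in>K. t i \<in> P j"
    proof (rule subtree_Helly[OF finK _ t])
      show "K \<noteq> {}" using v by blast
      show "P i \<inter> P j \<noteq> {}" if "i \<in> K" "j \<in> K" for i j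
      proof (cases "i = j")
        case True
        then show ?thesis using t[OF that(1)] by (auto simp: subtree_at_def)
      next
        case False
        then show ?thesis
          using adj_iff[of i j] mcliqueD(1,2)[OF KV] that by blast
      qed
    qed
    then obtain x where x: "\<And>k. k \<in> K \<Longrightarrow> x \<in> P k" by blast
    obtain c where c: "c \<in> K" "c \<in> C'" using K by (auto simp: nodes_def)
    have xR: "x \<in> region C'" using x c by (auto simp: region_def)
    then have xM: "x \<in> M" using region_sub[OF C'] by blast
    have xt: "anc x (apex C')" using subtree_anc apex[OF C'] xR by blast
    have vQ: "v \<in> Q" "apex C \<in> P v" using v foot_iff_apex[OF C] by auto
    have "branch x = branch (apex C)"
      using anc_branch[OF xt] anc_branch[OF above] apex_in[OF C'] by simp
    then have "anc x (apex C) \<or> anc (apex C) x"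
      using comparable_in_branch[OF vQ(1)] x[OF v(2)] vQ(2) xM apex_in(2)[OF C] by blast
    moreover have "\<not> anc x (apex C)"
    proof
      assume "anc x (apex C)"
      then have "apex C \<in> region C'" using subtree_between[OF apex[OF C'] _ xR above] by blast
      then show False using region_disjoint[OF C C' ne] apex_in(1)[OF C] by blast
    qed
    ultimately have "anc (apex C) x" by blast
    moreover have wQ: "w \<in> Q" "apex C \<in> P w" using w foot_iff_apex[OF C] by auto
    ultimately have xw: "x \<in> P w" using up_Q xM by blast
    have wV: "w \<in> V" using wQ mcliqueD(1)[OF Q] by blast
    show "w \<in> K"
    proof (rule ccontr)
      assume "w \<notin> K"
      then obtain k where k: "k \<in> K" "\<not> adj w k" using mcliqueD(3)[OF KV wV] by blast
      then have "w \<noteq> k" "k \<in> V" using \<open>w \<notin> K\<close> mcliqueD(1)[OF KV] by auto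
      then show False using adj_iff[OF wV] k xw x[OF k(1)] by blast
    qed
  qed
  then have "\<forall>K\<in>nodes V C'. foot Q C \<subseteq> K \<or> foot Q C \<inter> K = {}" by blast
  then show ?thesis using meet by (simp add: subordinate_def)
qed

text \<open>Tops in one branch that lie on a common path are comparable. Each branch used at
  \<open>v\<close> puts a child of \<open>q\<close> into \<open>P v\<close>, and
  \<open>degree\<close> at \<open>q\<close> allows two.\<close>

lemma colorable: "colorable V Q"
proof -
  have "coloring V Q (\<lambda>C. branch (apex C))"
  proof (rule coloringI)
    fix C C' assume C: "component V Q C" "component V Q C'" "C \<noteq> C'"
      and br: "branch (apex C) = branch (apex C')" and meet: "foot Q C \<inter> foot Q C' \<noteq> {}"
    then obtain v where "v \<in> Q" "apex C \<in> P v" "apex C' \<in> P v"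
      using foot_iff_apex[OF C(1)] foot_iff_apex[OF C(2)] by blast
    then have "anc (apex C) (apex C') \<or> anc (apex C') (apex C)"
      using comparable_in_branch br apex_in(2)[OF C(1)] apex_in(2)[OF C(2)] by blast
    then show "subordinate V Q C C' \<or> subordinate V Q C' C"
      using subordinate_if_above[OF C(1,2,3)] subordinate_if_above[OF C(2,1)] C(3) meet by blast
  next
    fix v C C' C'' assume C: "component V Q C" "component V Q C'" "component V Q C''"
      and v: "v \<in> foot Q C" "v \<in> foot Q C'" "v \<in> foot Q C''"
    have vQ: "v \<in> Q" "v \<in> V" using v mcliqueD(1)[OF Q] by (auto simp: foot_def)
    have b: "branch (apex D) \<in> P v" "branch (apex D) \<in> M" "p (branch (apex D)) = q"
      if D: "component V Q D" "v \<in> foot Q D" for D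
    proof -
      note b = branch_child[OF apex_in(2)[OF D(1)]]
      show "branch (apex D) \<in> M" "p (branch (apex D)) = q" using b by auto
      show "branch (apex D) \<in> P v"
        using up_Q[OF vQ(1) _ b(1)] b(2) D foot_iff_apex[OF D(1)] by blast
    qed
    show "branch (apex C) = branch (apex C') \<or> branch (apex C) = branch (apex C'') \<or>
        branch (apex C') = branch (apex C'')"
      by (rule degree[OF vQ(2) root_in[OF vQ(1)]]) (use b C v in auto)
  qed
  then show ?thesis by (auto simp: colorable_def)
qed

end

section \<open>Induced subgraphs and clique separators\<close>

sublocale graph \<subseteq> U: ugraph "dominates G"
  by unfold_locales (auto dest: adj_not_same intro: arcs_ends_symmetric[OF sym_arcs])

context graph
begin

lemma dominates_restrict: "u \<rightarrow>\<^bsub>G \<restriction> W\<^esub> v \<longleftrightarrow> u \<rightarrow> v \<and> u \<in> W \<and> v \<in> W"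
  by (auto simp: arcs_ends_conv induce_subgraph_def)

lemma clique_iff: "clique G K \<longleftrightarrow> U.mclique (verts G) K"
proof
  assume K: "clique G K"
  have "\<exists>y\<in>K. \<not> x \<rightarrow> y" if "x \<in> verts G - K" for x
  proof (rule ccontr)
    assume "\<not> ?thesis"
    then have "pairwise_adjacent G (insert x K)"
      using K that U.adj_sym by (auto simp: clique_def pairwise_adjacent_def)
    then have "insert x K = K" using K unfolding clique_def by blast
    then show False using that by blast
  qed
  then show "U.mclique (verts G) K"
    using K unfolding U.mclique_def clique_def pairwise_adjacent_def by auto
next
  assume K: "U.mclique (verts G) K"
  have "L = K" if "pairwise_adjacent G L" "K \<subseteq> L" for L
  proof -
    have "L \<subseteq> verts G" "\<And>x y. x \<in> L \<Longrightarrow> y \<in> L \<Longrightarrow> x \<noteq> y \<Longrightarrow> x \<rightarrow> y"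
      using that(1) by (auto simp: pairwise_adjacent_def)
    then show ?thesis using U.mcliqueD[OF K] that(2) by blast
  qed
  then show "clique G K"
    using K unfolding U.mclique_def clique_def pairwise_adjacent_def by auto
qed

lemma clique_restrict_iff: "clique (G \<restriction> W) K \<longleftrightarrow> U.mclique W K"
proof
  assume K: "clique (G \<restriction> W) K"
  have "\<exists>y\<in>K. \<not> x \<rightarrow> y" if "x \<in> W - K" for x
  proof (rule ccontr)
    assume "\<not> ?thesis"
    then have "pairwise_adjacent (G \<restriction> W) (insert x K)"
      using K that U.adj_sym by (auto simp: clique_def pairwise_adjacent_def dominates_restrict)
    then have "insert x K = K" using K unfolding clique_def by blast
    then show False using that by blast
  qed
  then show "U.mclique W K"
    using K unfolding U.mclique_def clique_def pairwise_adjacent_def dominates_restrict by auto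
next
  assume K: "U.mclique W K"
  have "L = K" if "pairwise_adjacent (G \<restriction> W) L" "K \<subseteq> L" for L
  proof -
    have "L \<subseteq> W" "\<And>x y. x \<in> L \<Longrightarrow> y \<in> L \<Longrightarrow> x \<noteq> y \<Longrightarrow> x \<rightarrow> y"
      using that(1) by (auto simp: pairwise_adjacent_def dominates_restrict)
    then show ?thesis using U.mcliqueD[OF K] that(2) by blast
  qed
  then show "clique (G \<restriction> W) K"
    using K unfolding U.mclique_def clique_def pairwise_adjacent_def dominates_restrict by auto
qed

lemma comps_minus_eq: "comps_minus G Q = {C. U.component (verts G) Q C}"
proof -
  let ?H = "G \<restriction> (verts G - Q)"
  have wfH: "wf_digraph ?H" by unfold_locales (auto simp: induce_subgraph_def)
  have symH: "symmetric ?H"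
    unfolding symmetric_def by (rule symI) (auto simp: dominates_restrict intro: U.adj_sym)
  have VH: "verts ?H = verts G - Q" by simp
  have "C \<in> pre_digraph.sccs_verts ?H \<longleftrightarrow> U.component (verts G) Q C" for C
  proof
    assume C: "C \<in> pre_digraph.sccs_verts ?H"
    then have ne: "C \<noteq> {}" and reach: "\<And>u v. u \<in> C \<Longrightarrow> v \<in> C \<Longrightarrow> u \<rightarrow>\<^sup>*\<^bsub>?H\<^esub> v"
      and max: "\<And>u v. u \<in> C \<Longrightarrow> v \<notin> C \<Longrightarrow> \<not> u \<rightarrow>\<^sup>*\<^bsub>?H\<^esub> v \<or> \<not> v \<rightarrow>\<^sup>*\<^bsub>?H\<^esub> u"
      unfolding pre_digraph.sccs_verts_def by auto
    have sub: "C \<subseteq> verts G - Q"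
      using reach reachable_in_vertsE VH by (metis subsetI)
    have closed: "y \<in> C" if "x \<in> C" "y \<in> verts G - Q" "x \<rightarrow> y" for x y
    proof -
      have "x \<rightarrow>\<^bsub>?H\<^esub> y" using that sub by (auto simp: dominates_restrict)
      then have xy: "x \<rightarrow>\<^sup>*\<^bsub>?H\<^esub> y" by (rule wf_digraph.reachable_adjI[OF wfH])
      then have "y \<rightarrow>\<^sup>*\<^bsub>?H\<^esub> x" by (rule symmetric_reachable[OF symH])
      then show ?thesis using max that xy by blast
    qed
    show "U.component (verts G) Q C"
    proof (rule U.componentI[OF ne sub closed])
      fix W assume W: "W \<subseteq> C" "W \<noteq> {}" "\<forall>x\<in>W. \<forall>y\<in>C. x \<rightarrow> y \<longrightarrow> y \<in> W"
      obtain w where w: "w \<in> W" using W by blast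
      have "y \<in> W" if "y \<in> C" for y
      proof -
        have "w \<rightarrow>\<^sup>*\<^bsub>?H\<^esub> y" using reach w W that by blast
        then show ?thesis
        proof (induction rule: wf_digraph.reachable_induct[OF wfH, consumes 1, case_names base step])
          case (step x y)
          then have "x \<rightarrow> y" "y \<in> verts G - Q" by (auto simp: dominates_restrict)
          then show ?case using W closed step by blast
        qed (use w in simp)
      qed
      then show "W = C" using W by blast
    qed
  next
    assume C: "U.component (verts G) Q C"
    note cD = U.componentD[OF C]
    have "u \<rightarrow>\<^sup>*\<^bsub>?H\<^esub> v" if uv: "u \<in> C" "v \<in> C" for u v
    proof -
      have "{y\<in>C. u \<rightarrow>\<^sup>*\<^bsub>?H\<^esub> y} = C"
      proof (rule U.component_connected[OF C])
        have "u \<rightarrow>\<^sup>*\<^bsub>?H\<^esub> u"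
          by (rule wf_digraph.reachable_refl[OF wfH]) (use uv cD in auto)
        then show "{y\<in>C. u \<rightarrow>\<^sup>*\<^bsub>?H\<^esub> y} \<noteq> {}" using uv by blast
        fix x y assume x: "x \<in> {y\<in>C. u \<rightarrow>\<^sup>*\<^bsub>?H\<^esub> y}" and y: "y \<in> C" "x \<rightarrow> y"
        then have "x \<rightarrow>\<^bsub>?H\<^esub> y" using cD by (auto simp: dominates_restrict)
        then show "y \<in> {y\<in>C. u \<rightarrow>\<^sup>*\<^bsub>?H\<^esub> y}"
          using x y wf_digraph.reachable_adj_trans[OF wfH] by blast
      qed auto
      then show ?thesis using uv by blast
    qed
    moreover have "v \<in> C" if "u \<in> C" "u \<rightarrow>\<^sup>*\<^bsub>?H\<^esub> v" for u v
      using that(2)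
    proof (induction rule: wf_digraph.reachable_induct[OF wfH, consumes 1, case_names base step])
      case (step x y)
      then show ?case using cD(4)[of x y] by (auto simp: dominates_restrict)
    qed (use that in simp)
    ultimately show "C \<in> pre_digraph.sccs_verts ?H"
      unfolding pre_digraph.sccs_verts_def using cD(1) by blast
  qed
  then show ?thesis unfolding comps_minus_def by blast
qed

lemma Gamma_eq: "Gamma G Q = (\<lambda>C. G \<restriction> (C \<union> Q)) ` {C. U.component (verts G) Q C}"
  by (simp add: Gamma_def comps_minus_eq)

lemma finite_Gamma: "finite (Gamma G Q)"
  unfolding Gamma_eq using U.finite_components[OF finite_verts] by blast

section \<open>The elements of \<open>Gamma\<close> described by their components\<close>

context
  fixes Q assumes Q: "U.mclique (verts G) Q"
begin

abbreviation "cmp \<equiv> U.component (verts G) Q"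
abbreviation "foot \<equiv> U.foot Q"
abbreviation "sub \<equiv> U.subordinate (verts G) Q"
abbreviation "piece C \<equiv> G \<restriction> (C \<union> Q)"

lemma relevant_cliques_eq:
  assumes C: "cmp C"
  shows "relevant_cliques Q (piece C) = {K\<in>U.nodes (verts G) C. K \<inter> Q \<noteq> {}}"
  using U.mclique_component[OF Q C] U.base_notin_nodes[OF C]
  by (auto simp: relevant_cliques_def clique_restrict_iff)

lemma neighboring_subgraph_iff:
  assumes C: "cmp C" and v: "v \<in> Q"
  shows "neighboring_subgraph Q v (piece C) \<longleftrightarrow> v \<in> foot C"
  unfolding neighboring_subgraph_def relevant_cliques_eq[OF C]
  using U.foot_iff[OF finite_verts U.mcliqueD(1)[OF Q] C] v by auto

lemma foot_subset: "foot C \<subseteq> Q"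
  by (auto simp: U.foot_def)

lemma attached_iff_foot:
  assumes "cmp C" "cmp C'"
  shows "attached Q (piece C) (piece C') \<longleftrightarrow> foot C \<inter> foot C' \<noteq> {}"
  unfolding attached_iff using neighboring_subgraph_iff assms foot_subset by blast

lemma restrict_eq_iff:
  assumes "cmp C" "cmp C'"
  shows "piece C = piece C' \<longleftrightarrow> C = C'"
proof
  assume "piece C = piece C'"
  then have "C \<union> Q = C' \<union> Q" using induce_subgraph_verts by metis
  then show "C = C'" using U.componentD(3)[OF assms(1)] U.componentD(3)[OF assms(2)] by blast
qed simp

lemma dominated_iff_subordinate:
  assumes C: "cmp C" "cmp C'" "C \<noteq> C'"
  shows "dominated Q (piece C) (piece C') \<longleftrightarrow> sub C C'"
proof -
  let ?R = "{K\<in>U.nodes (verts G) C. K \<inter> Q \<noteq> {}}"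
  let ?R' = "{K\<in>U.nodes (verts G) C'. K \<inter> Q \<noteq> {}}"
  have foot: "v \<in> foot C \<longleftrightarrow> v \<in> Q \<and> (\<exists>K\<in>?R. v \<in> K)" for v
    using U.foot_iff[OF finite_verts U.mcliqueD(1)[OF Q] C(1)] by auto
  have "(\<forall>K\<in>?R. K \<inter> Q \<subseteq> K' \<inter> Q) \<longleftrightarrow> foot C \<subseteq> K'" for K'
    using foot by blast
  moreover have "(\<forall>K\<in>?R. K \<inter> K' \<inter> Q = {}) \<longleftrightarrow> foot C \<inter> K' = {}" for K'
    using foot by blast
  moreover have "(\<forall>K'\<in>?R'. foot C \<subseteq> K' \<or> foot C \<inter> K' = {}) \<longleftrightarrow>
      (\<forall>K'\<in>U.nodes (verts G) C'. foot C \<subseteq> K' \<or> foot C \<inter> K' = {})"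
    using foot_subset[of C] by blast
  ultimately show ?thesis
    unfolding dominated_def U.subordinate_def restrict_eq_iff[OF C(1,2)]
      attached_iff_foot[OF C(1,2)] relevant_cliques_eq[OF C(1)] relevant_cliques_eq[OF C(2)]
    using C(3) by simp
qed

lemma antipodal_iff:
  assumes C: "cmp C" "cmp C'"
  shows "antipodal Q (piece C) (piece C') \<longleftrightarrow>
    C \<noteq> C' \<and> foot C \<inter> foot C' \<noteq> {} \<and>
    \<not> sub C C' \<and> \<not> sub C' C"
proof (cases "C = C'")
  case False
  then show ?thesis
    unfolding antipodal_def attached_iff_foot[OF C]
    using dominated_iff_subordinate[OF C False] dominated_iff_subordinate[OF C(2,1)] by auto
qed (simp add: antipodal_def)

text \<open>A component is recovered from its piece by removing \<open>Q\<close> from the vertex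
  set, so colorings can be carried over in both directions.\<close>

lemma strong_colorable_iff: "strong_colorable G Q \<longleftrightarrow> U.colorable (verts G) Q"
proof
  assume "strong_colorable G Q"
  then obtain g where g: "strong_coloring G Q g" by (auto simp: strong_colorable_def)
  note g1 = strong_coloring_antipodal[OF g] and g2 = strong_coloring_two[OF g]
  have \<Gamma>: "piece C \<in> Gamma G Q" if "cmp C" for C
    using that by (auto simp: Gamma_eq)
  have "U.coloring (verts G) Q (\<lambda>C. g (piece C))"
  proof (rule U.coloringI)
    fix C C' assume C: "cmp C" "cmp C'" "C \<noteq> C'"
      "g (piece C) = g (piece C')" "foot C \<inter> foot C' \<noteq> {}"
    then have "\<not> antipodal Q (piece C) (piece C')" using g1 \<Gamma> by metis
    then show "sub C C' \<or> sub C' C"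
      using antipodal_iff[OF C(1,2)] C(3,5) by blast
  next
    fix v C C' C'' assume C: "cmp C" "cmp C'"
      "cmp C''" and v: "v \<in> foot C" "v \<in> foot C'" "v \<in> foot C''"
    then have "v \<in> Q" using foot_subset by blast
    then show "g (piece C) = g (piece C') \<or> g (piece C) = g (piece C'') \<or>
        g (piece C') = g (piece C'')"
      using g2[OF _ \<Gamma>[OF C(1)] \<Gamma>[OF C(2)] \<Gamma>[OF C(3)]] neighboring_subgraph_iff C v by blast
  qed
  then show "U.colorable (verts G) Q" by (auto simp: U.colorable_def)
next
  assume "U.colorable (verts G) Q"
  then obtain g where g: "U.coloring (verts G) Q g" by (auto simp: U.colorable_def)
  have inv: "verts (piece C) - Q = C" if "cmp C" for C
    using U.componentD(3)[OF that] by auto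
  have "strong_coloring G Q (\<lambda>\<gamma>. g (verts \<gamma> - Q))"
    unfolding strong_coloring_def
  proof (intro conjI ballI impI; (elim conjE)?)
    fix \<gamma> \<gamma>' assume "\<gamma> \<in> Gamma G Q" "\<gamma>' \<in> Gamma G Q" and anti: "antipodal Q \<gamma> \<gamma>'"
    then obtain C C' where C: "cmp C" "cmp C'"
      "\<gamma> = piece C" "\<gamma>' = piece C'" by (auto simp: Gamma_eq)
    then show "g (verts \<gamma> - Q) \<noteq> g (verts \<gamma>' - Q)"
      using anti antipodal_iff[OF C(1,2)] U.coloring_comparable[OF g C(1,2)] inv[OF C(1)] inv[OF C(2)]
      by auto
  next
    fix v \<gamma> \<gamma>' \<gamma>'' assume v: "v \<in> Q" and "\<gamma> \<in> Gamma G Q" "\<gamma>' \<in> Gamma G Q" "\<gamma>'' \<in> Gamma G Q"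
      and nb: "neighboring_subgraph Q v \<gamma>" "neighboring_subgraph Q v \<gamma>'" "neighboring_subgraph Q v \<gamma>''"
    then obtain C C' C'' where C: "cmp C" "cmp C'"
      "cmp C''" and eq: "\<gamma> = piece C" "\<gamma>' = piece C'"
      "\<gamma>'' = piece C''"
      by (auto simp: Gamma_eq)
    have "v \<in> foot C" "v \<in> foot C'" "v \<in> foot C''"
      using nb neighboring_subgraph_iff[OF _ v] C unfolding eq by blast+
    then show "g (verts \<gamma> - Q) = g (verts \<gamma>' - Q) \<or> g (verts \<gamma> - Q) = g (verts \<gamma>'' - Q) \<or>
        g (verts \<gamma>' - Q) = g (verts \<gamma>'' - Q)"
      using U.coloring_two[OF g C] inv[OF C(1)] inv[OF C(2)] inv[OF C(3)] unfolding eq by metis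
  qed
  then show "strong_colorable G Q" by (auto simp: strong_colorable_def)
qed

end

lemma hole_free_if_chordal:
  assumes "chordal G"
  shows "U.hole_free (verts G)"
  unfolding U.hole_free_def
proof
  assume "\<exists>xs. 4 \<le> length xs \<and> distinct xs \<and> set xs \<subseteq> verts G \<and>
     (\<forall>i<length xs. \<forall>j<length xs.
        xs ! i \<rightarrow> xs ! j \<longleftrightarrow> j = Suc i mod length xs \<or> i = Suc j mod length xs)"
  then obtain xs where len: "4 \<le> length xs" and xs: "distinct xs" "set xs \<subseteq> verts G"
     and adj: "\<And>i j. i < length xs \<Longrightarrow> j < length xs \<Longrightarrow>
        xs ! i \<rightarrow> xs ! j \<longleftrightarrow> j = Suc i mod length xs \<or> i = Suc j mod length xs" by blast
  have "0 < length xs" using len by linarith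
  then have "graph_cycle G xs"
    using len xs adj by (simp add: graph_cycle_iff)
  then have "induced_cycle G xs" using adj by (simp add: induced_cycle_def)
  then show False using assms len by (auto simp: chordal_def)
qed

lemma clique_separator_iff:
  "clique_separator G Q \<longleftrightarrow> U.mclique (verts G) Q \<and>
     (\<exists>C C'. U.component (verts G) Q C \<and> U.component (verts G) Q C' \<and> C \<noteq> C')"
proof -
  have "2 \<le> card A \<longleftrightarrow> (\<exists>x y. x \<in> A \<and> y \<in> A \<and> x \<noteq> y)" if "finite A" for A :: "'a set set"
    using that by (metis One_nat_def Suc_1 Suc_le_eq card_le_Suc0_iff_eq not_less)
  then show ?thesis
    unfolding clique_separator_def clique_iff comps_minus_eq
    using U.finite_components[OF finite_verts, of Q] by (simp only: mem_Collect_eq conj_assoc)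
qed

text \<open>The induction asks for colorings at all maximal cliques. One that does not separate
  leaves at most one component, and a constant coloring works.\<close>

lemma colorable_if_separators:
  assumes "\<And>Q. clique_separator G Q \<Longrightarrow> strong_colorable G Q" and Q: "U.mclique (verts G) Q"
  shows "U.colorable (verts G) Q"
proof (cases "clique_separator G Q")
  case True
  then show ?thesis using assms strong_colorable_iff by blast
next
  case False
  then have "C = C'" if "U.component (verts G) Q C" "U.component (verts G) Q C'" for C C'
    using that Q unfolding clique_separator_iff by blast
  then have "U.coloring (verts G) Q (\<lambda>_. 0)" by (intro U.coloringI) blast+
  then show ?thesis by (auto simp: U.colorable_def)
qed

text \<open>The tree is rooted twice: at an arbitrary node \<open>r\<close>, to obtain from the
  Helly property a node \<open>q\<close> common to all paths of \<open>Q\<close>, and then at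
  \<open>q\<close>.\<close>

lemma colorable_if_path_graph:
  assumes pg: "path_graph G" and Q: "U.mclique (verts G) Q" and ne: "verts G \<noteq> {}"
  shows "U.colorable (verts G) Q"
proof -
  obtain T :: "(nat, nat \<times> nat) pre_digraph" and \<P> \<phi> where T: "graph_tree T"
    and paths: "\<And>P. P \<in> \<P> \<Longrightarrow> path_of T P" and bij: "bij_betw \<phi> (verts G) \<P>"
    and adj: "\<And>u v. u \<in> verts G \<Longrightarrow> v \<in> verts G \<Longrightarrow> u \<noteq> v \<Longrightarrow>
      u \<rightarrow> v \<longleftrightarrow> verts (\<phi> u) \<inter> verts (\<phi> v) \<noteq> {}"
  proof -
    from pg obtain T :: "(nat, nat \<times> nat) pre_digraph" and \<P> \<phi> where
      "graph_tree T" "\<forall>P\<in>\<P>. path_of T P" "bij_betw \<phi> (verts G) \<P>"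
      "\<forall>u\<in>verts G. \<forall>v\<in>verts G. u \<noteq> v \<longrightarrow> (u \<rightarrow> v \<longleftrightarrow> verts (\<phi> u) \<inter> verts (\<phi> v) \<noteq> {})"
      unfolding path_graph_def by (elim exE conjE) (rule that; assumption)
    then show thesis by (intro that[of T \<P> \<phi>]) auto
  qed
  define P where "P v = verts (\<phi> v)" for v
  have path: "\<exists>xs. vpath xs T \<and> P v = set xs" if "v \<in> verts G" for v
  proof -
    have "\<phi> v \<in> \<P>" using bij that by (auto simp: bij_betw_def)
    then show ?thesis using paths unfolding path_of_def P_def by blast
  qed
  have PT: "P v \<noteq> {}" "P v \<subseteq> verts T" if "v \<in> verts G" for v
    using path[OF that] by (auto simp: vpath_iff)
  have "\<exists>t. parent_structure.subtree_at p M t (P v)"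
    if tree: "parent_tree p q M" and M: "M = verts T - {q}" and v: "v \<in> verts G"
      and e: "\<And>x y. x \<rightarrow>\<^bsub>T\<^esub> y \<longleftrightarrow> x \<in> M \<and> p x = y \<or> y \<in> M \<and> p y = x" for p q M v
  proof -
    interpret parent_structure p q M by unfold_locales (rule tree)
    obtain xs where xs: "vpath xs T" "P v = set xs" using path v by blast
    then have "successively (\<lambda>x y. x \<in> M \<and> p x = y \<or> y \<in> M \<and> p y = x) xs"
      using e by (simp add: vpath_iff)
    then show ?thesis using subtree_vpath[of xs] xs by (auto simp: vpath_iff)
  qed
  note subtree = this
  have QV: "Q \<subseteq> verts G" using U.mcliqueD(1)[OF Q] .
  have "Q \<noteq> {}" using ne U.mcliqueD(3)[OF Q] by blast
  have "\<exists>q. \<forall>v\<in>Q. q \<in> P v"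
  proof -
    obtain r where r: "r \<in> verts T" using ne PT by blast
    obtain p where p: "parent_tree p r (verts T - {r})" and
      e: "\<And>x y. x \<rightarrow>\<^bsub>T\<^esub> y \<longleftrightarrow> x \<in> verts T - {r} \<and> p x = y \<or> y \<in> verts T - {r} \<and> p y = x"
      using graph_tree_parent_tree[OF T r] by blast
    interpret R: parent_structure p r "verts T - {r}" by unfold_locales (rule p)
    have "\<exists>t. \<forall>v\<in>Q. R.subtree_at (t v) (P v)"
      using subtree[OF p refl _ e] QV by (intro bchoice) blast
    then obtain t where t: "\<And>v. v \<in> Q \<Longrightarrow> R.subtree_at (t v) (P v)" by blast
    have "\<exists>i\<in>Q. \<forall>j\<in>Q. t i \<in> P j"
    proof (rule R.subtree_Helly[OF _ \<open>Q \<noteq> {}\<close> t])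
      show "finite Q" using QV finite_verts finite_subset by blast
      show "P i \<inter> P j \<noteq> {}" if "i \<in> Q" "j \<in> Q" for i j
        using adj[of i j] U.mcliqueD(2)[OF Q, of i j] PT(1)[of i] that QV
        unfolding P_def by (cases "i = j") auto
    qed
    then show ?thesis by blast
  qed
  then obtain q where q: "\<And>v. v \<in> Q \<Longrightarrow> q \<in> P v" by blast
  have qT: "q \<in> verts T" using q \<open>Q \<noteq> {}\<close> PT QV by blast
  obtain p where p: "parent_tree p q (verts T - {q})" and
    e: "\<And>x y. x \<rightarrow>\<^bsub>T\<^esub> y \<longleftrightarrow> x \<in> verts T - {q} \<and> p x = y \<or> y \<in> verts T - {q} \<and> p y = x"
    using graph_tree_parent_tree[OF T qT] by blast
  interpret R: rooted_representation "dominates G" p q "verts T - {q}" "verts G" Q P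
  proof (intro rooted_representation.intro parent_structure.intro rooted_representation_axioms.intro)
    show "ugraph (dominates G)" by unfold_locales
    show "parent_tree p q (verts T - {q})" by fact
    show "finite (verts G)" "U.mclique (verts G) Q" using Q by auto
    show "\<exists>t. parent_structure.subtree_at p (verts T - {q}) t (P v)" if "v \<in> verts G" for v
      using subtree[OF p refl that e] .
    show "P v \<subseteq> insert q (verts T - {q})" if "v \<in> verts G" for v using PT(2)[OF that] by blast
    show "u \<rightarrow> v \<longleftrightarrow> P u \<inter> P v \<noteq> {}" if "u \<in> verts G" "v \<in> verts G" "u \<noteq> v" for u v
      using adj[OF that] by (simp add: P_def)
    show "q \<in> P v" if "v \<in> Q" for v using q[OF that] .
    fix v x y1 y2 y3 assume *: "v \<in> verts G" "x \<in> P v" "y1 \<in> P v" "y2 \<in> P v" "y3 \<in> P v"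
      "\<And>y. y \<in> {y1, y2, y3} \<Longrightarrow> x \<in> verts T - {q} \<and> p x = y \<or> y \<in> verts T - {q} \<and> p y = x"
    obtain xs where xs: "vpath xs T" "P v = set xs" using path *(1) by blast
    have "x \<rightarrow>\<^bsub>T\<^esub> y1" "x \<rightarrow>\<^bsub>T\<^esub> y2" "x \<rightarrow>\<^bsub>T\<^esub> y3" unfolding e using *(6) by blast+
    then show "y1 = y2 \<or> y1 = y3 \<or> y2 = y3"
      using graph_tree_path_neighbors[OF T xs(1)] *(2-5) unfolding xs(2) by blast
  qed
  show ?thesis by (rule R.colorable)
qed

end

section \<open>Path representations from clique trees\<close>

context parent_structure
begin

text \<open>The node of least depth has its parent outside \<open>A\<close>, so it is the child of
  \<open>t\<close>, and the rest is a chain below it.\<close>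

lemma parent_chain_list:
  assumes "parent_chain p t A" "A \<subseteq> M" "finite A"
  shows "\<exists>xs. distinct xs \<and> set xs = A \<and> successively (\<lambda>x y. y \<in> M \<and> p y = x) (t # xs)"
  using assms
proof (induction "card A" arbitrary: A t)
  case 0
  then show ?case by (intro exI[of _ "[]"]) simp
next
  case (Suc n)
  have inj: "inj_on p A" and sub: "p ` A \<subseteq> insert t A"
    using Suc.prems by (auto simp: parent_chain_def)
  obtain a where a: "a \<in> A" "\<And>b. b \<in> A \<Longrightarrow> depth a \<le> depth b"
  proof -
    obtain b where "b \<in> A" using Suc.hyps(2) by fastforce
    then show thesis using ex_has_least_nat[of "\<lambda>x. x \<in> A" b depth] that by blast
  qed
  have aM: "a \<in> M" using a Suc.prems by blast
  have "p a \<notin> A" using a(2)[of "p a"] depth(2)[OF aM] by auto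
  then have pa: "p a = t" using sub a(1) by blast
  have "p b \<in> insert a (A - {a})" if "b \<in> A - {a}" for b
    using that sub inj_onD[OF inj, of a b] a(1) pa by auto
  then have "parent_chain p a (A - {a})"
    using inj by (auto simp: parent_chain_def inj_on_diff)
  then obtain xs where xs: "distinct xs" "set xs = A - {a}"
    "successively (\<lambda>x y. y \<in> M \<and> p y = x) (a # xs)"
  proof -
    have "n = card (A - {a})"
      using Suc.hyps(2)[symmetric] Suc.prems(3) a(1) by simp
    then show thesis
      using Suc.hyps(1)[of "A - {a}" a] \<open>parent_chain p a (A - {a})\<close> Suc.prems(2,3) that by blast
  qed
  show ?case
    by (rule exI[of _ "a # xs"]) (use xs a(1) aM pa in auto)
qed

lemma two_chains_list:
  assumes "two_chains p q S" "S \<subseteq> insert q M" "finite S"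
  shows "\<exists>xs. xs \<noteq> [] \<and> distinct xs \<and> set xs = S \<and>
    successively (\<lambda>x y. x \<in> M \<and> p x = y \<or> y \<in> M \<and> p y = x) xs"
proof -
  let ?E = "\<lambda>x y. x \<in> M \<and> p x = y \<or> y \<in> M \<and> p y = x"
  obtain t A B where S: "S = insert t (A \<union> B)" "A \<inter> B = {}" "q \<notin> A \<union> B"
     "parent_chain p t A" "parent_chain p t B"
    using assms(1) by (auto simp: two_chains_def)
  have AB: "A \<subseteq> M" "B \<subseteq> M" "finite A" "finite B" using S assms(2,3) by auto
  obtain as where as: "distinct as" "set as = A" "successively (\<lambda>x y. y \<in> M \<and> p y = x) (t # as)"
    using parent_chain_list[OF S(4) AB(1,3)] by blast
  obtain bs where bs: "distinct bs" "set bs = B" "successively (\<lambda>x y. y \<in> M \<and> p y = x) (t # bs)"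
    using parent_chain_list[OF S(5) AB(2,4)] by blast
  have t: "t \<notin> A" "t \<notin> B" using S(4,5) by (auto simp: parent_chain_def)
  have "successively ?E (rev (t # as))"
    unfolding successively_rev by (rule successively_mono[OF as(3)]) blast
  moreover have "successively ?E (t # bs)"
    by (rule successively_mono[OF bs(3)]) blast
  ultimately have "successively ?E (rev (t # as) @ bs)"
    by (auto simp: successively_append_iff successively_Cons)
  moreover have "distinct (rev (t # as) @ bs)" "set (rev (t # as) @ bs) = S"
    using as bs t S(1,2) by auto
  ultimately show ?thesis by (intro exI[of _ "rev (t # as) @ bs"]) auto
qed

end

text \<open>Used to rename the nodes of a clique tree by natural numbers.\<close>

lemma parent_tree_image:
  assumes tree: "parent_tree p q M" and inj: "inj_on f (insert q M)"
  shows "parent_tree (f \<circ> p \<circ> inv_into (insert q M) f) (f q) (f ` M)"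
proof -
  interpret parent_structure p q M by unfold_locales (rule tree)
  let ?i = "inv_into (insert q M) f"
  have i: "?i (f x) = x" if "x \<in> insert q M" for x using inv_into_f_f[OF inj that] .
  have "f q \<notin> f ` M" using inj root by (auto simp: inj_on_def)
  moreover have "(f \<circ> p \<circ> ?i) y \<in> insert (f q) (f ` M) \<and>
      (depth \<circ> ?i) ((f \<circ> p \<circ> ?i) y) < (depth \<circ> ?i) y" if "y \<in> f ` M" for y
  proof -
    obtain x where x: "x \<in> M" "y = f x" using \<open>y \<in> f ` M\<close> by blast
    then show ?thesis using i[of x] i[OF depth(1)[OF x(1)]] depth[OF x(1)] by auto
  qed
  ultimately show ?thesis unfolding parent_tree_def by blast
qed

definition path_digraph :: "'n list \<Rightarrow> ('n, 'n \<times> 'n) pre_digraph" where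
  "path_digraph xs = \<lparr>verts = set xs, arcs = set (vwalk_arcs xs) \<union> (set (vwalk_arcs xs))\<inverse>,
     tail = fst, head = snd\<rparr>"

lemma path_of_path_digraph:
  assumes T: "wf_digraph T" "symmetric T" "tail T = fst" "head T = snd" and xs: "vpath xs T"
  shows "path_of T (path_digraph xs)"
proof -
  have ends: "arcs_ends T = arcs T" "arcs_ends (path_digraph xs) = arcs (path_digraph xs)"
    using T by (auto simp: arcs_ends_fst_snd path_digraph_def)
  have "set (vwalk_arcs xs) \<subseteq> arcs T" using xs ends by (auto simp: vpath_def vwalk_def)
  moreover from this have "(set (vwalk_arcs xs))\<inverse> \<subseteq> arcs T"
    using arcs_ends_symmetric[OF T(2)] ends(1) by auto
  moreover have "wf_digraph (path_digraph xs)"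
    by unfold_locales (auto simp: path_digraph_def elim: in_set_vwalk_arcsE)
  ultimately have "subgraph (path_digraph xs) T"
    using T xs by (auto simp: subgraph_def path_digraph_def compatible_def vpath_iff)
  then show ?thesis
    using xs ends(2) unfolding path_of_def by (auto simp: path_digraph_def)
qed

text \<open>
  Every vertex gets a private leaf at the end of its path, which makes the paths distinct
  and does not change their intersections.
\<close>

lemma (in graph) path_graph_if_path_tree:
  assumes Q: "U.mclique (verts G) Q" and tree: "path_tree ({K. U.mclique (verts G) K} - {Q}) Q p"
  shows "path_graph G"
proof -
  define V where "V = verts G"
  define N where "N = {K. U.mclique V K}"
  define M where "M = N - {Q}"
  have N: "insert Q M = N" using Q by (auto simp: M_def N_def V_def)
  have T: "path_tree M Q p" using tree by (simp add: M_def N_def V_def)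
  have finV: "finite V" and finM: "finite M" using T by (auto simp: V_def path_tree_def)
  interpret P: parent_structure p Q M by unfold_locales (use T in \<open>simp add: path_tree_def\<close>)
  let ?E = "\<lambda>x y. x \<in> M \<and> p x = y \<or> y \<in> M \<and> p y = x"
  have "\<exists>xs. xs \<noteq> [] \<and> distinct xs \<and> set xs = {K\<in>N. v \<in> K} \<and> successively ?E xs" if v: "v \<in> V" for v
  proof -
    obtain K where "U.mclique V K" "{v} \<subseteq> K" using U.mclique_extend[OF finV, of "{v}"] v by auto
    then have "two_chains p Q {K\<in>N. v \<in> K}"
      using T N unfolding path_tree_def by (auto simp: N_def)
    then show ?thesis
      by (rule P.two_chains_list) (use N finM in auto)
  qed
  then have "\<forall>v\<in>V. \<exists>xs. xs \<noteq> [] \<and> distinct xs \<and> set xs = {K\<in>N. v \<in> K} \<and> successively ?E xs"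
    by (intro ballI)
  from bchoice[OF this] obtain xs where xs: "\<And>v. v \<in> V \<Longrightarrow> xs v \<noteq> [] \<and> distinct (xs v) \<and>
      set (xs v) = {K\<in>N. v \<in> K} \<and> successively ?E (xs v)"
    by (elim exE) (rule that, drule (1) bspec)
  \<comment> \<open>\<open>Inl K\<close> is a node of the clique tree and \<open>Inr v\<close> the
    private leaf of \<open>v\<close>, hung below the last node of its path so that the path can be
    prolonged by it.\<close>
  define M' :: "('a set + 'a) set" where "M' = Inl ` M \<union> Inr ` V"
  define p' :: "'a set + 'a \<Rightarrow> 'a set + 'a" where "p' = case_sum (\<lambda>K. Inl (p K)) (\<lambda>v. Inl (last (xs v)))"
  have X: "insert (Inl Q) M' = Inl ` N \<union> Inr ` V" using N by (auto simp: M'_def)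
  have last: "last (xs v) \<in> N" if "v \<in> V" for v
    using xs[OF that] last_in_set[of "xs v"] by auto
  have tree': "parent_tree p' (Inl Q) M'"
    unfolding parent_tree_def
  proof (intro conjI exI[of _ "case_sum P.depth (\<lambda>v. Suc (P.depth (last (xs v))))"] ballI)
    show "Inl Q \<notin> M'" using P.root by (auto simp: M'_def)
    fix x assume x: "x \<in> M'"
    then consider K where "K \<in> M" "x = Inl K" | v where "v \<in> V" "x = Inr v"
      by (auto simp: M'_def)
    then have "p' x \<in> Inl ` N"
      by cases (use P.depth(1) N last in \<open>simp_all add: p'_def\<close>)
    then show "p' x \<in> insert (Inl Q) M'" unfolding X by blast
    show "case_sum P.depth (\<lambda>v. Suc (P.depth (last (xs v)))) (p' x)
        < case_sum P.depth (\<lambda>v. Suc (P.depth (last (xs v)))) x"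
      using x P.depth(2) by (auto simp: M'_def p'_def)
  qed
  have finM': "finite M'" using finM finV by (simp add: M'_def)
  \<comment> \<open>\<open>path_graph\<close> asks for a tree on natural numbers, hence the
    injective renaming.\<close>
  obtain f :: "'a set + 'a \<Rightarrow> nat" where f: "inj_on f (insert (Inl Q) M')"
    using finite_imp_inj_to_nat_seg[of "insert (Inl Q) M'"] finM' by auto
  define pn where "pn = f \<circ> p' \<circ> inv_into (insert (Inl Q) M') f"
  have pn: "pn (f x) = f (p' x)" if "x \<in> insert (Inl Q) M'" for x
    using inv_into_f_f[OF f that] by (simp add: pn_def)
  interpret n: parent_structure pn "f (Inl Q)" "f ` M'"
    by unfold_locales (use parent_tree_image[OF tree' f] in \<open>simp add: pn_def\<close>)
  define T where "T = parent_digraph pn (f (Inl Q)) (f ` M')"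
  have VT: "verts T = f ` (Inl ` N \<union> Inr ` V)" unfolding X[symmetric] by (simp add: T_def parent_digraph_def)
  have arcT: "x \<rightarrow>\<^bsub>T\<^esub> y \<longleftrightarrow> x \<in> f ` M' \<and> pn x = y \<or> y \<in> f ` M' \<and> pn y = x" for x y
    by (simp add: T_def arcs_ends_parent_digraph)
  define ls where "ls v = map (f \<circ> Inl) (xs v) @ [f (Inr v)]" for v
  have f_eq: "f x = f y \<longleftrightarrow> x = y" if "x \<in> Inl ` N \<union> Inr ` V" "y \<in> Inl ` N \<union> Inr ` V" for x y
    using inj_on_eq_iff[OF f[unfolded X] that] .
  have vpath: "vpath (ls v) T" if v: "v \<in> V" for v
  proof -
    note xsv = xs[OF v]
    have "inj_on (f \<circ> Inl) (set (xs v))" using xsv f_eq by (auto simp: inj_on_def)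
    moreover have "f (Inr v) \<notin> (f \<circ> Inl) ` set (xs v)" using xsv f_eq v by auto
    ultimately have "distinct (ls v)" using xsv by (simp add: ls_def distinct_map)
    moreover have "set (ls v) \<subseteq> verts T" using xsv v by (auto simp: ls_def VT)
    moreover have "successively (dominates T) (ls v)"
    proof -
      have "successively (dominates T) (map (f \<circ> Inl) (xs v))"
        unfolding successively_map
      proof (rule successively_mono)
        show "successively ?E (xs v)" using xsv by simp
        have step: "f (Inl x) \<in> f ` M' \<and> pn (f (Inl x)) = f (Inl (p x))" if "x \<in> M" for x
          using pn[of "Inl x"] that by (auto simp: M'_def p'_def)
        show "(f \<circ> Inl) x \<rightarrow>\<^bsub>T\<^esub> (f \<circ> Inl) y" if "?E x y" for x y
          using that step[of x] step[of y] by (auto simp: arcT)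
      qed
      moreover have "last (map (f \<circ> Inl) (xs v)) \<rightarrow>\<^bsub>T\<^esub> f (Inr v)"
        using pn[of "Inr v"] v xsv by (simp add: arcT M'_def p'_def last_map)
      ultimately show ?thesis by (simp add: ls_def successively_append_iff)
    qed
    ultimately show ?thesis by (simp add: vpath_iff ls_def)
  qed
  have gT: "graph_tree T" unfolding T_def by (rule n.graph_tree_parent_digraph) (use finM' in simp)
  have pof: "path_of T (path_digraph (ls v))" if "v \<in> V" for v
    by (rule path_of_path_digraph[OF _ _ _ _ vpath[OF that]])
      (use n.wf_parent_digraph n.symmetric_parent_digraph in \<open>simp_all add: T_def, simp_all add: parent_digraph_def\<close>)
  have inj: "inj_on (\<lambda>v. path_digraph (ls v)) V"
  proof (rule inj_onI)
    fix u v assume uv: "u \<in> V" "v \<in> V" "path_digraph (ls u) = path_digraph (ls v)"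
    then have "set (ls u) = set (ls v)" by (simp add: path_digraph_def)
    then have "f (Inr u) \<in> set (ls v)" by (auto simp: ls_def)
    then show "u = v" using uv xs f_eq by (auto simp: ls_def)
  qed
  have adj: "u \<rightarrow> v \<longleftrightarrow> verts (path_digraph (ls u)) \<inter> verts (path_digraph (ls v)) \<noteq> {}"
    if uv: "u \<in> V" "v \<in> V" "u \<noteq> v" for u v
  proof -
    have "verts (path_digraph (ls u)) \<inter> verts (path_digraph (ls v)) \<noteq> {} \<longleftrightarrow>
        (\<exists>K\<in>N. u \<in> K \<and> v \<in> K)"
    proof
      assume "verts (path_digraph (ls u)) \<inter> verts (path_digraph (ls v)) \<noteq> {}"
      then obtain y where y: "y \<in> set (ls u)" "y \<in> set (ls v)" by (auto simp: path_digraph_def)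
      have dec: "\<exists>a. y = f a \<and> (a = Inr w \<or> (\<exists>K\<in>N. a = Inl K \<and> w \<in> K))"
        if "w \<in> V" "y \<in> set (ls w)" for w
        using xs[OF that(1)] that(2) by (auto simp: ls_def)
      obtain a b where "y = f a" "a = Inr u \<or> (\<exists>K\<in>N. a = Inl K \<and> u \<in> K)"
        "y = f b" "b = Inr v \<or> (\<exists>K\<in>N. b = Inl K \<and> v \<in> K)"
        using dec[OF uv(1) y(1)] dec[OF uv(2) y(2)] by (elim exE conjE) (rule that)
      then show "\<exists>K\<in>N. u \<in> K \<and> v \<in> K" using f_eq[of a b] uv by auto
    next
      assume "\<exists>K\<in>N. u \<in> K \<and> v \<in> K"
      then obtain K where "K \<in> set (xs u)" "K \<in> set (xs v)" using xs uv by auto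
      then show "verts (path_digraph (ls u)) \<inter> verts (path_digraph (ls v)) \<noteq> {}"
        by (auto simp: path_digraph_def ls_def)
    qed
    also have "\<dots> \<longleftrightarrow> u \<rightarrow> v"
    proof
      assume "\<exists>K\<in>N. u \<in> K \<and> v \<in> K"
      then show "u \<rightarrow> v" using U.mcliqueD(2) uv(3) by (auto simp: N_def)
    next
      assume "u \<rightarrow> v"
      then obtain K where "U.mclique V K" "{u, v} \<subseteq> K"
        using U.mclique_extend[OF finV, of "{u, v}"] uv U.adj_sym by auto
      then show "\<exists>K\<in>N. u \<in> K \<and> v \<in> K" by (auto simp: N_def)
    qed
    finally show ?thesis by blast
  qed
  show ?thesis
    unfolding path_graph_def
  proof (intro exI conjI)
    show "graph_tree T" by (rule gT)
    show "\<forall>P\<in>(\<lambda>v. path_digraph (ls v)) ` verts G. path_of T P" using pof by (auto simp: V_def)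
    show "bij_betw (\<lambda>v. path_digraph (ls v)) (verts G) ((\<lambda>v. path_digraph (ls v)) ` verts G)"
      using inj by (simp add: bij_betw_def V_def)
    show "\<forall>u\<in>verts G. \<forall>v\<in>verts G. u \<noteq> v \<longrightarrow>
        (u \<rightarrow> v \<longleftrightarrow> verts (path_digraph (ls u)) \<inter> verts (path_digraph (ls v)) \<noteq> {})"
      using adj by (auto simp: V_def)
  qed
qed

theorem theorem4:
  fixes G :: "('a,'b) pre_digraph"
    and u :: "'a set \<Rightarrow> nat \<Rightarrow> ('a,'b) pre_digraph set"
  assumes "graph G" and "Digraph_Component.connected G" and "chordal G"
    and "\<And>Q. clique_separator G Q \<Longrightarrow> upper_ordering G Q (u Q)"
  shows "path_graph G \<longleftrightarrow>
    (\<forall>Q. clique_separator G Q \<longrightarrow>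
       (\<nexists>W. full_antipodal_triple G Q W) \<and> weak_colorable G Q (u Q))"
proof -
  interpret graph G by (rule assms(1))
  have ne: "verts G \<noteq> {}"
    using assms(2) by (auto simp: connected_def strongly_connected_def)
  have upper: "ordered_upper G Q (u Q)" if "clique_separator G Q" for Q
    by unfold_locales (use finite_Gamma assms(4) that in auto)
  show ?thesis
  proof (intro iffI allI impI)
    fix Q assume pg: "path_graph G" and Q: "clique_separator G Q"
    interpret ordered_upper G Q "u Q" by (rule upper[OF Q])
    have mQ: "U.mclique (verts G) Q" using Q clique_separator_iff by blast
    have "strong_colorable G Q"
      unfolding strong_colorable_iff[OF mQ] by (rule colorable_if_path_graph[OF pg mQ ne])
    then show "(\<nexists>W. full_antipodal_triple G Q W) \<and> weak_colorable G Q (u Q)"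
      using no_triple_if_strong weak_if_strong by blast
  next
    assume weak: "\<forall>Q. clique_separator G Q \<longrightarrow>
       (\<nexists>W. full_antipodal_triple G Q W) \<and> weak_colorable G Q (u Q)"
    have strong: "strong_colorable G Q" if "clique_separator G Q" for Q
      using ordered_upper.strong_if_weak[OF upper[OF that]] weak that by blast
    \<comment> \<open>Any maximal clique can serve as the root.\<close>
    obtain Q where Q: "U.mclique (verts G) Q"
      using U.mclique_extend[OF finite_verts, of "{}"] by auto
    then obtain p where "path_tree ({K. U.mclique (verts G) K} - {Q}) Q p"
      using U.path_tree_exists[OF finite_verts hole_free_if_chordal[OF assms(3)]]
        colorable_if_separators strong by blast
    then show "path_graph G" by (rule path_graph_if_path_tree[OF Q])
  qed
qed

end
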